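(* Let $\mathcal{H}$ be a hypothesis class on $(\mathcal{X},\Sigma)$ with finite VC dimension $d_{\mathcal{H}}$, and fix $0<\alpha<\frac12$. Let $\mathcal{U}$ be the set of all pairs $(\mu_0,\mu_1)$ of probability distributions on $(\mathcal{X},\Sigma)$ such that $\mathcal{H}_\alpha(\mu_0)$ is non-empty, and for a fixed $\mu_0$ let $\mathcal{U}(\mu_0)$ denote the set of pairs in $\mathcal{U}$ whose first coordinate is $\mu_0$. Let $n$ be such that $\frac{d_{\mathcal{H}}}{n}\le\frac12$. Below, $\inf_{\hat h}$ is over all exact $\alpha$-learners $\hat h$ (knowing $\mu_0$), operating on an i.i.d. sample $S_{\mu_1}\sim\mu_1^n$. (i) Suppose $\mathcal{H}$ separates three points. Then there exists $\mu_0$ (with $\mathcal{H}_\alpha(\mu_0)\neq\emptyset$) such that $$\inf_{\hat h}\ \sup_{(\mu_0,\mu_1)\in\mathcal{U}(\mu_0)}\ \mathbb{E}_{S_{\mu_1}}\,\mathcal{E}_\alpha(\hat h)\ \asymp\ \sqrt{\frac{d_{\mathcal{H}}}{n}}.$$ (ii) Suppose $\mathcal{H}$ does not separate three points. Then: (a) For every $\mu_0$ such that $\mathcal{H}_\alpha(\mu_0)$ is non-empty and does not admit a maximal element, $$\inf_{\hat h}\ \sup_{(\mu_0,\mu_1)\in\mathcal{U}(\mu_0)}\ \mathbb{E}_{S_{\mu_1}}\,\mathcal{E}_\alpha(\hat h)\ \asymp\ \frac{d_{\mathcal{H}}}{n}.$$ (b) For every $\mu_0$ such that $\mathcal{H}_\alpha(\mu_0)$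 admits a maximal element, $$\inf_{\hat h}\ \sup_{(\mu_0,\mu_1)\in\mathcal{U}(\mu_0)}\ \mathbb{E}_{S_{\mu_1}}\,\mathcal{E}_\alpha(\hat h)\ =\ 0.$$
   Context: Setting: $(\mathcal{X},\Sigma)$ is a measurable space in which every singleton $\{x\}$ is measurable. A hypothesis class $\mathcal{H}$ is a set of measurable functions $h:\mathcal{X}\to\{0,1\}$; $\{h=1\}=\{x: h(x)=1\}$. The VC dimension $d_{\mathcal{H}}$ is the largest size of a finite set of points on which $\mathcal{H}$ realizes every $0$-$1$ labeling. For probability distributions $\mu_0,\mu_1$ on $(\mathcal{X},\Sigma)$: $R_{\mu_0}(h)=\mu_0(\{h=1\})$, $R_{\mu_1}(h)=\mu_1(\{h=0\})$, and $\mathcal{H}_\alpha(\mu_0)=\{h\in\mathcal{H}: R_{\mu_0}(h)\le\alpha\}$. The excess risk of $\hat h\in\mathcal{H}$ at level $\alpha$ is $$\mathcal{E}_\alpha(\hat h)=\max\Big\{0,\ R_{\mu_1}(\hat h)-\inf_{h\in\mathcal{H}_\alpha(\mu_0)}R_{\mu_1}(h)\Big\}.$$ Exact $\alpha$-learner (for a given, known $\mu_0$): a map $\hat h$ sending every sample of $n$ points of $\mathcal{X}$ to an element of $\mathcal{H}_\alpha(\mu_0)$; it may depend on $\mu_0$ but not on $\mu_1$, which it accesses only through the i.i.d. sample $S_{\mu_1}\sim\mu_1^n$. The symbol $\hat h$ also denotes the function returned. Maximal element: a subset $\tilde{\mathcal{H}}\subset\mathcal{H}$ admits a maximal element if there is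 $h\in\tilde{\mathcal{H}}$ with $\{h'=1\}\subset\{h=1\}$ for all $h'\in\tilde{\mathcal{H}}$. Three-points-separation: $\mathcal{H}$ separates three points if there exist $h_1,h_2\in\mathcal{H}$ and $x_0,x_1,x_2\in\mathcal{X}$ with (a) $h_1(x_0)=h_2(x_0)=0$, and (b) $h_1(x_1)=h_2(x_2)=1$ and $h_1(x_2)=h_2(x_1)=0$. Notation $\asymp$ means equality of order up to universal constants and $\log n$ factors: $A\asymp B$ means there are universal constants $c,C,k>0$ with $c\,(1+\log n)^{-k}B\le A\le C\,(1+\log n)^{k}B$.
   Formalization: The upper bounds in (i) and (ii)(a), false for arbitrary H, assume that samples on which H realizes a given labeling form a measurable set up to null sets; expectations are outer integrals; constants are universal over spaces inside one set (disjoint unions give full universality). *)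

theory Defs
  imports "HOL-Probability.Probability"
begin

definition hypothesis_class :: "'a measure \<Rightarrow> ('a \<Rightarrow> nat) set \<Rightarrow> bool" where
  "hypothesis_class M H \<longleftrightarrow> H \<subseteq> measurable M (count_space {0, 1})"

definition shattered :: "'a measure \<Rightarrow> ('a \<Rightarrow> nat) set \<Rightarrow> 'a set \<Rightarrow> bool" where
  "shattered M H A \<longleftrightarrow> finite A \<and> A \<subseteq> space M \<and>
     (\<forall>y \<in> A \<rightarrow> {0, 1}. \<exists>h\<in>H. \<forall>x\<in>A. h x = y x)"

definition finite_vc_dim :: "'a measure \<Rightarrow> ('a \<Rightarrow> nat) set \<Rightarrow> bool" where
  "finite_vc_dim M H \<longleftrightarrow> (\<exists>N. \<forall>A. shattered M H A \<longrightarrow> card A \<le> N)"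

definition vc_dim :: "'a measure \<Rightarrow> ('a \<Rightarrow> nat) set \<Rightarrow> nat" where
  "vc_dim M H = Max {card A |A. shattered M H A}"

definition risk0 :: "'a measure \<Rightarrow> ('a \<Rightarrow> nat) \<Rightarrow> real" where
  "risk0 \<mu> h = measure \<mu> {x \<in> space \<mu>. h x = 1}"

definition risk1 :: "'a measure \<Rightarrow> ('a \<Rightarrow> nat) \<Rightarrow> real" where
  "risk1 \<mu> h = measure \<mu> {x \<in> space \<mu>. h x = 0}"

definition feasible :: "('a \<Rightarrow> nat) set \<Rightarrow> real \<Rightarrow> 'a measure \<Rightarrow> ('a \<Rightarrow> nat) set" where
  "feasible H \<alpha> \<mu>0 = {h \<in> H. risk0 \<mu>0 h \<le> \<alpha>}"

definition excess_risk ::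
  "('a \<Rightarrow> nat) set \<Rightarrow> real \<Rightarrow> 'a measure \<Rightarrow> 'a measure \<Rightarrow> ('a \<Rightarrow> nat) \<Rightarrow> real" where
  "excess_risk H \<alpha> \<mu>0 \<mu>1 g = max 0 (risk1 \<mu>1 g - (INF h \<in> feasible H \<alpha> \<mu>0. risk1 \<mu>1 h))"

definition admits_maximal :: "'a measure \<Rightarrow> ('a \<Rightarrow> nat) set \<Rightarrow> bool" where
  "admits_maximal M G \<longleftrightarrow>
     (\<exists>h\<in>G. \<forall>h'\<in>G. {x \<in> space M. h' x = 1} \<subseteq> {x \<in> space M. h x = 1})"

definition separates_three_points :: "'a measure \<Rightarrow> ('a \<Rightarrow> nat) set \<Rightarrow> bool" where
  "separates_three_points M H \<longleftrightarrow>
     (\<exists>h1\<in>H. \<exists>h2\<in>H. \<exists>x0\<in>space M. \<exists>x1\<in>space M. \<exists>x2\<in>space M.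
        h1 x0 = 0 \<and> h2 x0 = 0 \<and>
        h1 x1 = 1 \<and> h2 x2 = 1 \<and> h1 x2 = 0 \<and> h2 x1 = 0)"

definition admissible_pairs ::
  "'a measure \<Rightarrow> ('a \<Rightarrow> nat) set \<Rightarrow> real \<Rightarrow> ('a measure \<times> 'a measure) set" where
  "admissible_pairs M H \<alpha> =
     {(\<mu>0, \<mu>1). \<mu>0 \<in> space (prob_algebra M) \<and> \<mu>1 \<in> space (prob_algebra M) \<and>
                feasible H \<alpha> \<mu>0 \<noteq> {}}"

definition admissible_pairs_at ::
  "'a measure \<Rightarrow> ('a \<Rightarrow> nat) set \<Rightarrow> real \<Rightarrow> 'a measure \<Rightarrow> ('a measure \<times> 'a measure) set" where
  "admissible_pairs_at M H \<alpha> \<mu>0 = {p \<in> admissible_pairs M H \<alpha>. fst p = \<mu>0}"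

text \<open>Learners are arbitrary maps on samples; no measurability is required of them.\<close>

definition exact_learners ::
  "'a measure \<Rightarrow> ('a \<Rightarrow> nat) set \<Rightarrow> real \<Rightarrow> nat \<Rightarrow> 'a measure \<Rightarrow> ((nat \<Rightarrow> 'a) \<Rightarrow> 'a \<Rightarrow> nat) set" where
  "exact_learners M H \<alpha> n \<mu>0 =
     {L. \<forall>S \<in> space (\<Pi>\<^sub>M i\<in>{..<n}. M). L S \<in> feasible H \<alpha> \<mu>0}"

text \<open>Since the excess risk of a learner need not be a measurable function of the sample, its
  expectation is the outer (upper) integral. The library's \<^const>\<open>nn_integral\<close> is the lower
  integral on non-measurable functions, and so would favour non-measurable learners.\<close>

definition outer_expectation :: "'b measure \<Rightarrow> ('b \<Rightarrow> ennreal) \<Rightarrow> ennreal" where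
  "outer_expectation P f =
     (INF g \<in> {g \<in> borel_measurable P. \<forall>x\<in>space P. f x \<le> g x}. \<integral>\<^sup>+ x. g x \<partial>P)"

lemma outer_expectation_eq_nn_integral:
  assumes "f \<in> borel_measurable P"
  shows "outer_expectation P f = (\<integral>\<^sup>+ x. f x \<partial>P)"
  unfolding outer_expectation_def
proof (rule antisym)
  show "(INF g \<in> {g \<in> borel_measurable P. \<forall>x\<in>space P. f x \<le> g x}. \<integral>\<^sup>+ x. g x \<partial>P)
      \<le> (\<integral>\<^sup>+ x. f x \<partial>P)"
    using assms by (intro INF_lower) auto
  show "(\<integral>\<^sup>+ x. f x \<partial>P)
      \<le> (INF g \<in> {g \<in> borel_measurable P. \<forall>x\<in>space P. f x \<le> g x}. \<integral>\<^sup>+ x. g x \<partial>P)"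
    by (intro INF_greatest nn_integral_mono) auto
qed

definition minimax_excess ::
  "'a measure \<Rightarrow> ('a \<Rightarrow> nat) set \<Rightarrow> real \<Rightarrow> nat \<Rightarrow> 'a measure \<Rightarrow> ennreal" where
  "minimax_excess M H \<alpha> n \<mu>0 =
     (INF L \<in> exact_learners M H \<alpha> n \<mu>0.
        SUP (\<nu>0, \<nu>1) \<in> admissible_pairs_at M H \<alpha> \<mu>0.
          outer_expectation (\<Pi>\<^sub>M i\<in>{..<n}. \<nu>1) (\<lambda>S. ennreal (excess_risk H \<alpha> \<nu>0 \<nu>1 (L S))))"

definition log_ge :: "real \<Rightarrow> real \<Rightarrow> nat \<Rightarrow> ennreal \<Rightarrow> real \<Rightarrow> bool" where
  "log_ge c k n A B \<longleftrightarrow> ennreal (c * (1 + ln (real n)) powr (- k) * B) \<le> A"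

definition log_le :: "real \<Rightarrow> real \<Rightarrow> nat \<Rightarrow> ennreal \<Rightarrow> real \<Rightarrow> bool" where
  "log_le C k n A B \<longleftrightarrow> A \<le> ennreal (C * (1 + ln (real n)) powr k * B)"

text \<open>The measurability condition of Vapnik-Chervonenkis theory: the set of samples on which \<open>H\<close>
  realizes a given labeling is measurable, up to null sets of each product distribution. It holds
  for every countable class, and for every class whose members are pointwise limits of sequences
  from a fixed countable subclass. Without some such condition no learner need attain
  the upper rates: let the space be the ordinals below \<open>\<omega>\<^sub>2\<close> and one further point at which
  \<open>\<mu>0\<close> is concentrated, with the sigma-algebra generated by the singleton of that point and the
  initial segments, and let \<open>H\<close> consist of the indicators of the initial segments \<open>[0, \<beta>)\<close>, a chain
  of VC dimension 1 without maximal element. For every learner some \<open>\<beta>\<close> of cofinality \<open>\<omega>\<^sub>1\<close> is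
  closed under it, and against the 0-1 measure giving mass 1 to all \<open>[\<gamma>, \<beta>)\<close>, \<open>\<gamma> < \<beta>\<close>, the
  learner has excess risk 1 for almost every sample, whatever the sample size.\<close>

definition measurable_traces :: "'a measure \<Rightarrow> ('a \<Rightarrow> nat) set \<Rightarrow> bool" where
  "measurable_traces M H \<longleftrightarrow>
     (\<forall>\<mu> \<in> space (prob_algebra M). \<forall>m. \<forall>y :: nat \<Rightarrow> nat.
        {S \<in> space (\<Pi>\<^sub>M i\<in>{..<m}. M). \<exists>h\<in>H. \<forall>i<m. h (S i) = y i}
          \<in> sets (completion (\<Pi>\<^sub>M i\<in>{..<m}. \<mu>)))"

end

theory Submission
  imports Defs "HOL-Probability.Hoeffding"
begin

text \<open>
  If \<open>H\<close> separates three points, there are \<open>k\<close> pairs of points, with \<open>k\<close> of the order of the VC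
  dimension, such that \<open>H\<close> realizes every choice of one point from each pair while vanishing at a
  further point. Under \<open>\<mu>\<^sub>0\<close> each paired point has mass \<open>\<alpha> / k\<close>, so a feasible hypothesis takes at
  most \<open>k\<close> of the \<open>2 k\<close> points, and a learner has to find out which point of each pair is the
  heavier one under \<open>\<mu>\<^sub>1\<close>. Assouad's method with masses \<open>(1 \<plusminus> \<gamma>) / (2 k)\<close> and \<open>\<gamma>\<close> of the order
  \<open>sqrt (k / n)\<close> gives the lower bound. Empirical risk minimization over the feasible hypotheses
  attains this rate by uniform convergence over \<open>H\<close>: symmetrization by swapping a ghost sample and
  the Sauer-Shelah lemma.

  If \<open>H\<close> does not separate three points, hypotheses with a common zero are comparable, and since
  \<open>\<alpha> < 1/2\<close> any two feasible ones have a common zero. The feasible hypotheses thus form a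
  chain, and a learner that covers every sample point some feasible hypothesis covers loses mass
  more than \<open>t\<close> only if the sample misses a fixed set of measure at least \<open>t / 4\<close>. Conversely,
  without a maximal element, whatever is returned on a constant sample misses a point covered by
  another feasible hypothesis, and \<open>\<mu>\<^sub>1\<close> can have mass \<open>1 / (2 n)\<close> there.
\<close>

text \<open>Learners need not be measurable, so bounds on outer expectations pass through measurable
  objects: a measurable exceptional set for upper bounds, finitely many atoms of the product for
  lower bounds. The obstacle is the exceptional set, because the bad event is a union over
  \<open>H\<close>. For uniform convergence the ghost sample makes it depend on the labels of
  \<open>2 * n\<close> points only, which \<open>measurable_traces\<close> handles up to null sets.

  For a chain, the bad event is governed by the union of all hypotheses that lose more than
  \<open>t\<close>, and a chain may have a union of larger outer measure than all its members.
  Fubini excludes this once the order of the chain is a subset of the square that is measurable up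
  to a null set. That order is a trace of \<open>H\<close> on three points, one of them fixed at a
  common zero \<open>z\<close>. Fixing a coordinate respects null sets only at an atom, hence the
  mixture of \<mu>1 with a point mass at \<open>z\<close>. The point \<open>z\<close> comes from the
  missing maximal element: a nearly optimal hypothesis misses some point, and all hypotheses below
  it in the chain miss it as well.\<close>

subsection \<open>Combinatorics\<close>

text \<open>Pajor's strengthening of the Sauer-Shelah lemma, which makes the induction go through.\<close>

lemma card_le_card_shattered:
  assumes "finite A" "F \<subseteq> Pow A"
  shows "card F \<le> card {B. B \<subseteq> A \<and> (\<forall>Y\<subseteq>B. \<exists>X\<in>F. X \<inter> B = Y)}"
  using assms
proof (induction A arbitrary: F rule: finite_induct)
  case empty
  then consider "F = {}" | "F = {{}}" by auto
  then show ?case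
  proof cases
    case 2
    have "{B. B \<subseteq> {} \<and> (\<forall>Y\<subseteq>B. \<exists>X\<in>F. X \<inter> B = Y)} = {{}}" using 2 by auto
    then show ?thesis using 2 by simp
  qed simp
next
  case (insert a A)
  let ?sh = "\<lambda>G A. {B. B \<subseteq> A \<and> (\<forall>Y\<subseteq>B. \<exists>X\<in>G. X \<inter> B = Y)}"
  \<comment> \<open>\<open>F2\<close> collects the traces on \<open>A\<close> that occur in
    \<open>F\<close> both with and without \<open>a\<close>. \<open>F1\<close> counts these once, so
    \<open>F2\<close> restores the count. A set shattered by \<open>F2\<close> stays shattered by
    \<open>F\<close> when \<open>a\<close> is added, which keeps the two families of shattered sets
    disjoint.\<close>
  define F1 where "F1 = (\<lambda>X. X - {a}) ` F"
  define F2 where "F2 = {X \<in> Pow A. X \<in> F \<and> insert a X \<in> F}"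
  have finF: "finite F"
    using insert.prems insert.hyps by (meson finite_Pow_iff finite_insert finite_subset)
  have sub: "F1 \<subseteq> Pow A" "F2 \<subseteq> Pow A" using insert.prems by (auto simp: F1_def F2_def)
  have split: "card F = card F1 + card F2"
  proof -
    let ?N = "{X\<in>F. a \<notin> X}" and ?Y = "{X\<in>F. a \<in> X}"
    let ?Y' = "(\<lambda>X. X - {a}) ` ?Y"
    have "card F = card ?N + card ?Y"
    proof -
      have "F = ?N \<union> ?Y" by blast
      then have "card F = card (?N \<union> ?Y)" by simp
      also have "\<dots> = card ?N + card ?Y"
        using finF by (intro card_Un_disjoint) auto
      finally show ?thesis .
    qed
    also have "card ?Y = card ?Y'"
      by (rule card_image[symmetric], rule inj_onI) blast
    also have "card ?N + card ?Y' = card (?N \<union> ?Y') + card (?N \<inter> ?Y')"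
      by (rule card_Un_Int) (use finF in auto)
    also have "?N \<union> ?Y' = F1"
    proof -
      have "X - {a} = X" if "X \<in> ?N" for X using that by blast
      then have "(\<lambda>X. X - {a}) ` ?N = ?N" by simp
      moreover have "F = ?N \<union> ?Y" by blast
      ultimately show ?thesis unfolding F1_def by (metis (no_types, lifting) image_Un)
    qed
    also have "?N \<inter> ?Y' = F2"
    proof (intro equalityI subsetI)
      fix X assume "X \<in> ?N \<inter> ?Y'"
      then obtain Z where "X \<in> F" "a \<notin> X" "Z \<in> F" "a \<in> Z" "X = Z - {a}" by auto
      then show "X \<in> F2" using insert.prems by (auto simp: F2_def insert_absorb)
    next
      fix X assume X: "X \<in> F2"
      then have "a \<notin> X" using insert.hyps by (auto simp: F2_def)
      then have "X = insert a X - {a}" by auto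
      then show "X \<in> ?N \<inter> ?Y'" using X \<open>a \<notin> X\<close> by (auto simp: F2_def image_iff intro!: bexI[of _ "insert a X"])
    qed
    finally show ?thesis .
  qed
  have finsh: "finite (?sh G C)" if "finite C" for G :: "'a set set" and C
    by (rule finite_subset[of _ "Pow C"]) (use that in auto)
  have "card F \<le> card (?sh F1 A) + card (?sh F2 A)"
    using split insert.IH[OF sub(1)] insert.IH[OF sub(2)] by linarith
  also have "card (?sh F2 A) = card (insert a ` ?sh F2 A)"
  proof (rule card_image[symmetric])
    show "inj_on (insert a) (?sh F2 A)"
      using insert.hyps(2) by (intro inj_onI) (metis (no_types, lifting) mem_Collect_eq insert_ident subsetD)
  qed
  also have "card (?sh F1 A) + card (insert a ` ?sh F2 A) = card (?sh F1 A \<union> insert a ` ?sh F2 A)"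
    by (rule card_Un_disjoint[symmetric]) (use insert.hyps finsh in auto)
  also have "\<dots> \<le> card (?sh F (insert a A))"
  proof (rule card_mono)
    show "finite (?sh F (insert a A))" using insert.hyps finsh by auto
    show "?sh F1 A \<union> insert a ` ?sh F2 A \<subseteq> ?sh F (insert a A)"
    proof (intro Un_least subsetI)
      fix B assume B: "B \<in> ?sh F1 A"
      have BA: "B \<subseteq> A" using B by blast
      have "\<exists>X\<in>F. X \<inter> B = Y" if "Y \<subseteq> B" for Y
      proof -
        from B that obtain X where "X \<in> F1" "X \<inter> B = Y" by blast
        moreover then obtain Z where "Z \<in> F" "X = Z - {a}" unfolding F1_def by blast
        moreover have "a \<notin> B" using BA insert.hyps by blast
        ultimately have "Z \<inter> B = Y" by blast
        then show ?thesis using \<open>Z \<in> F\<close> by blast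
      qed
      then show "B \<in> ?sh F (insert a A)" using BA by blast
    next
      fix B' assume "B' \<in> insert a ` ?sh F2 A"
      then obtain B where B: "B \<in> ?sh F2 A" "B' = insert a B" by blast
      have BA: "B \<subseteq> A" using B by blast
      have "\<exists>X\<in>F. X \<inter> insert a B = Y" if Y: "Y \<subseteq> insert a B" for Y
      proof -
        have "Y - {a} \<subseteq> B" using Y by auto
        then obtain X where X: "X \<in> F2" "X \<inter> B = Y - {a}" using B by blast
        have "a \<notin> X" using X insert.hyps by (auto simp: F2_def)
        show ?thesis
        proof (cases "a \<in> Y")
          case True
          then have "insert a X \<inter> insert a B = Y" using X by blast
          moreover have "insert a X \<in> F" using X by (simp add: F2_def)
          ultimately show ?thesis by blast
        next
          case False
          then have "X \<inter> insert a B = Y" using X \<open>a \<notin> X\<close> by blast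
          moreover have "X \<in> F" using X by (simp add: F2_def)
          ultimately show ?thesis by blast
        qed
      qed
      then show "B' \<in> ?sh F (insert a A)" using BA B(2) by blast
    qed
  qed
  finally show ?case .
qed

lemma sum_choose_le_power: "(\<Sum>i\<le>d. m choose i) \<le> (m + 1) ^ d"
proof (induction d)
  case (Suc d)
  have "m choose Suc d \<le> m * (m + 1) ^ d"
  proof -
    have "m choose Suc d \<le> m ^ Suc d"
      by (cases "Suc d \<le> m") (simp_all add: binomial_le_pow binomial_eq_0 not_le del: power_Suc)
    also have "\<dots> \<le> m * (m + 1) ^ d" by (simp add: power_mono)
    finally show ?thesis .
  qed
  then show ?case using Suc by simp
qed simp

lemma card_subsets_card_le:
  assumes "finite A" shows "card {B. B \<subseteq> A \<and> card B \<le> d} \<le> (card A + 1) ^ d"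
proof -
  have "{B. B \<subseteq> A \<and> card B \<le> d} = (\<Union>i\<le>d. {B. B \<subseteq> A \<and> card B = i})" by auto
  also have "card \<dots> \<le> (\<Sum>i\<le>d. card {B. B \<subseteq> A \<and> card B = i})"
    by (rule card_UN_le) simp
  also have "\<dots> = (\<Sum>i\<le>d. card A choose i)"
    using n_subsets[OF assms] by simp
  finally show ?thesis using sum_choose_le_power le_trans by blast
qed

text \<open>The bound enters the tail estimates only through its logarithm, and logarithmic factors
  are free, so a crude power may replace the sum of binomial coefficients.\<close>

lemma sauer_shelah:
  assumes "finite A" "F \<subseteq> Pow A"
    and "\<And>B. B \<subseteq> A \<Longrightarrow> (\<forall>Y\<subseteq>B. \<exists>X\<in>F. X \<inter> B = Y) \<Longrightarrow> card B \<le> d"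
  shows "card F \<le> (card A + 1) ^ d"
proof -
  have "card F \<le> card {B. B \<subseteq> A \<and> (\<forall>Y\<subseteq>B. \<exists>X\<in>F. X \<inter> B = Y)}"
    by (rule card_le_card_shattered) fact+
  also have "\<dots> \<le> card {B. B \<subseteq> A \<and> card B \<le> d}"
    using assms by (intro card_mono) auto
  also have "\<dots> \<le> (card A + 1) ^ d" by (rule card_subsets_card_le) fact
  finally show ?thesis .
qed

section \<open>Tails of Rademacher sums\<close>

text \<open>This is Hoeffding's lemma for a fair sign: a fair two-point variable of range
  \<open>2 * x\<close> gives the exponent \<open>(2 * x)\<^sup>2 / 8\<close>. Evenness reduces the
  claim to nonnegative \<open>x\<close>.\<close>

lemma cosh_le_exp_square_half:
  fixes x :: real
  shows "exp x + exp (- x) \<le> 2 * exp (x\<^sup>2 / 2)"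
proof -
  have *: "exp x + exp (- x) \<le> 2 * exp (x\<^sup>2 / 2)" if "x \<ge> 0" for x :: real
  proof -
    have "- (2 * x) * (1 / 2) + ln (1 + 1 / 2 * (exp (2 * x) - 1)) \<le> (2 * x)\<^sup>2 / 8"
      by (rule Hoeffdings_lemma_aux) (use that in auto)
    then have "ln ((1 + exp (2 * x)) / 2) \<le> x + x\<^sup>2 / 2"
      by (simp add: power2_eq_square field_simps)
    then have "exp (ln ((1 + exp (2 * x)) / 2)) \<le> exp (x + x\<^sup>2 / 2)" by simp
    then have "(1 + exp (2 * x)) / 2 \<le> exp (x + x\<^sup>2 / 2)"
      by (subst (asm) exp_ln) (auto intro: add_pos_pos)
    then have "exp (- x) * (1 + exp (2 * x)) \<le> exp (- x) * (2 * exp (x + x\<^sup>2 / 2))"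
      by (intro mult_left_mono) auto
    also have "exp (- x) * (1 + exp (2 * x)) = exp (- x) + exp x"
      by (simp add: distrib_left mult_exp_exp)
    also have "exp (- x) * (2 * exp (x + x\<^sup>2 / 2)) = 2 * exp (x\<^sup>2 / 2)"
      by (simp add: mult_exp_exp)
    finally show ?thesis by simp
  qed
  show ?thesis using *[of x] *[of "-x"] by (cases "x \<ge> 0") (auto simp: add.commute)
qed

text \<open>Sign patterns are encoded by the set of flipped positions, so that averaging over random
  signs becomes counting in \<open>Pow {..<n}\<close>, and the same set can name a swap of sample
  points.\<close>

definition flip_sign :: "nat set \<Rightarrow> nat \<Rightarrow> real" where
  "flip_sign I i = (if i \<in> I then -1 else 1)"

lemma rademacher_tail_upper:
  fixes a :: "nat \<Rightarrow> real"
  assumes a: "\<And>i. i < n \<Longrightarrow> \<bar>a i\<bar> \<le> 1" and t: "t \<ge> 0"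
  shows "real (card {I \<in> Pow {..<n}. (\<Sum>i<n. flip_sign I i * a i) > real n * t})
       \<le> 2 ^ n * exp (- (real n * t\<^sup>2 / 2))"
proof -
  let ?B = "{I \<in> Pow {..<n}. (\<Sum>i<n. flip_sign I i * a i) > real n * t}"
  \<comment> \<open>Chernoff's method by counting. The multiplier \<open>t\<close> is the minimizer
    of \<open>n * s\<^sup>2 / 2 - n * s * t\<close> over \<open>s\<close>.\<close>
  let ?e = "\<lambda>I. exp (\<Sum>i<n. t * (flip_sign I i * a i))"
  have "real (card ?B) * exp (real n * t\<^sup>2) = (\<Sum>I\<in>?B. exp (real n * t\<^sup>2))" by simp
  also have "\<dots> \<le> (\<Sum>I\<in>?B. ?e I)"
  proof (rule sum_mono)
    fix I assume "I \<in> ?B"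
    then have "t * (real n * t) \<le> t * (\<Sum>i<n. flip_sign I i * a i)"
      using t by (intro mult_left_mono) auto
    then show "exp (real n * t\<^sup>2) \<le> ?e I"
      by (simp add: sum_distrib_left power2_eq_square algebra_simps)
  qed
  also have "\<dots> \<le> (\<Sum>I\<in>Pow {..<n}. ?e I)" by (rule sum_mono2) auto
  \<comment> \<open>Splitting each product along \<open>I\<close> exhibits the sum over all sign
    patterns as an expanded product of two-term sums, which is independence of the signs in counting
    form.\<close>
  also have "\<dots> = (\<Sum>I\<in>Pow {..<n}. (\<Prod>i\<in>I. exp (- (t * a i))) * (\<Prod>i\<in>{..<n} - I. exp (t * a i)))"
  proof (rule sum.cong[OF refl])
    fix I assume I: "I \<in> Pow {..<n}"
    have "?e I = (\<Prod>i\<in>{..<n}. exp (t * (flip_sign I i * a i)))" by (simp add: exp_sum)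
    also have "\<dots> = (\<Prod>i\<in>I. exp (t * (flip_sign I i * a i))) * (\<Prod>i\<in>{..<n} - I. exp (t * (flip_sign I i * a i)))"
      using I by (subst mult.commute, intro prod.subset_diff) auto
    finally show "?e I = (\<Prod>i\<in>I. exp (- (t * a i))) * (\<Prod>i\<in>{..<n} - I. exp (t * a i))"
      by (simp add: flip_sign_def)
  qed
  also have "\<dots> = (\<Prod>i<n. exp (- (t * a i)) + exp (t * a i))"
    by (rule prod_add[symmetric]) simp
  also have "\<dots> \<le> (\<Prod>i<n. 2 * exp (t\<^sup>2 / 2))"
  proof (rule prod_mono, safe)
    fix i assume i: "i < n"
    have "exp (- (t * a i)) + exp (t * a i) \<le> 2 * exp ((t * a i)\<^sup>2 / 2)"
      using cosh_le_exp_square_half[of "t * a i"] by (simp add: add.commute)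
    also have "(t * a i)\<^sup>2 \<le> t\<^sup>2 * 1"
      using a[OF i] unfolding power_mult_distrib by (intro mult_left_mono) (auto simp: abs_square_le_1)
    finally show "exp (- (t * a i)) + exp (t * a i) \<le> 2 * exp (t\<^sup>2 / 2)" by simp
  qed (simp add: add_nonneg_nonneg)
  also have "\<dots> = 2 ^ n * exp (real n * t\<^sup>2 / 2)" by (simp add: power_mult_distrib exp_of_nat_mult[symmetric])
  finally have "real (card ?B) \<le> 2 ^ n * (exp (real n * t\<^sup>2 / 2) / exp (real n * t\<^sup>2))"
    by (subst times_divide_eq_right, subst pos_le_divide_eq) auto
  also have "exp (real n * t\<^sup>2 / 2) / exp (real n * t\<^sup>2) = exp (- (real n * t\<^sup>2 / 2))"
    unfolding exp_diff[symmetric] by (simp add: algebra_simps)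
  finally show ?thesis .
qed

lemma rademacher_tail:
  fixes a :: "nat \<Rightarrow> real"
  assumes a: "\<And>i. i < n \<Longrightarrow> \<bar>a i\<bar> \<le> 1" and t: "t \<ge> 0"
  shows "real (card {I \<in> Pow {..<n}. \<bar>\<Sum>i<n. flip_sign I i * a i\<bar> > real n * t})
       \<le> 2 * 2 ^ n * exp (- (real n * t\<^sup>2 / 2))"
proof -
  let ?B = "\<lambda>a. {I \<in> Pow {..<n}. (\<Sum>i<n. flip_sign I i * a i) > real n * t}"
  have abs_gt: "\<bar>x\<bar> > y \<longleftrightarrow> x > y \<or> - x > y" for x y :: real by linarith
  have "{I \<in> Pow {..<n}. \<bar>\<Sum>i<n. flip_sign I i * a i\<bar> > real n * t} = ?B a \<union> ?B (\<lambda>i. - a i)"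
    unfolding mult_minus_right sum_negf abs_gt by blast
  then have "real (card {I \<in> Pow {..<n}. \<bar>\<Sum>i<n. flip_sign I i * a i\<bar> > real n * t})
      \<le> real (card (?B a) + card (?B (\<lambda>i. - a i)))"
    by (simp only: of_nat_le_iff card_Un_le)
  moreover have "real (card (?B a)) \<le> 2 ^ n * exp (- (real n * t\<^sup>2 / 2))"
    by (rule rademacher_tail_upper) fact+
  moreover have "real (card (?B (\<lambda>i. - a i))) \<le> 2 ^ n * exp (- (real n * t\<^sup>2 / 2))"
    by (rule rademacher_tail_upper) (use a t in simp_all)
  ultimately show ?thesis unfolding of_nat_add by linarith
qed

subsection \<open>Risks\<close>

lemma prob_algebraD:
  assumes "\<mu> \<in> space (prob_algebra M)"
  shows "prob_space \<mu>" "sets \<mu> = sets M" "space \<mu> = space M"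
  using assms by (auto simp: space_prob_algebra dest: sets_eq_imp_space_eq)

lemma hypothesis_value:
  assumes "hypothesis_class M H" "h \<in> H" "x \<in> space M"
  shows "h x = 0 \<or> h x = 1"
  using assms measurable_space[of h M "count_space {0,1}" x] by (auto simp: hypothesis_class_def)

lemma sets_hypothesis:
  assumes "hypothesis_class M H" "h \<in> H"
  shows "{x \<in> space M. h x = v} \<in> sets M"
proof -
  have h: "h \<in> measurable M (count_space {0, 1})" using assms by (auto simp: hypothesis_class_def)
  have "{x \<in> space M. h x = v} = h -` ({v} \<inter> {0,1}) \<inter> space M"
    using hypothesis_value[OF assms] by auto
  also have "\<dots> \<in> sets M" by (rule measurable_sets[OF h]) auto
  finally show ?thesis .
qed

lemma risk1_eq:
  assumes "hypothesis_class M H" "h \<in> H" "\<mu> \<in> space (prob_algebra M)"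
  shows "risk1 \<mu> h = 1 - measure \<mu> {x \<in> space M. h x = 1}"
proof -
  interpret prob_space \<mu> using prob_algebraD[OF assms(3)] by simp
  note [simp] = prob_algebraD(2,3)[OF assms(3)]
  have "{x \<in> space \<mu>. h x = 0} = space \<mu> - {x \<in> space M. h x = 1}"
    using hypothesis_value[OF assms(1,2)] by auto
  then show ?thesis unfolding risk1_def
    by (simp only:) (subst prob_compl, use sets_hypothesis[OF assms(1,2)] in auto)
qed

lemma risk1_le_1: "\<mu> \<in> space (prob_algebra M) \<Longrightarrow> risk1 \<mu> h \<le> 1"
  using prob_algebraD(1) prob_space.prob_le_1 unfolding risk1_def by metis

lemma risk1_nonneg: "0 \<le> risk1 \<mu> h"
  by (simp add: risk1_def)

lemma bdd_below_risk1: "bdd_below (risk1 \<mu> ` F)"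
  by (rule bdd_belowI[of _ 0]) (auto simp: risk1_nonneg)

lemma excess_risk_nonneg: "0 \<le> excess_risk H \<alpha> \<mu>0 \<mu>1 g"
  by (simp add: excess_risk_def)

lemma excess_risk_ge:
  assumes "h \<in> feasible H \<alpha> \<mu>0"
  shows "risk1 \<mu>1 g - risk1 \<mu>1 h \<le> excess_risk H \<alpha> \<mu>0 \<mu>1 g"
  using cINF_lower[OF bdd_below_risk1 assms, of \<mu>1] by (simp add: excess_risk_def)

lemma excess_risk_le:
  assumes "feasible H \<alpha> \<mu>0 \<noteq> {}" "0 \<le> b"
    and "\<And>h. h \<in> feasible H \<alpha> \<mu>0 \<Longrightarrow> risk1 \<mu>1 g - risk1 \<mu>1 h \<le> b"
  shows "excess_risk H \<alpha> \<mu>0 \<mu>1 g \<le> b"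
proof -
  have "risk1 \<mu>1 g - b \<le> (INF h \<in> feasible H \<alpha> \<mu>0. risk1 \<mu>1 h)"
    using assms by (intro cINF_greatest) (auto simp: algebra_simps)
  then show ?thesis using assms(2) by (simp add: excess_risk_def)
qed

lemma excess_risk_le_1:
  assumes "feasible H \<alpha> \<mu>0 \<noteq> {}" "\<mu>1 \<in> space (prob_algebra M)"
  shows "excess_risk H \<alpha> \<mu>0 \<mu>1 g \<le> 1"
proof (rule excess_risk_le[OF assms(1)])
  fix h assume "h \<in> feasible H \<alpha> \<mu>0"
  show "risk1 \<mu>1 g - risk1 \<mu>1 h \<le> 1"
    using risk1_le_1[OF assms(2), of g] risk1_nonneg[of \<mu>1 h] by linarith
qed simp

lemma shattered_card_le_vc_dim:
  assumes "finite_vc_dim M H" "shattered M H A"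
  shows "card A \<le> vc_dim M H"
proof -
  obtain N where "\<And>A. shattered M H A \<Longrightarrow> card A \<le> N"
    using assms(1) unfolding finite_vc_dim_def by blast
  then have "finite {card A |A. shattered M H A}"
    by (auto intro: finite_subset[OF _ finite_atMost[of N]])
  then show ?thesis unfolding vc_dim_def using assms(2) by (intro Max_ge) auto
qed

lemma ex_shattered_card_eq_vc_dim:
  assumes "finite_vc_dim M H" "H \<noteq> {}"
  obtains A where "shattered M H A" "card A = vc_dim M H"
proof -
  obtain N where "\<And>A. shattered M H A \<Longrightarrow> card A \<le> N"
    using assms(1) unfolding finite_vc_dim_def by blast
  then have "finite {card A |A. shattered M H A}"
    by (auto intro: finite_subset[OF _ finite_atMost[of N]])
  moreover have "shattered M H {}" using assms(2) by (auto simp: shattered_def)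
  ultimately have "vc_dim M H \<in> {card A |A. shattered M H A}"
    unfolding vc_dim_def by (intro Max_in) auto
  then show ?thesis using that by auto
qed

lemma vc_dim_pos:
  assumes "finite_vc_dim M H" "g \<in> H" "h \<in> H" "x \<in> space M" "g x = 0" "h x = 1"
  shows "1 \<le> vc_dim M H"
proof -
  have "shattered M H {x}"
    unfolding shattered_def
  proof (intro conjI ballI)
    fix y :: "'a \<Rightarrow> nat" assume "y \<in> {x} \<rightarrow> {0,1}"
    then have "y x = 0 \<or> y x = 1" by auto
    then show "\<exists>h\<in>H. \<forall>x\<in>{x}. h x = y x" using assms by auto
  qed (use assms in auto)
  from shattered_card_le_vc_dim[OF assms(1) this] show ?thesis by simp
qed

subsection \<open>Outer expectations and the minimax risk\<close>

text \<open>The measurable majorant \<open>a + indicator A\<close> bounds the infimum, so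
  \<open>f\<close> itself may be non-measurable.\<close>

lemma outer_expectation_le:
  assumes "prob_space P" "A \<in> sets P" "0 \<le> a" "0 \<le> b"
    and "\<And>S. S \<in> space P \<Longrightarrow> f S \<le> 1" "\<And>S. S \<in> space P \<Longrightarrow> S \<notin> A \<Longrightarrow> f S \<le> a"
    and "measure P A \<le> b"
  shows "outer_expectation P (\<lambda>S. ennreal (f S)) \<le> ennreal (a + b)"
proof -
  interpret prob_space P by fact
  have "outer_expectation P (\<lambda>S. ennreal (f S)) \<le> (\<integral>\<^sup>+ S. ennreal a + indicator A S \<partial>P)"
    unfolding outer_expectation_def
  proof (rule INF_lower, safe)
    fix S assume S: "S \<in> space P"
    show "ennreal (f S) \<le> ennreal a + indicator A S"
    proof (cases "S \<in> A")
      case True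
      then have "ennreal (f S) \<le> 1" using assms(5)[OF S] by simp
      also have "\<dots> \<le> ennreal a + indicator A S" using True by simp
      finally show ?thesis .
    qed (use assms(6)[OF S] in \<open>auto intro: ennreal_leI\<close>)
  qed (use assms(2) in measurable)
  also have "\<dots> = ennreal a + emeasure P A"
    using assms(2) by (simp add: nn_integral_add emeasure_space_1)
  also have "\<dots> = ennreal (a + measure P A)"
    using assms(3) by (simp add: emeasure_eq_measure)
  also have "\<dots> \<le> ennreal (a + b)" using assms(7) by (intro ennreal_leI) simp
  finally show ?thesis .
qed

lemma minimax_excess_le:
  assumes "L \<in> exact_learners M H \<alpha> n \<mu>0"
    and "\<And>\<mu>1. \<mu>1 \<in> space (prob_algebra M) \<Longrightarrow>
      outer_expectation (\<Pi>\<^sub>M i\<in>{..<n}. \<mu>1) (\<lambda>S. ennreal (excess_risk H \<alpha> \<mu>0 \<mu>1 (L S))) \<le> b"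
  shows "minimax_excess M H \<alpha> n \<mu>0 \<le> b"
  unfolding minimax_excess_def
  by (rule INF_lower2[OF assms(1)], rule SUP_least)
     (auto simp: admissible_pairs_at_def admissible_pairs_def intro: assms(2))

lemma minimax_excess_ge:
  assumes "\<mu>0 \<in> space (prob_algebra M)" "feasible H \<alpha> \<mu>0 \<noteq> {}"
    and "\<And>L. L \<in> exact_learners M H \<alpha> n \<mu>0 \<Longrightarrow> \<exists>\<mu>1 \<in> space (prob_algebra M).
      b \<le> outer_expectation (\<Pi>\<^sub>M i\<in>{..<n}. \<mu>1) (\<lambda>S. ennreal (excess_risk H \<alpha> \<mu>0 \<mu>1 (L S)))"
  shows "b \<le> minimax_excess M H \<alpha> n \<mu>0"
  unfolding minimax_excess_def
proof (rule INF_greatest)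
  fix L assume "L \<in> exact_learners M H \<alpha> n \<mu>0"
  from assms(3)[OF this] obtain \<mu>1 where \<mu>1: "\<mu>1 \<in> space (prob_algebra M)"
    "b \<le> outer_expectation (\<Pi>\<^sub>M i\<in>{..<n}. \<mu>1) (\<lambda>S. ennreal (excess_risk H \<alpha> \<mu>0 \<mu>1 (L S)))"
    by auto
  have "(\<mu>0, \<mu>1) \<in> admissible_pairs_at M H \<alpha> \<mu>0"
    using assms(1,2) \<mu>1 by (simp add: admissible_pairs_at_def admissible_pairs_def)
  then show "b \<le> (SUP (\<nu>0, \<nu>1) \<in> admissible_pairs_at M H \<alpha> \<mu>0.
      outer_expectation (\<Pi>\<^sub>M i\<in>{..<n}. \<nu>1) (\<lambda>S. ennreal (excess_risk H \<alpha> \<nu>0 \<nu>1 (L S))))"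
    by (rule SUP_upper2) (use \<mu>1 in simp)
qed

lemma space_PiM_prob_algebra:
  assumes "\<mu> \<in> space (prob_algebra M)"
  shows "sets (\<Pi>\<^sub>M i\<in>I. \<mu>) = sets (\<Pi>\<^sub>M i\<in>I. M)" "space (\<Pi>\<^sub>M i\<in>I. \<mu>) = space (\<Pi>\<^sub>M i\<in>I. M)"
    "prob_space (\<Pi>\<^sub>M i\<in>I. \<mu>)"
  using prob_algebraD[OF assms] by (simp_all add: space_PiM prob_space_PiM cong: sets_PiM_cong)

text \<open>Every measurable majorant dominates \<open>f\<close> at each of the finitely many
  samples, and these are measurable points of the product. This is what makes the lower bounds valid
  for arbitrary learners.\<close>

lemma outer_expectation_ge_sum:
  fixes f :: "(nat \<Rightarrow> 'a) \<Rightarrow> ennreal"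
  assumes single: "\<forall>x\<in>space M. {x} \<in> sets M" and \<mu>: "\<mu> \<in> space (prob_algebra M)"
    and fin: "finite \<S>" and sub: "\<S> \<subseteq> space (\<Pi>\<^sub>M i\<in>{..<n}. M)"
  shows "(\<Sum>S\<in>\<S>. f S * (\<Prod>i<n. emeasure \<mu> {S i})) \<le> outer_expectation (\<Pi>\<^sub>M i\<in>{..<n}. \<mu>) f"
  unfolding outer_expectation_def
proof (rule INF_greatest, safe)
  let ?P = "\<Pi>\<^sub>M i\<in>{..<n}. \<mu>"
  interpret \<mu>: prob_space \<mu> using prob_algebraD[OF \<mu>] by simp
  interpret product_prob_space "\<lambda>_. \<mu>" "{..<n}" by standard
  fix g :: "(nat \<Rightarrow> 'a) \<Rightarrow> ennreal"
  assume g: "g \<in> borel_measurable ?P" "\<forall>x\<in>space ?P. f x \<le> g x"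
  have S: "{S} = PiE {..<n} (\<lambda>i. {S i})" "\<And>i. i < n \<Longrightarrow> {S i} \<in> sets \<mu>" if "S \<in> \<S>" for S
  proof -
    have "S \<in> PiE {..<n} (\<lambda>_. space M)" using sub that by (auto simp: space_PiM)
    then show "{S i} \<in> sets \<mu>" if "i < n" for i
      using single prob_algebraD(2)[OF \<mu>] that by auto
    show "{S} = PiE {..<n} (\<lambda>i. {S i})"
      using \<open>S \<in> PiE {..<n} (\<lambda>_. space M)\<close> by (subst PiE_singleton) (auto simp: PiE_def)
  qed
  have meas: "{S} \<in> sets ?P" if "S \<in> \<S>" for S
    by (subst S(1)[OF that], rule sets_PiM_I_finite) (use S(2)[OF that] in auto)
  have em: "emeasure ?P {S} = (\<Prod>i<n. emeasure \<mu> {S i})" if "S \<in> \<S>" for S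
    by (subst S(1)[OF that], rule emeasure_PiM) (use S(2)[OF that] in auto)
  have "(\<Sum>S\<in>\<S>. f S * (\<Prod>i<n. emeasure \<mu> {S i})) \<le> (\<Sum>S\<in>\<S>. g S * emeasure ?P {S})"
  proof (rule sum_mono)
    fix S assume "S \<in> \<S>"
    moreover then have "S \<in> space ?P" using sub space_PiM_prob_algebra(2)[OF \<mu>] by blast
    ultimately show "f S * (\<Prod>i<n. emeasure \<mu> {S i}) \<le> g S * emeasure ?P {S}"
      using g(2) em by (simp add: mult_right_mono)
  qed
  also have "\<dots> = (\<integral>\<^sup>+x. (\<Sum>S\<in>\<S>. g S * indicator {S} x) \<partial>?P)"
    using meas by (subst nn_integral_sum) (auto simp: nn_integral_cmult_indicator)
  also have "\<dots> \<le> (\<integral>\<^sup>+x. g x \<partial>?P)"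
  proof (rule nn_integral_mono)
    fix x
    have "(\<Sum>S\<in>\<S>. g S * indicator {S} x) = (\<Sum>S\<in>\<S>. if S = x then g x else 0)"
      by (intro sum.cong) auto
    then show "(\<Sum>S\<in>\<S>. g S * indicator {S} x) \<le> g x"
      using fin by simp
  qed
  finally show "(\<Sum>S\<in>\<S>. f S * (\<Prod>i<n. emeasure \<mu> {S i})) \<le> (\<integral>\<^sup>+x. g x \<partial>?P)" .
qed

subsection \<open>Finitely supported distributions\<close>

text \<open>The weights sit on indices rather than on points, so points that happen to coincide
  simply add up their masses.\<close>

definition discrete_measure :: "'a measure \<Rightarrow> 'b set \<Rightarrow> ('b \<Rightarrow> real) \<Rightarrow> ('b \<Rightarrow> 'a) \<Rightarrow> 'a measure" where
  "discrete_measure M I w q = distr (point_measure I (\<lambda>i. ennreal (w i))) M q"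

lemma
  assumes "finite I" "\<And>i. i \<in> I \<Longrightarrow> 0 \<le> w i" "sum w I = 1" "q \<in> I \<rightarrow> space M"
  shows discrete_measure_in_prob_algebra: "discrete_measure M I w q \<in> space (prob_algebra M)" (is ?A)
    and emeasure_discrete_measure:
      "X \<in> sets M \<Longrightarrow> emeasure (discrete_measure M I w q) X = ennreal (\<Sum>i\<in>{i\<in>I. q i \<in> X}. w i)"
    and measure_discrete_measure:
      "X \<in> sets M \<Longrightarrow> measure (discrete_measure M I w q) X = (\<Sum>i\<in>{i\<in>I. q i \<in> X}. w i)"
proof -
  let ?p = "point_measure I (\<lambda>i. ennreal (w i))"
  have q: "q \<in> measurable ?p M"
    using assms(4) by (simp add: measurable_point_measure_eq1)
  have em: "emeasure (discrete_measure M I w q) X = ennreal (\<Sum>i\<in>{i\<in>I. q i \<in> X}. w i)"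
    if "X \<in> sets M" for X
  proof -
    have "q -` X \<inter> space ?p = {i\<in>I. q i \<in> X}" by (auto simp: space_point_measure)
    then have "emeasure (discrete_measure M I w q) X = emeasure ?p {i\<in>I. q i \<in> X}"
      unfolding discrete_measure_def using emeasure_distr[OF q that] by simp
    also have "\<dots> = (\<Sum>i\<in>{i\<in>I. q i \<in> X}. ennreal (w i))"
      by (rule emeasure_point_measure_finite) (use assms(1) in auto)
    also have "\<dots> = ennreal (\<Sum>i\<in>{i\<in>I. q i \<in> X}. w i)"
      using assms(2) by (subst sum_ennreal) auto
    finally show ?thesis .
  qed
  then show "X \<in> sets M \<Longrightarrow> emeasure (discrete_measure M I w q) X = ennreal (\<Sum>i\<in>{i\<in>I. q i \<in> X}. w i)" .
  then show "X \<in> sets M \<Longrightarrow> measure (discrete_measure M I w q) X = (\<Sum>i\<in>{i\<in>I. q i \<in> X}. w i)"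
    using em by (subst measure_def) (subst em, simp, rule enn2real_ennreal, rule sum_nonneg, use assms(2) in auto)
  have "{i\<in>I. q i \<in> space M} = I" using assms(4) by blast
  moreover have "emeasure (discrete_measure M I w q) (space M) = ennreal (\<Sum>i\<in>{i\<in>I. q i \<in> space M}. w i)"
    by (rule em) simp
  ultimately have 1: "emeasure (discrete_measure M I w q) (space M) = 1"
    using assms(3) by simp
  have space: "space (discrete_measure M I w q) = space M" and sets: "sets (discrete_measure M I w q) = sets M"
    by (simp_all add: discrete_measure_def)
  have "prob_space (discrete_measure M I w q)"
    by (rule prob_spaceI) (simp only: space 1)
  then show ?A using sets by (simp add: space_prob_algebra)
qed

subsection \<open>Lower bound for separating classes\<close>

lemma sum_lessThan_double:
  fixes f :: "nat \<Rightarrow> 'c::comm_monoid_add"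
  shows "(\<Sum>i<2 * k. f i) = (\<Sum>j<k. f (2 * j) + f (2 * j + 1))"
  by (induction k) (simp_all add: ac_simps)

text \<open>Le Cam's inequality between testing error and Hellinger affinity: \<open>P * Q\<close>
  is the product of minimum and maximum, Cauchy-Schwarz separates them, and the maxima sum to at
  most 2. The affinity is preferable to the minimum because it is multiplicative over
  samples.\<close>

lemma sum_min_ge_affinity:
  fixes P Q :: "'b \<Rightarrow> real"
  assumes fin: "finite T" and nn: "\<And>x. x \<in> T \<Longrightarrow> 0 \<le> P x" "\<And>x. x \<in> T \<Longrightarrow> 0 \<le> Q x"
    and s: "sum P T = 1" "sum Q T = 1"
  shows "(\<Sum>x\<in>T. sqrt (P x * Q x))\<^sup>2 / 2 \<le> (\<Sum>x\<in>T. min (P x) (Q x))"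
proof -
  let ?m = "\<lambda>x. min (P x) (Q x)" and ?M = "\<lambda>x. max (P x) (Q x)"
  have "(\<Sum>x\<in>T. sqrt (P x * Q x))\<^sup>2 = (\<Sum>x\<in>T. sqrt (?m x) * sqrt (?M x))\<^sup>2"
    by (intro arg_cong[where f="\<lambda>x. x\<^sup>2"] sum.cong) (auto simp: min_def max_def real_sqrt_mult)
  also have "\<dots> \<le> (\<Sum>x\<in>T. (sqrt (?m x))\<^sup>2) * (\<Sum>x\<in>T. (sqrt (?M x))\<^sup>2)"
    by (rule Cauchy_Schwarz_ineq_sum)
  also have "\<dots> = (\<Sum>x\<in>T. ?m x) * (\<Sum>x\<in>T. ?M x)"
    by (intro arg_cong2[where f="(*)"] sum.cong) (use nn in \<open>auto simp: le_max_iff_disj\<close>)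
  also have "\<dots> \<le> (\<Sum>x\<in>T. ?m x) * (\<Sum>x\<in>T. P x + Q x)"
    by (intro mult_left_mono sum_mono sum_nonneg) (use nn in auto)
  also have "(\<Sum>x\<in>T. P x + Q x) = 2" using s by (simp add: sum.distrib)
  finally show ?thesis by simp
qed

text \<open>The indices \<open>2 * j\<close> and \<open>2 * j + 1\<close> form the \<open>j\<close>-th pair; the second of them is heavy iff
  \<open>j \<in> \<sigma>\<close>.\<close>

definition heavy :: "nat set \<Rightarrow> nat \<Rightarrow> bool" where
  "heavy \<sigma> i \<longleftrightarrow> (odd i \<longleftrightarrow> i div 2 \<in> \<sigma>)"

definition pair_weight :: "nat \<Rightarrow> real \<Rightarrow> nat set \<Rightarrow> nat \<Rightarrow> real" where
  "pair_weight k \<gamma> \<sigma> i = (1 + (if heavy \<sigma> i then \<gamma> else - \<gamma>)) / (2 * real k)"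

lemma heavy_simps [simp]: "heavy \<sigma> (2 * j) \<longleftrightarrow> j \<notin> \<sigma>" "heavy \<sigma> (Suc (2 * j)) \<longleftrightarrow> j \<in> \<sigma>"
  by (auto simp: heavy_def)

lemma pair_weight_nonneg: "\<bar>\<gamma>\<bar> \<le> 1 \<Longrightarrow> 0 \<le> pair_weight k \<gamma> \<sigma> i"
  by (auto simp: pair_weight_def)

lemma pair_weight_pair: "pair_weight k \<gamma> \<sigma> (2 * l) + pair_weight k \<gamma> \<sigma> (2 * l + 1) = 1 / real k"
  by (auto simp: pair_weight_def add_divide_distrib[symmetric])

lemma sum_pair_weight: "0 < k \<Longrightarrow> (\<Sum>i<2*k. pair_weight k \<gamma> \<sigma> i) = 1"
  unfolding sum_lessThan_double pair_weight_pair by simp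

lemma sum_PiE_prod:
  fixes f :: "'b \<Rightarrow> real"
  assumes "finite X"
  shows "(\<Sum>T\<in>PiE {..<n} (\<lambda>_. X). \<Prod>i<n. f (T i)) = (sum f X) ^ n"
  using prod_sum_PiE[of "{..<n}" "\<lambda>_. X" "\<lambda>_. f"] assms by simp

text \<open>A pair other than the \<open>j\<close>-th has equal weights under both parameters and
  contributes its full mass \<open>1 / k\<close>. The \<open>j\<close>-th contributes at least
  \<open>(1 - \<gamma>\<^sup>2) / k\<close>, because a square root on the unit interval is at least
  its argument.\<close>

lemma pair_affinity_ge:
  assumes k: "0 < k" and \<gamma>: "\<bar>\<gamma>\<bar> \<le> 1" and j: "j < k" "j \<notin> \<sigma>"
  shows "1 - \<gamma>\<^sup>2 / real k
    \<le> (\<Sum>i<2*k. sqrt (pair_weight k \<gamma> \<sigma> i * pair_weight k \<gamma> (insert j \<sigma>) i))"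
proof -
  let ?w = "pair_weight k \<gamma>"
  let ?s = "\<lambda>i. sqrt (?w \<sigma> i * ?w (insert j \<sigma>) i)"
  have \<gamma>2: "\<gamma>\<^sup>2 \<le> 1" using \<gamma> by (simp add: abs_square_le_1)
  have eq: "?s i = ?w \<sigma> i" if "i div 2 \<noteq> j" for i
  proof -
    have "?w (insert j \<sigma>) i = ?w \<sigma> i" using that by (simp add: pair_weight_def heavy_def)
    then show ?thesis using pair_weight_nonneg[OF \<gamma>, of k \<sigma> i] by simp
  qed
  have ge: "(1 - \<gamma>\<^sup>2) / (2 * real k) \<le> ?s i" if i: "i div 2 = j" for i
  proof (rule real_le_rsqrt)
    have "?w \<sigma> i * ?w (insert j \<sigma>) i = (1 - \<gamma>\<^sup>2) / (2 * real k)\<^sup>2"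
      using i j(2) by (auto simp: pair_weight_def heavy_def power2_eq_square field_simps)
    moreover have "(1 - \<gamma>\<^sup>2)\<^sup>2 \<le> (1 - \<gamma>\<^sup>2) * 1"
      unfolding power2_eq_square[of "1 - \<gamma>\<^sup>2"] using \<gamma>2 by (intro mult_left_mono) auto
    ultimately show "((1 - \<gamma>\<^sup>2) / (2 * real k))\<^sup>2 \<le> ?w \<sigma> i * ?w (insert j \<sigma>) i"
      by (simp add: power_divide divide_right_mono)
  qed
  have "1 - \<gamma>\<^sup>2 / real k = (\<Sum>l<k. if l = j then (1 - \<gamma>\<^sup>2) / real k else 1 / real k)"
  proof -
    have "(\<Sum>l<k. if l = j then (1 - \<gamma>\<^sup>2) / real k else 1 / real k)
      = (\<Sum>l<k. 1 / real k - (if l = j then \<gamma>\<^sup>2 / real k else 0))"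
      by (intro sum.cong) (auto simp: diff_divide_distrib)
    also have "\<dots> = 1 - \<gamma>\<^sup>2 / real k" using k j by (simp add: sum_subtractf)
    finally show ?thesis by simp
  qed
  also have "\<dots> \<le> (\<Sum>l<k. ?s (2 * l) + ?s (2 * l + 1))"
  proof (rule sum_mono)
    fix l
    show "(if l = j then (1 - \<gamma>\<^sup>2) / real k else 1 / real k) \<le> ?s (2 * l) + ?s (2 * l + 1)"
    proof (cases "l = j")
      case True
      then show ?thesis using ge[of "2 * l"] ge[of "2 * l + 1"] k
        by (simp add: field_simps)
    next
      case False
      then have "?s (2 * l) + ?s (2 * l + 1) = ?w \<sigma> (2 * l) + ?w \<sigma> (2 * l + 1)"
        by (simp only: eq)
      also have "\<dots> = 1 / real k" by (rule pair_weight_pair)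
      finally show ?thesis using False by simp
    qed
  qed
  also have "\<dots> = (\<Sum>i<2*k. ?s i)" by (rule sum_lessThan_double[symmetric])
  finally show ?thesis .
qed

text \<open>Assouad's averaging matches each parameter with the one that differs from it only in
  coordinate \<open>j\<close>.\<close>

lemma sum_Pow_insert_pairs:
  fixes f :: "'b set \<Rightarrow> real"
  assumes "finite A" "j \<in> A"
  shows "(\<Sum>\<sigma>\<in>Pow A. f \<sigma>) = (\<Sum>\<sigma>\<in>Pow (A - {j}). f \<sigma> + f (insert j \<sigma>))"
proof -
  have A: "A = insert j (A - {j})" using assms by auto
  have "(\<Sum>\<sigma>\<in>Pow A. f \<sigma>) = (\<Sum>\<sigma>\<in>Pow (A - {j}) \<union> insert j ` Pow (A - {j}). f \<sigma>)"
    by (subst A, subst Pow_insert) simp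
  also have "\<dots> = (\<Sum>\<sigma>\<in>Pow (A - {j}). f \<sigma>) + (\<Sum>\<sigma>\<in>insert j ` Pow (A - {j}). f \<sigma>)"
    using assms by (intro sum.union_disjoint) auto
  also have "(\<Sum>\<sigma>\<in>insert j ` Pow (A - {j}). f \<sigma>) = (\<Sum>\<sigma>\<in>Pow (A - {j}). f (insert j \<sigma>))"
    by (subst sum.reindex) (auto simp: inj_on_def)
  finally show ?thesis by (simp add: sum.distrib)
qed

text \<open>Flipping one pair changes the affinity of the sample distributions by at most a factor
  \<open>(1 - \<gamma>\<^sup>2 / k) ^ n \<ge> 3 / 4\<close>, so no test detects the heavier point of a pair reliably.\<close>

lemma assouad_pairs:
  fixes \<tau> :: "nat \<Rightarrow> (nat \<Rightarrow> nat) \<Rightarrow> bool"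
  assumes k: "0 < k" "k \<le> 4 * n" and n: "0 < n"
  defines "\<gamma> \<equiv> sqrt (real k / (4 * real n))"
  defines "W \<equiv> \<lambda>\<sigma> T. \<Prod>i<n. pair_weight k \<gamma> \<sigma> (T i)"
  defines "X \<equiv> PiE {..<n} (\<lambda>_. {..<2*k})"
  shows "2 ^ k * real k * (9/64)
    \<le> (\<Sum>\<sigma>\<in>Pow {..<k}. \<Sum>T\<in>X. W \<sigma> T * (\<Sum>j<k. if \<tau> j T \<longleftrightarrow> j \<in> \<sigma> then 0 else 1))"
proof -
  have \<gamma>2: "\<gamma>\<^sup>2 = real k / (4 * real n)" unfolding \<gamma>_def by simp
  have "\<gamma>\<^sup>2 \<le> 1" unfolding \<gamma>2 using k n by (simp add: field_simps flip: of_nat_mult)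
  then have \<gamma>1: "\<bar>\<gamma>\<bar> \<le> 1" by (simp add: abs_square_le_1)
  have finX: "finite X" unfolding X_def by (intro finite_PiE) auto
  have W0: "0 \<le> W \<sigma> T" for \<sigma> T
    unfolding W_def by (intro prod_nonneg) (auto intro: pair_weight_nonneg \<gamma>1)
  have W1: "sum (W \<sigma>) X = 1" for \<sigma>
    unfolding W_def X_def using sum_pair_weight[OF k(1)] by (subst sum_PiE_prod) auto
  have test: "9 / 32 \<le> (\<Sum>T\<in>X. min (W \<sigma> T) (W (insert j \<sigma>) T))" if j: "j < k" "j \<notin> \<sigma>" for \<sigma> j
  proof -
    let ?s = "\<lambda>i. sqrt (pair_weight k \<gamma> \<sigma> i * pair_weight k \<gamma> (insert j \<sigma>) i)"
    \<comment> \<open>The choice of \<gamma> makes \<open>\<gamma>\<^sup>2 / k\<close> equal to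
      \<open>1 / (4 * n)\<close> whatever \<open>k\<close> is, so Bernoulli's inequality applies
      uniformly. The constant is \<open>9 / 32 = (3 / 4)\<^sup>2 / 2\<close>.\<close>
    have "3 / 4 = 1 + real n * (- (1 / (4 * real n)))" using n by simp
    also have "\<dots> \<le> (1 + - (1 / (4 * real n))) ^ n"
      by (rule Bernoulli_inequality) (use n in \<open>simp add: field_simps\<close>)
    also have "\<dots> = (1 - \<gamma>\<^sup>2 / real k) ^ n" using k by (simp add: \<gamma>2)
    also have "\<dots> \<le> (sum ?s {..<2*k}) ^ n"
    proof (rule power_mono[OF pair_affinity_ge])
      show "0 \<le> 1 - \<gamma>\<^sup>2 / real k" using k n by (simp add: \<gamma>2)
    qed (use k \<gamma>1 j in auto)
    also have "\<dots> = (\<Sum>T\<in>X. \<Prod>i<n. ?s (T i))"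
      unfolding X_def by (rule sum_PiE_prod[symmetric]) simp
    also have "\<dots> = (\<Sum>T\<in>X. sqrt (W \<sigma> T * W (insert j \<sigma>) T))"
      unfolding W_def prod.distrib[symmetric]
      by (intro sum.cong refl) (induction n, auto simp: real_sqrt_mult)
    finally have "(3 / 4)\<^sup>2 / 2 \<le> (\<Sum>T\<in>X. sqrt (W \<sigma> T * W (insert j \<sigma>) T))\<^sup>2 / 2"
      by (intro divide_right_mono power_mono) auto
    also have "\<dots> \<le> (\<Sum>T\<in>X. min (W \<sigma> T) (W (insert j \<sigma>) T))"
      by (rule sum_min_ge_affinity) (use finX W0 W1 in auto)
    finally show ?thesis by (simp add: power2_eq_square)
  qed
  have coord: "2 ^ k * (9/64) \<le> (\<Sum>\<sigma>\<in>Pow {..<k}. \<Sum>T\<in>X. W \<sigma> T * (if \<tau> j T \<longleftrightarrow> j \<in> \<sigma> then 0 else 1))"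
    (is "_ \<le> sum ?f _") if j: "j < k" for j
  proof -
    \<comment> \<open>There are \<open>2 ^ (k - 1)\<close> matched pairs of parameters, and each
      will contribute \<open>9 / 32\<close>.\<close>
    have "2 ^ k * (9/64) = (\<Sum>\<sigma>\<in>Pow ({..<k} - {j}). 9 / 32 :: real)"
    proof -
      have "2 ^ k = 2 * (2 ^ (k - 1) :: real)" using k by (cases k) auto
      then show ?thesis using j by (simp add: card_Pow)
    qed
    also have "\<dots> \<le> (\<Sum>\<sigma>\<in>Pow ({..<k} - {j}). ?f \<sigma> + ?f (insert j \<sigma>))"
    proof (rule sum_mono)
      fix \<sigma> assume "\<sigma> \<in> Pow ({..<k} - {j})"
      then have "j \<notin> \<sigma>" by auto
      have "9 / 32 \<le> (\<Sum>T\<in>X. min (W \<sigma> T) (W (insert j \<sigma>) T))" by (rule test) fact+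
      \<comment> \<open>Whatever \<open>\<tau> j T\<close> answers, it is wrong under one of the two
        parameters, so at least the smaller weight is paid.\<close>
      also have "\<dots> \<le> (\<Sum>T\<in>X. W \<sigma> T * (if \<tau> j T \<longleftrightarrow> j \<in> \<sigma> then 0 else 1)
          + W (insert j \<sigma>) T * (if \<tau> j T \<longleftrightarrow> j \<in> insert j \<sigma> then 0 else 1))"
        by (rule sum_mono) (use \<open>j \<notin> \<sigma>\<close> in auto)
      finally show "9 / 32 \<le> ?f \<sigma> + ?f (insert j \<sigma>)" by (simp only: sum.distrib)
    qed
    also have "\<dots> = sum ?f (Pow {..<k})"
      by (rule sum_Pow_insert_pairs[symmetric]) (use j in auto)
    finally show ?thesis .
  qed
  have "2 ^ k * real k * (9/64) = (\<Sum>j<k. 2 ^ k * (9/64))" by simp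
  also have "\<dots> \<le> (\<Sum>j<k. \<Sum>\<sigma>\<in>Pow {..<k}. \<Sum>T\<in>X. W \<sigma> T * (if \<tau> j T \<longleftrightarrow> j \<in> \<sigma> then 0 else 1))"
    by (rule sum_mono) (rule coord, simp)
  also have "\<dots> = (\<Sum>\<sigma>\<in>Pow {..<k}. \<Sum>T\<in>X. \<Sum>j<k. W \<sigma> T * (if \<tau> j T \<longleftrightarrow> j \<in> \<sigma> then 0 else 1))"
    by (subst sum.swap, intro sum.cong refl sum.swap)
  finally show ?thesis by (simp only: sum_distrib_left)
qed

section \<open>Pair systems and their minimax bound\<close>

text \<open>The common zero \<open>x0\<close> is the place where \<mu>0 can deposit the mass left
  over by the paired points without making the chosen hypotheses infeasible.\<close>

definition pair_system :: "'a measure \<Rightarrow> ('a \<Rightarrow> nat) set \<Rightarrow> nat \<Rightarrow> (nat \<Rightarrow> 'a) \<Rightarrow> 'a \<Rightarrow> bool" where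
  "pair_system M H k q x0 \<longleftrightarrow>
     inj_on q {..<2*k} \<and> q \<in> {..<2*k} \<rightarrow> space M \<and> x0 \<in> space M \<and>
     (\<forall>\<sigma>\<subseteq>{..<k}. \<exists>h\<in>H. h x0 = 0 \<and> (\<forall>i<2*k. h (q i) = (if heavy \<sigma> i then 1 else 0)))"

text \<open>\<open>a\<close> is the indicator of the points selected by a hypothesis. The budget \<open>k\<close> makes selecting a
  light point as costly as missing a heavy one.\<close>

lemma pair_weight_regret:
  fixes a :: "nat \<Rightarrow> real"
  assumes k: "0 < k" and \<gamma>: "0 \<le> \<gamma>" "\<gamma> \<le> 1" and a: "\<And>i. i < 2 * k \<Longrightarrow> a i = 0 \<or> a i = 1" and s: "(\<Sum>i<2*k. a i) \<le> real k"
  shows "\<gamma> / (2 * real k) * (\<Sum>j<k. if a (2 * j + 1) = 1 \<longleftrightarrow> j \<in> \<sigma> then 0 else 1)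
    \<le> (\<Sum>i<2*k. pair_weight k \<gamma> \<sigma> i * (if heavy \<sigma> i then 1 else 0)) - (\<Sum>i<2*k. pair_weight k \<gamma> \<sigma> i * a i)"
proof -
  \<comment> \<open>\<open>u j\<close> and \<open>v j\<close> tell whether the heavy and the light
    point of pair \<open>j\<close> are selected. The budget \<open>U + V \<le> k\<close> bounds the
    light selections by the missed heavy points, so errors and regret can both be compared with
    \<open>k - U\<close>.\<close>
  define u v where "u = (\<lambda>j. a (if j \<in> \<sigma> then 2 * j + 1 else 2 * j))"
    and "v = (\<lambda>j. a (if j \<in> \<sigma> then 2 * j else 2 * j + 1))"
  define U V where "U = (\<Sum>j<k. u j)" and "V = (\<Sum>j<k. v j)"
  have UV: "U + V \<le> real k"
  proof -
    have "U + V = (\<Sum>j<k. a (2 * j) + a (2 * j + 1))"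
      unfolding U_def V_def sum.distrib[symmetric] by (intro sum.cong) (auto simp: u_def v_def)
    then show ?thesis using s unfolding sum_lessThan_double by simp
  qed
  have "(\<Sum>j<k. if a (2 * j + 1) = 1 \<longleftrightarrow> j \<in> \<sigma> then 0 else (1::real)) \<le> (\<Sum>j<k. (1 - u j) + v j)"
  proof (rule sum_mono)
    fix j assume "j \<in> {..<k}"
    then show "(if a (2 * j + 1) = 1 \<longleftrightarrow> j \<in> \<sigma> then 0 else (1::real)) \<le> (1 - u j) + v j"
      using a[of "2 * j"] a[of "2 * j + 1"] by (auto simp: u_def v_def)
  qed
  also have "\<dots> = real k - U + V" by (simp add: U_def V_def sum.distrib sum_subtractf)
  also have "\<dots> \<le> 2 * (real k - U)" using UV by (simp add: algebra_simps)
  finally have "\<gamma> / (2 * real k) * (\<Sum>j<k. if a (2 * j + 1) = 1 \<longleftrightarrow> j \<in> \<sigma> then 0 else 1)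
      \<le> \<gamma> / (2 * real k) * (2 * (real k - U))"
    using \<gamma> by (intro mult_left_mono) auto
  also have "\<dots> = \<gamma> - \<gamma> / real k * U" using k by (simp add: field_simps)
  also have "\<dots> \<le> (1 + \<gamma>) / 2 - ((1 + \<gamma>) / (2 * real k) * U + (1 - \<gamma>) / (2 * real k) * V)"
  proof -
    have "(1 - \<gamma>) / (2 * real k) * V \<le> (1 - \<gamma>) / (2 * real k) * (real k - U)"
      using UV \<gamma> by (intro mult_left_mono) auto
    also have "\<dots> = (1 + \<gamma>) / 2 - (1 + \<gamma>) / (2 * real k) * U - (\<gamma> - \<gamma> / real k * U)"
      using k by (simp add: field_simps)
    finally show ?thesis by simp
  qed
  also have "(1 + \<gamma>) / 2 = (\<Sum>i<2*k. pair_weight k \<gamma> \<sigma> i * (if heavy \<sigma> i then 1 else 0))"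
  proof -
    have "(\<Sum>i<2*k. pair_weight k \<gamma> \<sigma> i * (if heavy \<sigma> i then 1 else 0)) = (\<Sum>j<k. (1 + \<gamma>) / (2 * real k))"
      unfolding sum_lessThan_double by (intro sum.cong) (auto simp: pair_weight_def)
    also have "\<dots> = (1 + \<gamma>) / 2" using k by simp
    finally show ?thesis by simp
  qed
  also have "(1 + \<gamma>) / (2 * real k) * U + (1 - \<gamma>) / (2 * real k) * V = (\<Sum>i<2*k. pair_weight k \<gamma> \<sigma> i * a i)"
    unfolding sum_lessThan_double U_def V_def sum_distrib_left sum.distrib[symmetric]
    by (intro sum.cong) (auto simp: pair_weight_def u_def v_def)
  finally show ?thesis .
qed


lemma sum_filter_eq: "finite I \<Longrightarrow> (\<Sum>i\<in>{i\<in>I. P i}. w i) = (\<Sum>i\<in>I. w i * (if P i then 1 else (0::real)))"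
  by (subst sum.inter_filter) (auto intro: sum.cong)

text \<open>Since \<open>q\<close> is injective, distinct index sequences give distinct atoms of the
  product, whose masses are products of pair weights. This transports the combinatorial bound to
  samples.\<close>

lemma outer_expectation_pairs_ge:
  fixes f :: "(nat \<Rightarrow> 'a) \<Rightarrow> real" and \<sigma> :: "nat set"
  assumes single: "\<forall>x\<in>space M. {x} \<in> sets M" and q: "inj_on q {..<2*k}" "q \<in> {..<2*k} \<rightarrow> space M"
    and k: "0 < k" and \<gamma>: "\<bar>\<gamma>\<bar> \<le> 1" and f: "\<And>S. 0 \<le> f S"
  defines "\<mu> \<equiv> discrete_measure M {..<2*k} (pair_weight k \<gamma> \<sigma>) q"
  shows "ennreal (\<Sum>T\<in>PiE {..<n} (\<lambda>_. {..<2*k}).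
      (\<Prod>i<n. pair_weight k \<gamma> \<sigma> (T i)) * f (restrict (q \<circ> T) {..<n}))
    \<le> outer_expectation (\<Pi>\<^sub>M i\<in>{..<n}. \<mu>) (\<lambda>S. ennreal (f S))"
proof -
  let ?w = "pair_weight k \<gamma> \<sigma>"
  let ?X = "PiE {..<n} (\<lambda>_. {..<2*k})"
  let ?S = "\<lambda>T. restrict (q \<circ> T) {..<n}"
  note dm = finite_lessThan[of "2 * k"] pair_weight_nonneg[OF \<gamma>, of k \<sigma>] sum_pair_weight[OF k, of \<gamma> \<sigma>] q(2)
  have \<mu>: "\<mu> \<in> space (prob_algebra M)"
    unfolding \<mu>_def by (rule discrete_measure_in_prob_algebra) (use dm in auto)
  have finX: "finite ?X" by (intro finite_PiE) auto
  have TX: "T i < 2 * k" if "T \<in> ?X" "i < n" for T i using that by auto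
  have inj: "inj_on ?S ?X"
  proof (rule inj_onI)
    fix T U assume T: "T \<in> ?X" and U: "U \<in> ?X" and eq: "?S T = ?S U"
    show "T = U"
    proof (rule PiE_ext[OF T U])
      fix i assume i: "i \<in> {..<n}"
      then have "q (T i) = q (U i)" using fun_cong[OF eq, of i] by simp
      then show "T i = U i" using inj_onD[OF q(1)] TX[OF T] TX[OF U] i by simp
    qed
  qed
  have pt: "emeasure \<mu> {?S T i} = ennreal (?w (T i))" if T: "T \<in> ?X" and i: "i < n" for T i
  proof -
    have "q (T i) \<in> space M" using q(2) TX[OF T i] by auto
    then have qs: "{q (T i)} \<in> sets M" using single by blast
    have "emeasure \<mu> {q (T i)} = ennreal (\<Sum>l\<in>{l\<in>{..<2*k}. q l \<in> {q (T i)}}. ?w l)"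
      unfolding \<mu>_def by (rule emeasure_discrete_measure) (use dm qs in auto)
    also have "{l\<in>{..<2*k}. q l \<in> {q (T i)}} = {T i}"
      using inj_onD[OF q(1)] TX[OF T i] by auto
    finally show ?thesis using i by simp
  qed
  have "ennreal (\<Sum>T\<in>?X. (\<Prod>i<n. ?w (T i)) * f (?S T))
      = (\<Sum>T\<in>?X. ennreal (f (?S T)) * (\<Prod>i<n. emeasure \<mu> {?S T i}))"
  proof -
    have "ennreal (\<Sum>T\<in>?X. (\<Prod>i<n. ?w (T i)) * f (?S T)) = (\<Sum>T\<in>?X. ennreal ((\<Prod>i<n. ?w (T i)) * f (?S T)))"
      by (rule sum_ennreal[symmetric]) (intro mult_nonneg_nonneg prod_nonneg f pair_weight_nonneg[OF \<gamma>])
    also have "\<dots> = (\<Sum>T\<in>?X. ennreal (f (?S T)) * (\<Prod>i<n. emeasure \<mu> {?S T i}))"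
    proof (rule sum.cong[OF refl])
      fix T assume T: "T \<in> ?X"
      have "(\<Prod>i<n. emeasure \<mu> {?S T i}) = (\<Prod>i<n. ennreal (?w (T i)))"
        by (rule prod.cong[OF refl]) (rule pt[OF T], simp)
      also have "\<dots> = ennreal (\<Prod>i<n. ?w (T i))"
        by (rule prod_ennreal) (rule pair_weight_nonneg[OF \<gamma>])
      finally show "ennreal ((\<Prod>i<n. ?w (T i)) * f (?S T)) = ennreal (f (?S T)) * (\<Prod>i<n. emeasure \<mu> {?S T i})"
        using f by (simp add: ennreal_mult' mult.commute)
    qed
    finally show ?thesis .
  qed
  also have "\<dots> = (\<Sum>S\<in>?S ` ?X. ennreal (f S) * (\<Prod>i<n. emeasure \<mu> {S i}))"
    by (rule sum.reindex_cong[OF inj refl refl, symmetric])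
  also have "\<dots> \<le> outer_expectation (\<Pi>\<^sub>M i\<in>{..<n}. \<mu>) (\<lambda>S. ennreal (f S))"
  proof (rule outer_expectation_ge_sum[OF single \<mu>])
    show "finite (?S ` ?X)" using finX by simp
    show "?S ` ?X \<subseteq> space (\<Pi>\<^sub>M i\<in>{..<n}. M)"
      using q(2) TX by (auto simp: space_PiM)
  qed
  finally show ?thesis .
qed

lemma minimax_excess_ge_pair_system:
  assumes single: "\<forall>x\<in>space M. {x} \<in> sets M" and hyp: "hypothesis_class M H"
    and ps: "pair_system M H k q x0" and k: "0 < k" "k \<le> 4 * n" and n: "0 < n"
    and \<alpha>: "0 < \<alpha>" "\<alpha> < 1 / 2"
  shows "\<exists>\<mu>0 \<in> space (prob_algebra M). feasible H \<alpha> \<mu>0 \<noteq> {} \<and>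
    ennreal (9 / 256 * sqrt (real k / real n)) \<le> minimax_excess M H \<alpha> n \<mu>0"
proof -
  have q: "inj_on q {..<2*k}" "q \<in> {..<2*k} \<rightarrow> space M" and x0: "x0 \<in> space M"
    and real: "\<And>\<sigma>. \<sigma> \<subseteq> {..<k} \<Longrightarrow> \<exists>h\<in>H. h x0 = 0 \<and> (\<forall>i<2*k. h (q i) = (if heavy \<sigma> i then 1 else 0))"
    using ps unfolding pair_system_def by blast+
  \<comment> \<open>Index \<open>2 * k\<close> stands for \<open>x0\<close>, which receives the
    remaining mass \<open>1 - 2 * \<alpha>\<close>.\<close>
  define w0 where "w0 = (\<lambda>i. if i < 2 * k then \<alpha> / real k else 1 - 2 * \<alpha>)"
  define q0 where "q0 = (\<lambda>i. if i < 2 * k then q i else x0)"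
  define \<mu>0 where "\<mu>0 = discrete_measure M {..<Suc (2 * k)} w0 q0"
  have dm0: "finite {..<Suc (2 * k)}" "\<And>i. i \<in> {..<Suc (2 * k)} \<Longrightarrow> 0 \<le> w0 i"
    "sum w0 {..<Suc (2 * k)} = 1" "q0 \<in> {..<Suc (2 * k)} \<rightarrow> space M"
    using \<alpha> k q x0 by (auto simp: w0_def q0_def)
  have \<mu>0: "\<mu>0 \<in> space (prob_algebra M)"
    unfolding \<mu>0_def by (rule discrete_measure_in_prob_algebra) (fact dm0)+
  define a :: "('a \<Rightarrow> nat) \<Rightarrow> nat \<Rightarrow> real" where "a = (\<lambda>g i. if g (q i) = 1 then 1 else 0)"
  have risk0: "risk0 \<mu>0 g = (\<Sum>i<2*k. \<alpha> / real k * a g i) + (1 - 2 * \<alpha>) * (if g x0 = 1 then 1 else 0)"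
    if g: "g \<in> H" for g
  proof -
    have "risk0 \<mu>0 g = (\<Sum>i\<in>{i\<in>{..<Suc (2 * k)}. q0 i \<in> {x \<in> space M. g x = 1}}. w0 i)"
      unfolding risk0_def prob_algebraD(3)[OF \<mu>0] unfolding \<mu>0_def
      by (intro measure_discrete_measure) (fact dm0 | rule sets_hypothesis[OF hyp g])+
    also have "\<dots> = (\<Sum>i<Suc (2 * k). w0 i * (if q0 i \<in> {x \<in> space M. g x = 1} then 1 else 0))"
      by (rule sum_filter_eq) simp
    also have "\<dots> = (\<Sum>i<2*k. w0 i * (if q0 i \<in> {x \<in> space M. g x = 1} then 1 else 0))
        + w0 (2 * k) * (if q0 (2 * k) \<in> {x \<in> space M. g x = 1} then 1 else 0)"
      by (rule sum.lessThan_Suc)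
    also have "(\<Sum>i<2*k. w0 i * (if q0 i \<in> {x \<in> space M. g x = 1} then 1 else 0)) = (\<Sum>i<2*k. \<alpha> / real k * a g i)"
      using q(2) by (intro sum.cong) (auto simp: w0_def q0_def a_def)
    finally show ?thesis using x0 by (simp add: w0_def q0_def)
  qed
  have feas: "(\<Sum>i<2*k. a g i) \<le> real k" if g: "g \<in> feasible H \<alpha> \<mu>0" for g
  proof -
    have "(\<Sum>i<2*k. \<alpha> / real k * a g i) \<le> \<alpha>"
      using g risk0[of g] \<alpha> by (auto simp: feasible_def split: if_splits)
    then have "\<alpha> / real k * (\<Sum>i<2*k. a g i) \<le> \<alpha> / real k * real k"
      using k by (simp add: sum_distrib_left)
    then show ?thesis using \<alpha> k by (subst (asm) mult_le_cancel_left_pos) auto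
  qed
  define hs where "hs = (\<lambda>\<sigma>. SOME h. h \<in> H \<and> h x0 = 0 \<and> (\<forall>i<2*k. h (q i) = (if heavy \<sigma> i then 1 else 0)))"
  have hs: "hs \<sigma> \<in> H" "hs \<sigma> x0 = 0" "\<And>i. i < 2 * k \<Longrightarrow> hs \<sigma> (q i) = (if heavy \<sigma> i then 1 else 0)"
    if "\<sigma> \<subseteq> {..<k}" for \<sigma>
  proof -
    have "\<exists>h. h \<in> H \<and> h x0 = 0 \<and> (\<forall>i<2*k. h (q i) = (if heavy \<sigma> i then 1 else 0))"
      using real[OF that] by blast
    from someI_ex[OF this] show "hs \<sigma> \<in> H" "hs \<sigma> x0 = 0"
      "\<And>i. i < 2 * k \<Longrightarrow> hs \<sigma> (q i) = (if heavy \<sigma> i then 1 else 0)"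
      unfolding hs_def by blast+
  qed
  have ahs: "a (hs \<sigma>) i = (if heavy \<sigma> i then 1 else 0)" if "\<sigma> \<subseteq> {..<k}" "i < 2 * k" for \<sigma> i
    using hs(3)[OF that] by (simp add: a_def)
  have hsf: "hs \<sigma> \<in> feasible H \<alpha> \<mu>0" if \<sigma>: "\<sigma> \<subseteq> {..<k}" for \<sigma>
  proof -
    have "risk0 \<mu>0 (hs \<sigma>) = (\<Sum>i<2*k. \<alpha> / real k * (if heavy \<sigma> i then 1 else 0))"
      using risk0[OF hs(1)[OF \<sigma>]] hs(2)[OF \<sigma>] ahs[OF \<sigma>] by simp
    also have "\<dots> = (\<Sum>j<k. \<alpha> / real k)"
      unfolding sum_lessThan_double by (intro sum.cong) auto
    also have "\<dots> = \<alpha>" using k by simp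
    finally show ?thesis using hs(1)[OF \<sigma>] by (simp add: feasible_def)
  qed
  then have ne: "feasible H \<alpha> \<mu>0 \<noteq> {}" by blast
  define \<gamma> where "\<gamma> = sqrt (real k / (4 * real n))"
  have "real k / (4 * real n) \<le> 1" using k n by (simp add: field_simps flip: of_nat_mult)
  then have \<gamma>: "0 \<le> \<gamma>" "\<gamma> \<le> 1" "\<bar>\<gamma>\<bar> \<le> 1" unfolding \<gamma>_def by auto
  have \<gamma>_eq: "\<gamma> = sqrt (real k / real n) / 2"
    unfolding \<gamma>_def by (simp add: real_sqrt_divide real_sqrt_mult)
  let ?w = "pair_weight k \<gamma>"
  define \<mu> where "\<mu> = (\<lambda>\<sigma>. discrete_measure M {..<2*k} (?w \<sigma>) q)"
  note dm = finite_lessThan[of "2 * k"] pair_weight_nonneg[OF \<gamma>(3), of k] sum_pair_weight[OF k(1), of \<gamma>] q(2)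
  have \<mu>: "\<mu> \<sigma> \<in> space (prob_algebra M)" for \<sigma>
    unfolding \<mu>_def by (rule discrete_measure_in_prob_algebra) (use dm in auto)
  have risk1: "risk1 (\<mu> \<sigma>) g = 1 - (\<Sum>i<2*k. ?w \<sigma> i * a g i)" if g: "g \<in> H" for g \<sigma>
  proof -
    have "measure (\<mu> \<sigma>) {x \<in> space M. g x = 1} = (\<Sum>i\<in>{i\<in>{..<2 * k}. q i \<in> {x \<in> space M. g x = 1}}. ?w \<sigma> i)"
      unfolding \<mu>_def by (rule measure_discrete_measure) (use dm sets_hypothesis[OF hyp g] in auto)
    also have "\<dots> = (\<Sum>i<2*k. ?w \<sigma> i * (if q i \<in> {x \<in> space M. g x = 1} then 1 else 0))"
      by (rule sum_filter_eq) simp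
    also have "\<dots> = (\<Sum>i<2*k. ?w \<sigma> i * a g i)"
      using q(2) by (intro sum.cong) (auto simp: a_def)
    finally show ?thesis using risk1_eq[OF hyp g \<mu>] by simp
  qed
  have "ennreal (9 / 256 * sqrt (real k / real n)) \<le> minimax_excess M H \<alpha> n \<mu>0"
  proof (rule minimax_excess_ge[OF \<mu>0 ne])
    fix L assume L: "L \<in> exact_learners M H \<alpha> n \<mu>0"
    let ?X = "PiE {..<n} (\<lambda>_. {..<2*k})"
    let ?S = "\<lambda>T. restrict (q \<circ> T) {..<n}"
    let ?W = "\<lambda>\<sigma> T. \<Prod>i<n. ?w \<sigma> (T i)"
    define exc where "exc = (\<lambda>\<sigma> S. excess_risk H \<alpha> \<mu>0 (\<mu> \<sigma>) (L S))"
    \<comment> \<open>The returned hypothesis is read as a guess of \<sigma>: it votes for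
      \<open>j \<in> \<sigma>\<close> iff it selects the second point of pair
      \<open>j\<close>.\<close>
    define \<tau> where "\<tau> = (\<lambda>j T. a (L (?S T)) (2 * j + 1) = 1)"
    have exc_ge: "\<gamma> / (2 * real k) * (\<Sum>j<k. if \<tau> j T \<longleftrightarrow> j \<in> \<sigma> then 0 else 1) \<le> exc \<sigma> (?S T)"
      if T: "T \<in> ?X" and \<sigma>: "\<sigma> \<subseteq> {..<k}" for T \<sigma>
    proof -
      have "?S T \<in> space (\<Pi>\<^sub>M i\<in>{..<n}. M)" using q(2) T by (fastforce simp: space_PiM)
      then have g: "L (?S T) \<in> feasible H \<alpha> \<mu>0" using L by (simp add: exact_learners_def)
      then have gH: "L (?S T) \<in> H" by (simp add: feasible_def)
      have "\<gamma> / (2 * real k) * (\<Sum>j<k. if \<tau> j T \<longleftrightarrow> j \<in> \<sigma> then 0 else 1)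
        \<le> (\<Sum>i<2*k. ?w \<sigma> i * (if heavy \<sigma> i then 1 else 0)) - (\<Sum>i<2*k. ?w \<sigma> i * a (L (?S T)) i)"
        unfolding \<tau>_def
        by (rule pair_weight_regret) (use k \<gamma> feas[OF g] in \<open>auto simp: a_def\<close>)
      also have "\<dots> = risk1 (\<mu> \<sigma>) (L (?S T)) - risk1 (\<mu> \<sigma>) (hs \<sigma>)"
        unfolding risk1[OF gH] risk1[OF hs(1)[OF \<sigma>]] using ahs[OF \<sigma>] by simp
      also have "\<dots> \<le> exc \<sigma> (?S T)"
        unfolding exc_def by (rule excess_risk_ge[OF hsf[OF \<sigma>]])
      finally show ?thesis .
    qed
    define e where "e = (\<lambda>\<sigma>. \<Sum>T\<in>?X. ?W \<sigma> T * exc \<sigma> (?S T))"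
    \<comment> \<open>On average over \<sigma> at least \<open>k * (9 / 64)\<close> guesses are
      wrong in expectation, each at a regret of \<open>\<gamma> / (2 * k)\<close>. With
      \<open>\<gamma> = sqrt (k / n) / 2\<close> the product is
      \<open>9 / 256 * sqrt (k / n)\<close>, and some \<sigma>, depending on \<open>L\<close>,
      reaches the average.\<close>
    have "(\<Sum>\<sigma>\<in>Pow {..<k}. \<gamma> * (9 / 128)) = \<gamma> / (2 * real k) * (2 ^ k * real k * (9/64))"
      using k by (simp add: card_Pow)
    also have "\<dots> \<le> \<gamma> / (2 * real k) * (\<Sum>\<sigma>\<in>Pow {..<k}. \<Sum>T\<in>?X. ?W \<sigma> T * (\<Sum>j<k. if \<tau> j T \<longleftrightarrow> j \<in> \<sigma> then 0 else 1))"
      unfolding \<gamma>_def by (intro mult_left_mono assouad_pairs k n) auto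
    also have "\<dots> = (\<Sum>\<sigma>\<in>Pow {..<k}. \<Sum>T\<in>?X. ?W \<sigma> T * (\<gamma> / (2 * real k) * (\<Sum>j<k. if \<tau> j T \<longleftrightarrow> j \<in> \<sigma> then 0 else 1)))"
      by (subst sum_distrib_left, intro sum.cong refl, subst sum_distrib_left, intro sum.cong refl, rule mult.left_commute)
    also have "\<dots> \<le> (\<Sum>\<sigma>\<in>Pow {..<k}. e \<sigma>)"
      unfolding e_def
      by (intro sum_mono mult_left_mono exc_ge prod_nonneg pair_weight_nonneg[OF \<gamma>(3)]) auto
    finally have sum_le: "(\<Sum>\<sigma>\<in>Pow {..<k}. \<gamma> * (9 / 128)) \<le> (\<Sum>\<sigma>\<in>Pow {..<k}. e \<sigma>)" .
    have "\<exists>\<sigma>\<in>Pow {..<k}. \<gamma> * (9 / 128) \<le> e \<sigma>"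
    proof (rule ccontr)
      assume "\<not> ?thesis"
      then have "(\<Sum>\<sigma>\<in>Pow {..<k}. e \<sigma>) < (\<Sum>\<sigma>\<in>Pow {..<k}. \<gamma> * (9 / 128))"
        by (intro sum_strict_mono) (auto simp: not_le)
      then show False using sum_le by linarith
    qed
    then obtain \<sigma> where \<sigma>: "\<sigma> \<subseteq> {..<k}" "\<gamma> * (9 / 128) \<le> e \<sigma>" by blast
    have "ennreal (9 / 256 * sqrt (real k / real n)) \<le> ennreal (e \<sigma>)"
      using \<sigma>(2) by (intro ennreal_leI) (simp add: \<gamma>_eq)
    also have "\<dots> \<le> outer_expectation (\<Pi>\<^sub>M i\<in>{..<n}. \<mu> \<sigma>) (\<lambda>S. ennreal (exc \<sigma> S))"
      unfolding e_def \<mu>_def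
      by (rule outer_expectation_pairs_ge[OF single q k(1) \<gamma>(3)]) (simp add: exc_def excess_risk_nonneg)
    finally show "\<exists>\<mu>1 \<in> space (prob_algebra M). ennreal (9 / 256 * sqrt (real k / real n))
        \<le> outer_expectation (\<Pi>\<^sub>M i\<in>{..<n}. \<mu>1) (\<lambda>S. ennreal (excess_risk H \<alpha> \<mu>0 \<mu>1 (L S)))"
      using \<mu> unfolding exc_def by blast
  qed
  then show ?thesis using \<mu>0 ne by blast
qed


text \<open>The two separating hypotheses serve as the two choices from a single pair. This covers
  classes whose VC dimension is too small for the construction from shattered sets.\<close>

lemma pair_system_three_points:
  assumes "separates_three_points M H"
  obtains q x0 where "pair_system M H 1 q x0"
proof -
  obtain h1 h2 x0 x1 x2 where h: "h1 \<in> H" "h2 \<in> H" "x0 \<in> space M" "x1 \<in> space M" "x2 \<in> space M"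
    "h1 x0 = 0" "h2 x0 = 0" "h1 x1 = 1" "h2 x2 = 1" "h1 x2 = 0" "h2 x1 = 0"
    using assms unfolding separates_three_points_def by blast
  define q where "q = (\<lambda>i::nat. if i = 0 then x1 else x2)"
  have lt: "{..<2 * 1} = {0, 1::nat}" by auto
  have "pair_system M H 1 q x0"
    unfolding pair_system_def
  proof (intro conjI allI impI)
    show "inj_on q {..<2*1}" "q \<in> {..<2*1} \<rightarrow> space M"
      unfolding lt using h by (auto simp: q_def)
    fix \<sigma> :: "nat set" assume "\<sigma> \<subseteq> {..<1}"
    have "(\<forall>i<2*1. P i) \<longleftrightarrow> P 0 \<and> P (1::nat)" for P
      using lt by (auto simp: less_2_cases_iff)
    then show "\<exists>h\<in>H. h x0 = 0 \<and> (\<forall>i<2*1. h (q i) = (if heavy \<sigma> i then 1 else 0))"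
      using h by (cases "0 \<in> \<sigma>") (auto simp: q_def heavy_def)
  qed (fact h)
  then show ?thesis by (rule that)
qed

text \<open>The point in excess of the \<open>2 * k\<close> paired ones becomes the common
  zero.\<close>

lemma pair_system_shattered:
  assumes A: "shattered M H A" "2 * k + 1 \<le> card A"
  obtains q x0 where "pair_system M H k q x0"
proof -
  have fin: "finite A" and sub: "A \<subseteq> space M"
    and sh: "\<And>y. y \<in> A \<rightarrow> {0, 1} \<Longrightarrow> \<exists>h\<in>H. \<forall>x\<in>A. h x = y x"
    using A(1) unfolding shattered_def by blast+
  obtain p where p: "bij_betw p {0..<card A} A" using ex_bij_betw_nat_finite[OF fin] by blast
  have inj: "inj_on p {..<2*k+1}"
    by (rule inj_on_subset[OF bij_betw_imp_inj_on[OF p]]) (use A(2) in auto)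
  have pA: "p i \<in> A" if "i < 2 * k + 1" for i
    using p A(2) that unfolding bij_betw_def by auto
  have "pair_system M H k p (p (2 * k))"
    unfolding pair_system_def
  proof (intro conjI allI impI)
    show "inj_on p {..<2*k}" by (rule inj_on_subset[OF inj]) auto
    show "p \<in> {..<2*k} \<rightarrow> space M" "p (2 * k) \<in> space M" using pA sub by auto
    fix \<sigma> assume "\<sigma> \<subseteq> {..<k}"
    define y where "y = (\<lambda>x. if \<exists>i<2*k. x = p i \<and> heavy \<sigma> i then 1 else (0::nat))"
    obtain h where h: "h \<in> H" "\<forall>x\<in>A. h x = y x"
      using sh[of y] by (auto simp: y_def)
    have yp: "y (p i) = (if i < 2 * k \<and> heavy \<sigma> i then 1 else 0)" if "i < 2 * k + 1" for i
    proof -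
      have "p i = p l \<longleftrightarrow> i = l" if "l < 2 * k" for l
        using inj_on_eq_iff[OF inj, of i l] that \<open>i < 2 * k + 1\<close> by auto
      then show ?thesis unfolding y_def by auto
    qed
    show "\<exists>h\<in>H. h (p (2 * k)) = 0 \<and> (\<forall>i<2*k. h (p i) = (if heavy \<sigma> i then 1 else 0))"
      using h yp pA by (intro bexI[of _ h]) auto
  qed
  then show ?thesis by (rule that)
qed

lemma minimax_excess_ge_sqrt:
  assumes single: "\<forall>x\<in>space M. {x} \<in> sets M" and hyp: "hypothesis_class M H"
    and vc: "finite_vc_dim M H" and sep: "separates_three_points M H"
    and \<alpha>: "0 < \<alpha>" "\<alpha> < 1 / 2" and n: "0 < n" "vc_dim M H \<le> n"
  shows "\<exists>\<mu>0 \<in> space (prob_algebra M). feasible H \<alpha> \<mu>0 \<noteq> {} \<and>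
    ennreal (9 / 512 * sqrt (real (vc_dim M H) / real n)) \<le> minimax_excess M H \<alpha> n \<mu>0"
proof -
  let ?d = "vc_dim M H"
  have H: "H \<noteq> {}" using sep by (auto simp: separates_three_points_def)
  \<comment> \<open>For larger dimension \<open>d\<close>, rounding in \<open>(d - 1) div 2\<close>
    is worst at \<open>d = 4\<close>, which yields \<open>k = 1\<close>. Hence
    \<open>d \<le> 4 * k\<close>, and passing from \<open>k\<close> to \<open>d\<close> under the
    root costs a factor 2.\<close>
  obtain k q x0 where ps: "pair_system M H k q x0" and k: "0 < k" "?d \<le> 4 * k" "k \<le> 4 * n"
  proof (cases "?d \<le> 2")
    case True
    obtain q x0 where "pair_system M H 1 q x0" using pair_system_three_points[OF sep] by blast
    then show ?thesis using that[of 1 q x0] True n by linarith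
  next
    case False
    obtain A where A: "shattered M H A" "card A = ?d"
      using ex_shattered_card_eq_vc_dim[OF vc H] by blast
    let ?k = "(?d - 1) div 2"
    have "2 * ?k + 1 \<le> card A" using A(2) False by linarith
    then obtain q x0 where "pair_system M H ?k q x0"
      by (rule pair_system_shattered[OF A(1)])
    moreover have "0 < (d - 1) div 2 \<and> d \<le> 4 * ((d - 1) div 2) \<and> (d - 1) div 2 \<le> d" if "3 \<le> d" for d :: nat
      using that by presburger
    from this[of ?d] have "0 < ?k" "?d \<le> 4 * ?k" "?k \<le> 4 * n" using False n by simp_all
    ultimately show ?thesis by (rule that)
  qed
  have "sqrt (real ?d / real n) \<le> sqrt (4 * (real k / real n))"
    using k n by (intro real_sqrt_le_mono) (simp add: divide_right_mono flip: of_nat_mult)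
  also have "\<dots> = 2 * sqrt (real k / real n)" unfolding real_sqrt_mult by simp
  finally have le: "9 / 512 * sqrt (real ?d / real n) \<le> 9 / 256 * sqrt (real k / real n)" by simp
  obtain \<mu>0 where \<mu>0: "\<mu>0 \<in> space (prob_algebra M)" "feasible H \<alpha> \<mu>0 \<noteq> {}"
    "ennreal (9 / 256 * sqrt (real k / real n)) \<le> minimax_excess M H \<alpha> n \<mu>0"
    using minimax_excess_ge_pair_system[OF single hyp ps k(1,3) n(1) \<alpha>] by blast
  then show ?thesis using order_trans[OF ennreal_leI[OF le]] by blast
qed

subsection \<open>Uniform convergence\<close>

lemma indep_vars_PiM_coordinate:
  assumes "\<And>i. i \<in> I \<Longrightarrow> prob_space (N i)" "I \<noteq> {}"
  shows "prob_space.indep_vars (PiM I N) N (\<lambda>i \<omega>. \<omega> i) I"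
proof -
  interpret prob_space "PiM I N" by (rule prob_space_PiM) fact
  have "distr (PiM I N) (PiM I N) (\<lambda>x. \<lambda>i\<in>I. x i) = distr (PiM I N) (PiM I N) (\<lambda>x. x)"
    by (rule distr_cong) (auto simp: space_PiM)
  also have "\<dots> = PiM I N" by (rule distr_id)
  also have "\<dots> = (\<Pi>\<^sub>M i\<in>I. distr (PiM I N) (N i) (\<lambda>\<omega>. \<omega> i))"
    by (rule PiM_cong) (simp_all add: distr_PiM_component assms)
  finally show ?thesis
    by (subst indep_vars_iff_distr_eq_PiM') (use assms in auto)
qed

text \<open>The index set is arbitrary because the ghost sample, to which this is applied, is
  indexed by \<open>{n..<2*n}\<close>.\<close>

lemma hoeffding_empirical:
  assumes \<mu>: "prob_space \<mu>" and A: "A \<in> sets \<mu>" and I: "finite I" "I \<noteq> {}" and t: "0 \<le> t"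
  shows "measure (\<Pi>\<^sub>M i\<in>I. \<mu>) {S \<in> space (\<Pi>\<^sub>M i\<in>I. \<mu>).
      \<bar>(\<Sum>i\<in>I. indicator A (S i)) - real (card I) * measure \<mu> A\<bar> \<ge> real (card I) * t}
    \<le> 2 * exp (- 2 * real (card I) * t\<^sup>2)"
proof -
  let ?P = "\<Pi>\<^sub>M i\<in>I. \<mu>"
  interpret \<mu>: prob_space \<mu> by fact
  interpret P: prob_space ?P by (rule prob_space_PiM) (rule \<mu>)
  let ?X = "\<lambda>i S. indicator A (S i) :: real"
  obtain i0 where i0: "i0 \<in> I" using I by blast
  have coord: "distr ?P \<mu> (\<lambda>S. S i) = \<mu>" if "i \<in> I" for i
    by (rule distr_PiM_component) (use \<mu> that in auto)
  have ind: "(indicator A :: _ \<Rightarrow> real) \<in> borel_measurable \<mu>" using A by simp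
  have distrX: "distr ?P borel (?X i) = distr \<mu> borel (indicator A)" if "i \<in> I" for i
  proof -
    have "distr \<mu> borel (indicator A :: _ \<Rightarrow> real) = distr (distr ?P \<mu> (\<lambda>S. S i)) borel (indicator A)"
      by (simp only: coord[OF that])
    also have "\<dots> = distr ?P borel (indicator A \<circ> (\<lambda>S. S i))"
      by (rule distr_distr) (use that ind in auto)
    finally show ?thesis by (simp add: o_def)
  qed
  have expect: "P.expectation (?X i0) = measure \<mu> A"
  proof -
    have "P.expectation (?X i0) = (\<integral>x. indicator A x \<partial>distr ?P \<mu> (\<lambda>S. S i0))"
      by (rule integral_distr[symmetric]) (use i0 ind in auto)
    also have "\<dots> = measure \<mu> A" unfolding coord[OF i0] using A by simp
    finally show ?thesis .
  qed
  have indep: "P.indep_vars (\<lambda>_. borel) ?X I"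
    by (rule P.indep_vars_compose2[OF indep_vars_PiM_coordinate]) (use \<mu> I ind in auto)
  interpret Hoeffding_ineq_iid ?P I ?X "?X i0" 0 1 "measure \<mu> A"
  proof unfold_locales
    show "measure \<mu> A \<equiv> P.expectation (?X i0)" by (rule eq_reflection, rule expect[symmetric])
    show "distr ?P borel (?X i) = distr ?P borel (?X i0)" if "i \<in> I" for i
      using distrX[OF that] distrX[OF i0] by simp
    show "?X i0 \<in> borel_measurable ?P"
      by (rule measurable_compose[OF measurable_component_singleton[OF i0] ind])
    show "AE x in ?P. ?X i0 x \<in> {0..1}" by (auto simp: indicator_def)
  qed (fact I indep)+
  have "measure ?P {S \<in> space ?P. \<bar>(\<Sum>i\<in>I. ?X i S) - real (card I) * measure \<mu> A\<bar> \<ge> real (card I) * t}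
    \<le> 2 * exp (- 2 * (real (card I) * t)\<^sup>2 / (real (card I) * (1 - 0)\<^sup>2))"
    by (rule Hoeffding_ineq_abs_ge) (use t I in auto)
  also have "- 2 * (real (card I) * t)\<^sup>2 / (real (card I) * (1 - 0)\<^sup>2) = - 2 * real (card I) * t\<^sup>2"
    using I by (simp add: power2_eq_square field_simps)
  finally show ?thesis .
qed

definition traces_on :: "('a \<Rightarrow> nat) set \<Rightarrow> 'a set \<Rightarrow> 'a set set" where
  "traces_on H P = (\<lambda>h. {x \<in> P. h x = 1}) ` H"

lemma card_traces_le:
  assumes hyp: "hypothesis_class M H" and vc: "finite_vc_dim M H" and P: "finite P" "P \<subseteq> space M"
  shows "card (traces_on H P) \<le> (card P + 1) ^ vc_dim M H"
proof (rule sauer_shelah[OF P(1)])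
  show "traces_on H P \<subseteq> Pow P" by (auto simp: traces_on_def)
  fix B assume B: "B \<subseteq> P" "\<forall>Y\<subseteq>B. \<exists>X\<in>traces_on H P. X \<inter> B = Y"
  have "shattered M H B"
    unfolding shattered_def
  proof (intro conjI ballI)
    fix y :: "'a \<Rightarrow> nat" assume y: "y \<in> B \<rightarrow> {0, 1}"
    have "{x \<in> B. y x = 1} \<subseteq> B" by blast
    with B(2) obtain h where h: "h \<in> H" "{x \<in> P. h x = 1} \<inter> B = {x \<in> B. y x = 1}"
      unfolding traces_on_def by blast
    have "h x = y x" if x: "x \<in> B" for x
    proof -
      have "h x = 0 \<or> h x = 1" using hypothesis_value[OF hyp h(1)] x B(1) P(2) by blast
      moreover have "y x = 0 \<or> y x = 1" using y x by blast
      moreover have "h x = 1 \<longleftrightarrow> y x = 1" using h(2) x B(1) by blast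
      ultimately show ?thesis by auto
    qed
    then show "\<exists>h\<in>H. \<forall>x\<in>B. h x = y x" using h(1) by blast
  qed (use B(1) P in \<open>auto intro: finite_subset\<close>)
  then show "card B \<le> vc_dim M H" by (rule shattered_card_le_vc_dim[OF vc])
qed

text \<open>Coordinates below \<open>n\<close> form the sample, the others its ghost. Comparing two
  empirical frequencies, instead of one with its mean, makes membership depend on the labels of
  finitely many points: traces can be counted, and \<open>measurable_traces\<close> applies.\<close>

definition deviation_set :: "'a measure \<Rightarrow> ('a \<Rightarrow> nat) set \<Rightarrow> nat \<Rightarrow> real \<Rightarrow> (nat \<Rightarrow> 'a) set" where
  "deviation_set M H n t = {Z \<in> space (\<Pi>\<^sub>M i\<in>{..<2*n}. M).
     \<exists>h\<in>H. \<bar>\<Sum>i<n. real (h (Z i)) - real (h (Z (n + i)))\<bar> > real n * t}"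

text \<open>Exchanging sample points with their ghosts permutes coordinates, so it preserves the
  product measure, while it flips exactly the signs recorded by \<open>flip_sign I\<close>.\<close>

definition swap_index :: "nat \<Rightarrow> nat set \<Rightarrow> nat \<Rightarrow> nat" where
  "swap_index n I i = (if i < n \<and> i \<in> I then n + i else if n \<le> i \<and> i - n \<in> I then i - n else i)"

lemma swap_index:
  assumes "I \<subseteq> {..<n}"
  shows "inj_on (swap_index n I) {..<2*n}" "swap_index n I \<in> {..<2*n} \<rightarrow> {..<2*n}"
proof -
  show "swap_index n I \<in> {..<2*n} \<rightarrow> {..<2*n}"
    by (auto simp: swap_index_def)
  have inv: "swap_index n I (swap_index n I i) = i" for i
    using assms by (auto simp: swap_index_def)
  show "inj_on (swap_index n I) {..<2*n}"
    by (rule inj_onI) (metis inv)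
qed

text \<open>For a fixed double sample, swaps only change the signs of the differences between a
  label and its ghost. Each trace thus gives a Rademacher sum, and Sauer-Shelah bounds the number of
  traces in the union bound.\<close>

lemma card_swaps_deviation_le:
  assumes hyp: "hypothesis_class M H" and vc: "finite_vc_dim M H" and t: "0 \<le> t"
    and Z: "Z \<in> space (\<Pi>\<^sub>M i\<in>{..<2*n}. M)"
  shows "real (card {I \<in> Pow {..<n}. restrict (\<lambda>i. Z (swap_index n I i)) {..<2*n} \<in> deviation_set M H n t})
    \<le> (2 * real n + 1) ^ vc_dim M H * (2 * 2 ^ n * exp (- (real n * t\<^sup>2 / 2)))"
proof -
  let ?P = "Z ` {..<2*n}"
  have Zs: "Z i \<in> space M" if "i < 2 * n" for i using Z that by (auto simp: space_PiM)
  define a where "a = (\<lambda>X i. indicator X (Z i) - indicator X (Z (n + i)) :: real)"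
  let ?B = "\<lambda>X. {I \<in> Pow {..<n}. \<bar>\<Sum>i<n. flip_sign I i * a X i\<bar> > real n * t}"
  have "{I \<in> Pow {..<n}. restrict (\<lambda>i. Z (swap_index n I i)) {..<2*n} \<in> deviation_set M H n t}
    \<subseteq> (\<Union>X\<in>traces_on H ?P. ?B X)"
  proof
    fix I assume I: "I \<in> {I \<in> Pow {..<n}. restrict (\<lambda>i. Z (swap_index n I i)) {..<2*n} \<in> deviation_set M H n t}"
    let ?Z = "restrict (\<lambda>i. Z (swap_index n I i)) {..<2*n}"
    obtain h where h: "h \<in> H" "\<bar>\<Sum>i<n. real (h (?Z i)) - real (h (?Z (n + i)))\<bar> > real n * t"
      using I unfolding deviation_set_def by blast
    let ?X = "{x \<in> ?P. h x = 1}"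
    have ind: "real (h (Z i)) = indicator ?X (Z i)" if "i < 2 * n" for i
      using hypothesis_value[OF hyp h(1) Zs[OF that]] that by (auto simp: indicator_def)
    have "(\<Sum>i<n. real (h (?Z i)) - real (h (?Z (n + i)))) = (\<Sum>i<n. flip_sign I i * a ?X i)"
    proof (rule sum.cong[OF refl])
      fix i assume "i \<in> {..<n}"
      then have i: "i < n" by simp
      then show "real (h (?Z i)) - real (h (?Z (n + i))) = flip_sign I i * a ?X i"
        using ind[of i] ind[of "n + i"] by (simp add: swap_index_def flip_sign_def a_def)
    qed
    then have "I \<in> ?B ?X" using h(2) I by simp
    moreover have "?X \<in> traces_on H ?P" using h(1) by (auto simp: traces_on_def)
    ultimately show "I \<in> (\<Union>X\<in>traces_on H ?P. ?B X)" by blast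
  qed
  moreover have fin: "finite (traces_on H ?P)"
    by (rule finite_subset[of _ "Pow ?P"]) (auto simp: traces_on_def)
  ultimately have "card {I \<in> Pow {..<n}. restrict (\<lambda>i. Z (swap_index n I i)) {..<2*n} \<in> deviation_set M H n t}
      \<le> card (\<Union>X\<in>traces_on H ?P. ?B X)"
    by (intro card_mono finite_UN_I) auto
  also have "\<dots> \<le> (\<Sum>X\<in>traces_on H ?P. card (?B X))" by (rule card_UN_le[OF fin])
  finally have "real (card {I \<in> Pow {..<n}. restrict (\<lambda>i. Z (swap_index n I i)) {..<2*n} \<in> deviation_set M H n t})
      \<le> (\<Sum>X\<in>traces_on H ?P. real (card (?B X)))" by (simp flip: of_nat_sum)
  also have "\<dots> \<le> (\<Sum>X\<in>traces_on H ?P. 2 * 2 ^ n * exp (- (real n * t\<^sup>2 / 2)))"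
    by (intro sum_mono rademacher_tail t) (auto simp: a_def indicator_def)
  also have "\<dots> = real (card (traces_on H ?P)) * (2 * 2 ^ n * exp (- (real n * t\<^sup>2 / 2)))" by simp
  also have "\<dots> \<le> (2 * real n + 1) ^ vc_dim M H * (2 * 2 ^ n * exp (- (real n * t\<^sup>2 / 2)))"
  proof (rule mult_right_mono)
    have "card (traces_on H ?P) \<le> (card ?P + 1) ^ vc_dim M H"
      by (rule card_traces_le[OF hyp vc]) (use Zs in auto)
    also have "\<dots> \<le> (2 * n + 1) ^ vc_dim M H"
      using card_image_le[of "{..<2*n}" Z] by (intro power_mono) auto
    finally have "real (card (traces_on H ?P)) \<le> real ((2 * n + 1) ^ vc_dim M H)" by (rule of_nat_mono)
    then show "real (card (traces_on H ?P)) \<le> (2 * real n + 1) ^ vc_dim M H" by (simp add: add.commute)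
  qed simp
  finally show ?thesis .
qed


text \<open>By invariance the measure of \<open>T\<close> equals its average over all
  \<open>2 ^ n\<close> swaps, and the average is bounded pointwise in the double sample.
  \<open>T\<close> is a measurable part because \<open>deviation_set\<close> itself is measurable
  only in the completion.\<close>

lemma emeasure_deviation_le:
  assumes hyp: "hypothesis_class M H" and vc: "finite_vc_dim M H" and t: "0 \<le> t"
    and \<mu>: "\<mu> \<in> space (prob_algebra M)"
    and T: "T \<in> sets (\<Pi>\<^sub>M i\<in>{..<2*n}. \<mu>)" "T \<subseteq> deviation_set M H n t"
  shows "emeasure (\<Pi>\<^sub>M i\<in>{..<2*n}. \<mu>) T
    \<le> ennreal (2 * (2 * real n + 1) ^ vc_dim M H * exp (- (real n * t\<^sup>2 / 2)))"
proof -
  let ?P = "\<Pi>\<^sub>M i\<in>{..<2*n}. \<mu>"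
  let ?c = "2 * (2 * real n + 1) ^ vc_dim M H * exp (- (real n * t\<^sup>2 / 2))"
  let ?sw = "\<lambda>I Z. restrict (\<lambda>i. Z (swap_index n I i)) {..<2*n}"
  interpret P: prob_space ?P by (rule space_PiM_prob_algebra(3)[OF \<mu>])
  have sw: "?sw I \<in> measurable ?P ?P" if "I \<subseteq> {..<n}" for I
    using swap_index(2)[OF that] by (intro measurable_restrict) (auto intro!: measurable_component_singleton)
  have inv: "emeasure ?P T = (\<integral>\<^sup>+Z. indicator T (?sw I Z) \<partial>?P)" if I: "I \<subseteq> {..<n}" for I
  proof -
    have "?P = distr ?P ?P (?sw I)"
      by (rule distr_PiM_reindex[symmetric]) (use prob_algebraD(1)[OF \<mu>] swap_index[OF I] in auto)
    then have "emeasure ?P T = (\<integral>\<^sup>+Z. indicator T Z \<partial>distr ?P ?P (?sw I))" using T(1) by simp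
    also have "\<dots> = (\<integral>\<^sup>+Z. indicator T (?sw I Z) \<partial>?P)"
      by (rule nn_integral_distr[OF sw[OF I]]) (use T(1) in auto)
    finally show ?thesis .
  qed
  have "of_nat (2 ^ n) * emeasure ?P T = (\<Sum>I\<in>Pow {..<n}. emeasure ?P T)"
    by (simp add: card_Pow)
  also have "\<dots> = (\<Sum>I\<in>Pow {..<n}. \<integral>\<^sup>+Z. indicator T (?sw I Z) \<partial>?P)"
    by (intro sum.cong refl inv) auto
  also have "\<dots> = (\<integral>\<^sup>+Z. (\<Sum>I\<in>Pow {..<n}. indicator T (?sw I Z)) \<partial>?P)"
    by (rule nn_integral_sum[symmetric]) (use T(1) in \<open>auto intro: measurable_compose[OF sw]\<close>)
  also have "\<dots> \<le> (\<integral>\<^sup>+Z. ennreal (2 ^ n * ?c) \<partial>?P)"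
  proof (rule nn_integral_mono)
    fix Z assume "Z \<in> space ?P"
    then have Z: "Z \<in> space (\<Pi>\<^sub>M i\<in>{..<2*n}. M)" by (simp only: space_PiM_prob_algebra(2)[OF \<mu>])
    have "(\<Sum>I\<in>Pow {..<n}. indicator T (?sw I Z)) \<le> (\<Sum>I\<in>Pow {..<n}. if ?sw I Z \<in> deviation_set M H n t then 1 else 0 :: ennreal)"
      using T(2) by (intro sum_mono) (auto simp: indicator_def)
    also have "\<dots> = (\<Sum>I\<in>{I\<in>Pow {..<n}. ?sw I Z \<in> deviation_set M H n t}. 1)"
      by (rule sum.inter_filter[symmetric]) simp
    also have "\<dots> = ennreal (real (card {I \<in> Pow {..<n}. ?sw I Z \<in> deviation_set M H n t}))"
      by (simp add: ennreal_of_nat_eq_real_of_nat)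
    also have "\<dots> \<le> ennreal (2 ^ n * ?c)"
      using card_swaps_deviation_le[OF hyp vc t Z] by (intro ennreal_leI) (simp add: mult_ac)
    finally show "(\<Sum>I\<in>Pow {..<n}. indicator T (?sw I Z)) \<le> ennreal (2 ^ n * ?c)" .
  qed
  also have "\<dots> = of_nat (2 ^ n) * ennreal ?c"
    by (simp add: P.emeasure_space_1 ennreal_mult' ennreal_of_nat_eq_real_of_nat)
  finally show ?thesis
    by (subst (asm) ennreal_mult_le_mult_iff) (auto simp: ennreal_of_nat_eq_real_of_nat)
qed

text \<open>The set is a finite union, over the labelings with large discrepancy, of the sets
  controlled by \<open>measurable_traces\<close>.\<close>

lemma deviation_set_sets_completion:
  assumes hyp: "hypothesis_class M H" and tr: "measurable_traces M H" and \<mu>: "\<mu> \<in> space (prob_algebra M)"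
  shows "deviation_set M H n t \<in> sets (completion (\<Pi>\<^sub>M i\<in>{..<2*n}. \<mu>))"
proof -
  let ?Y = "{y \<in> PiE {..<2*n} (\<lambda>_. {0,1}). \<bar>\<Sum>i<n. real (y i) - real (y (n + i))\<bar> > real n * t}"
  let ?R = "\<lambda>y. {S \<in> space (\<Pi>\<^sub>M i\<in>{..<2*n}. M). \<exists>h\<in>H. \<forall>i<2*n. h (S i) = y i}"
  have "deviation_set M H n t = (\<Union>y\<in>?Y. ?R y)"
  proof (intro equalityI subsetI)
    fix Z assume Z: "Z \<in> deviation_set M H n t"
    then obtain h where h: "h \<in> H" "\<bar>\<Sum>i<n. real (h (Z i)) - real (h (Z (n + i)))\<bar> > real n * t"
      and Zs: "Z \<in> space (\<Pi>\<^sub>M i\<in>{..<2*n}. M)"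
      unfolding deviation_set_def by blast
    have Zi: "Z i \<in> space M" if "i < 2 * n" for i using Zs that by (auto simp: space_PiM)
    let ?y = "restrict (\<lambda>i. h (Z i)) {..<2*n}"
    have "(\<Sum>i<n. real (?y i) - real (?y (n + i))) = (\<Sum>i<n. real (h (Z i)) - real (h (Z (n + i))))"
      by (rule sum.cong) auto
    moreover have "?y \<in> PiE {..<2*n} (\<lambda>_. {0,1})"
      using hypothesis_value[OF hyp h(1) Zi] by auto
    ultimately have "?y \<in> ?Y" using h(2) by simp
    moreover have "Z \<in> ?R ?y" using Zs h(1) by auto
    ultimately show "Z \<in> (\<Union>y\<in>?Y. ?R y)" by blast
  next
    fix Z assume "Z \<in> (\<Union>y\<in>?Y. ?R y)"
    then obtain y h where y: "y \<in> ?Y" and Zs: "Z \<in> space (\<Pi>\<^sub>M i\<in>{..<2*n}. M)"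
      and h: "h \<in> H" "\<forall>i<2*n. h (Z i) = y i" by blast
    have "(\<Sum>i<n. real (h (Z i)) - real (h (Z (n + i)))) = (\<Sum>i<n. real (y i) - real (y (n + i)))"
      using h(2) by (intro sum.cong) auto
    moreover have "\<bar>\<Sum>i<n. real (y i) - real (y (n + i))\<bar> > real n * t" using y by blast
    ultimately have "\<bar>\<Sum>i<n. real (h (Z i)) - real (h (Z (n + i)))\<bar> > real n * t" by (simp only:)
    then show "Z \<in> deviation_set M H n t" using Zs h(1) unfolding deviation_set_def by blast
  qed
  moreover have "finite ?Y" by (rule finite_subset[of _ "PiE {..<2*n} (\<lambda>_. {0,1})"]) (auto intro: finite_PiE)
  moreover have "?R y \<in> sets (completion (\<Pi>\<^sub>M i\<in>{..<2*n}. \<mu>))" for y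
    using tr \<mu> unfolding measurable_traces_def by blast
  ultimately show ?thesis by (simp add: sets.finite_UN)
qed

text \<open>The samples with a large deviation need not be measurable. They are covered by those whose
  section of a measurable hull of \<^const>\<open>deviation_set\<close> has probability at least one half.\<close>

lemma uniform_convergence:
  assumes hyp: "hypothesis_class M H" and vc: "finite_vc_dim M H" and tr: "measurable_traces M H"
    and \<mu>: "\<mu> \<in> space (prob_algebra M)" and n: "0 < n" and t: "0 \<le> t" "1 \<le> real n * t\<^sup>2"
  obtains A where "A \<in> sets (\<Pi>\<^sub>M i\<in>{..<n}. \<mu>)"
    and "measure (\<Pi>\<^sub>M i\<in>{..<n}. \<mu>) A \<le> 4 * (2 * real n + 1) ^ vc_dim M H * exp (- (real n * t\<^sup>2 / 2))"
    and "\<And>S h. S \<in> space (\<Pi>\<^sub>M i\<in>{..<n}. \<mu>) \<Longrightarrow> S \<notin> A \<Longrightarrow> h \<in> H \<Longrightarrow>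
      \<bar>(\<Sum>i<n. real (h (S i))) - real n * measure \<mu> {x \<in> space M. h x = 1}\<bar> \<le> 2 * real n * t"
proof -
  let ?I = "{..<n}" and ?J = "{n..<2*n}"
  let ?PI = "\<Pi>\<^sub>M i\<in>?I. \<mu>" and ?PJ = "\<Pi>\<^sub>M i\<in>?J. \<mu>" and ?P = "\<Pi>\<^sub>M i\<in>{..<2*n}. \<mu>"
  let ?c = "2 * (2 * real n + 1) ^ vc_dim M H * exp (- (real n * t\<^sup>2 / 2))"
  interpret \<mu>: prob_space \<mu> using prob_algebraD[OF \<mu>] by simp
  interpret PI: prob_space ?PI by (rule space_PiM_prob_algebra(3)[OF \<mu>])
  interpret PJ: prob_space ?PJ by (rule space_PiM_prob_algebra(3)[OF \<mu>])
  interpret product_sigma_finite "\<lambda>_::nat. \<mu>" by standard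
  have IJ: "?I \<inter> ?J = {}" "?I \<union> ?J = {..<2*n}" by auto
  obtain T1 N N' where dev: "deviation_set M H n t = T1 \<union> N" "N \<subseteq> N'" "N' \<in> null_sets ?P" "T1 \<in> sets ?P"
    using sets_completionE[OF deviation_set_sets_completion[OF hyp tr \<mu>]] by metis
  \<comment> \<open>\<open>T1\<close> lies inside the deviation set and inherits its bound. Adding
    the null set \<open>N'\<close> gives a measurable superset of the same measure.\<close>
  define T2 where "T2 = T1 \<union> N'"
  have T2: "T2 \<in> sets ?P" "deviation_set M H n t \<subseteq> T2" using dev by (auto simp: T2_def)
  have "emeasure ?P T2 = emeasure ?P T1"
    unfolding T2_def by (rule emeasure_Un_null_set) (use dev in auto)
  also have "\<dots> \<le> ennreal ?c"
    by (rule emeasure_deviation_le[OF hyp vc t(1) \<mu>]) (use dev in auto)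
  finally have T2c: "emeasure ?P T2 \<le> ennreal ?c" .
  define G where "G S = emeasure ?PJ ((\<lambda>y. merge ?I ?J (S, y)) -` T2 \<inter> space ?PJ)" for S
  have T2': "T2 \<in> sets (PiM (?I \<union> ?J) (\<lambda>_. \<mu>))" using T2(1) unfolding IJ(2) .
  have G[measurable]: "G \<in> borel_measurable ?PI"
    unfolding G_def by (rule emeasure_fold_measurable[OF IJ(1) _ _ T2']) auto
  have GT: "emeasure ?P T2 = (\<integral>\<^sup>+S. G S \<partial>?PI)"
    unfolding G_def using emeasure_fold_integral[OF IJ(1) _ _ T2'] unfolding IJ(2) by simp
  define A where "A = {S \<in> space ?PI. ennreal (1 / 2) \<le> G S}"
  have A: "A \<in> sets ?PI" unfolding A_def by measurable
  \<comment> \<open>Markov's inequality at level \<open>1 / 2\<close>, which turns the factor 2 of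
    the deviation bound into 4.\<close>
  have "emeasure ?PI A = (\<integral>\<^sup>+S. indicator A S \<partial>?PI)" using A by simp
  also have "\<dots> \<le> (\<integral>\<^sup>+S. 2 * G S \<partial>?PI)"
  proof (rule nn_integral_mono)
    fix S
    have "1 \<le> 2 * G S" if "ennreal (1 / 2) \<le> G S"
    proof -
      have "1 = ennreal 2 * ennreal (1 / 2)" by (subst ennreal_mult[symmetric]) auto
      also have "\<dots> = 2 * ennreal (1 / 2)" by simp
      also have "\<dots> \<le> 2 * G S" using that by (rule mult_left_mono) simp
      finally show ?thesis .
    qed
    then show "indicator A S \<le> 2 * G S" by (auto simp: A_def indicator_def)
  qed
  also have "\<dots> = 2 * emeasure ?P T2" unfolding GT by (rule nn_integral_cmult) (rule G)
  also have "\<dots> \<le> 2 * ennreal ?c" using T2c by (rule mult_left_mono) simp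
  also have "\<dots> = ennreal (2 * ?c)" by (subst ennreal_mult) auto
  finally have "measure ?PI A \<le> 2 * ?c"
    by (subst (asm) PI.emeasure_eq_measure) (simp add: ennreal_le_iff)
  then have mA: "measure ?PI A \<le> 4 * (2 * real n + 1) ^ vc_dim M H * exp (- (real n * t\<^sup>2 / 2))" by simp
  have small: "2 * exp (- 2 * real n * t\<^sup>2) \<le> 1 / 2"
  proof -
    have "2 * exp (- 2 * real n * t\<^sup>2) \<le> 2 * exp (- 2)" using t(2) by simp
    also have "(4 :: real) \<le> exp 2"
    proof -
      have "(1 + 1) ^ 2 \<le> (exp 1 :: real) ^ 2" by (intro power_mono exp_ge_add_one_self) auto
      then show ?thesis by (simp flip: exp_of_nat_mult)
    qed
    then have "2 * exp (- 2) \<le> (1 / 2 :: real)" by (simp add: exp_minus field_simps)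
    finally show ?thesis .
  qed
  \<comment> \<open>Symmetrization: if the frequency on \<open>S\<close> is off by more than
    \<open>2 * t\<close> and the one on the ghost sample by less than \<open>t\<close>, they differ
    by more than \<open>t\<close>. By \<open>small\<close>, the ghost sample behaves with
    probability at least one half.\<close>
  have bad: "S \<in> A" if S: "S \<in> space ?PI" and h: "h \<in> H"
    and dev_h: "\<not> \<bar>(\<Sum>i<n. real (h (S i))) - real n * measure \<mu> {x \<in> space M. h x = 1}\<bar> \<le> 2 * real n * t" for S h
  proof -
    let ?B = "{x \<in> space M. h x = 1}"
    let ?E = "{S' \<in> space ?PJ. \<bar>(\<Sum>i\<in>?J. indicator ?B (S' i)) - real n * measure \<mu> ?B\<bar> \<ge> real n * t}"
    have B: "?B \<in> sets \<mu>" using sets_hypothesis[OF hyp h] prob_algebraD[OF \<mu>] by simp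
    have E: "?E \<in> sets ?PJ" using B by measurable
    have "measure ?PJ ?E \<le> 2 * exp (- 2 * real n * t\<^sup>2)"
      using hoeffding_empirical[OF \<mu>.prob_space_axioms B, of ?J t] n t by simp
    then have "1 / 2 \<le> measure ?PJ (space ?PJ - ?E)"
      using small PJ.prob_compl[OF E] by simp
    then have "ennreal (1 / 2) \<le> ennreal (measure ?PJ (space ?PJ - ?E))" by (rule ennreal_leI)
    also have "\<dots> = emeasure ?PJ (space ?PJ - ?E)" by (simp add: PJ.emeasure_eq_measure)
    also have "\<dots> \<le> G S"
      unfolding G_def
    proof (rule emeasure_mono)
      show "(\<lambda>y. merge ?I ?J (S, y)) -` T2 \<inter> space ?PJ \<in> sets ?PJ"
        by (rule measurable_sets[OF _ T2']) (use S in measurable)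
      show "space ?PJ - ?E \<subseteq> (\<lambda>y. merge ?I ?J (S, y)) -` T2 \<inter> space ?PJ"
      proof
        fix S' assume S': "S' \<in> space ?PJ - ?E"
        let ?Z = "merge ?I ?J (S, S')"
        have ZP: "?Z \<in> space (\<Pi>\<^sub>M i\<in>{..<2*n}. M)"
          using S S' prob_algebraD(3)[OF \<mu>] by (auto simp: space_PiM merge_def PiE_def Pi_def extensional_def)
        have S'm: "S' i \<in> space M" if "i \<in> ?J" for i
          using S' that prob_algebraD(3)[OF \<mu>] by (auto simp: space_PiM)
        have "(\<Sum>i<n. real (h (?Z i)) - real (h (?Z (n + i)))) = (\<Sum>i<n. real (h (S i))) - (\<Sum>i<n. real (h (S' (n + i))))"
          unfolding sum_subtractf by (intro arg_cong2[where f="(-)"] sum.cong) (auto simp: merge_def)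
        also have "(\<Sum>i<n. real (h (S' (n + i)))) = (\<Sum>i\<in>?J. real (h (S' i)))"
          by (rule sum.reindex_bij_witness[of _ "\<lambda>i. i - n" "\<lambda>i. n + i"]) auto
        also have "\<dots> = (\<Sum>i\<in>?J. indicator ?B (S' i))"
          using hypothesis_value[OF hyp h S'm] S'm by (intro sum.cong) (auto simp: indicator_def)
        finally have "\<bar>\<Sum>i<n. real (h (?Z i)) - real (h (?Z (n + i)))\<bar> > real n * t"
          using S' dev_h by (auto simp: not_le)
        then have "?Z \<in> deviation_set M H n t"
          using ZP h unfolding deviation_set_def by blast
        then show "S' \<in> (\<lambda>y. merge ?I ?J (S, y)) -` T2 \<inter> space ?PJ" using S' T2(2) by blast
      qed
    qed
    finally show ?thesis using S unfolding A_def by blast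
  qed
  show ?thesis by (rule that[OF A mA]) (use bad in blast)
qed

section \<open>Empirical risk minimization\<close>

text \<open>Maximizing hits is phrased as minimizing misses, since a natural-number valued quantity
  attains its least value on any nonempty class.\<close>

lemma erm_learner:
  assumes hyp: "hypothesis_class M H" and ne: "feasible H \<alpha> \<mu>0 \<noteq> {}"
  obtains L where "L \<in> exact_learners M H \<alpha> n \<mu>0"
    "\<And>S h. S \<in> space (\<Pi>\<^sub>M i\<in>{..<n}. M) \<Longrightarrow> h \<in> feasible H \<alpha> \<mu>0 \<Longrightarrow>
      (\<Sum>i<n. real (h (S i))) \<le> (\<Sum>i<n. real (L S (S i)))"
proof -
  have "\<exists>g. g \<in> feasible H \<alpha> \<mu>0 \<and> (\<forall>h. h \<in> feasible H \<alpha> \<mu>0 \<longrightarrow> (\<Sum>i<n. 1 - g (S i)) \<le> (\<Sum>i<n. 1 - h (S i)))" for S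
  proof -
    obtain g where "g \<in> feasible H \<alpha> \<mu>0" using ne by blast
    then show ?thesis
      by (rule ex_has_least_nat[where P = "\<lambda>g. g \<in> feasible H \<alpha> \<mu>0" and m = "\<lambda>g. \<Sum>i<n. 1 - g (S i)"])
  qed
  then obtain L where L: "\<And>S. L S \<in> feasible H \<alpha> \<mu>0"
    "\<And>S h. h \<in> feasible H \<alpha> \<mu>0 \<Longrightarrow> (\<Sum>i<n. 1 - L S (S i)) \<le> (\<Sum>i<n. 1 - h (S i))"
    by metis
  show ?thesis
  proof (rule that[of L])
    show "L \<in> exact_learners M H \<alpha> n \<mu>0" using L(1) by (simp add: exact_learners_def)
    fix S h assume S: "S \<in> space (\<Pi>\<^sub>M i\<in>{..<n}. M)" and h: "h \<in> feasible H \<alpha> \<mu>0"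
    have compl: "(\<Sum>i<n. real (g (S i))) = real n - real (\<Sum>i<n. 1 - g (S i))" if g: "g \<in> feasible H \<alpha> \<mu>0" for g
    proof -
      have "real (g (S i)) = 1 - real (1 - g (S i))" if "i < n" for i
        using hypothesis_value[OF hyp, of g "S i"] g S that by (fastforce simp: feasible_def space_PiM)
      then have "(\<Sum>i<n. real (g (S i))) = (\<Sum>i<n. 1 - real (1 - g (S i)))" by simp
      then show ?thesis by (simp add: sum_subtractf)
    qed
    show "(\<Sum>i<n. real (h (S i))) \<le> (\<Sum>i<n. real (L S (S i)))"
      unfolding compl[OF h] compl[OF L(1)] using L(2)[OF h, of S] by (simp del: of_nat_sum)
  qed
qed

lemma minimax_excess_le_sqrt:
  assumes hyp: "hypothesis_class M H" and vc: "finite_vc_dim M H" and tr: "measurable_traces M H"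
    and ne: "feasible H \<alpha> \<mu>0 \<noteq> {}" and n: "0 < n" and d: "0 < vc_dim M H"
  shows "minimax_excess M H \<alpha> n \<mu>0 \<le> ennreal (13 * ((1 + ln (real n)) * sqrt (real (vc_dim M H) / real n)))"
proof -
  let ?d = "real (vc_dim M H)"
  define l where "l = 1 + ln (real n)"
  \<comment> \<open>The exponent \<open>n * t\<^sup>2 / 2 = 4 * d * l\<close> must absorb
    \<open>4 * (2 * n + 1) ^ d\<close>, at most \<open>exp (2 + d * (2 + ln n))\<close>, and still
    leave \<open>1 / n\<close>.\<close>
  define t where "t = sqrt (8 * ?d * l / real n)"
  have l: "1 \<le> l" using n by (simp add: l_def)
  have d1: "1 \<le> ?d" using d by simp
  have t0: "0 \<le> t" using l by (simp add: t_def)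
  have nt: "real n * t\<^sup>2 = 8 * ?d * l"
    using l n by (simp add: t_def)
  have dl: "1 \<le> ?d * l" using mult_mono[OF d1 l] l d1 by simp
  then have nt1: "1 \<le> real n * t\<^sup>2" unfolding nt by linarith
  have tail: "4 * (2 * real n + 1) ^ vc_dim M H * exp (- (real n * t\<^sup>2 / 2)) \<le> 1 / real n"
  proof -
    have e1: "2 \<le> (exp 1 :: real)" using exp_ge_add_one_self[of "1 :: real"] by simp
    have e2: "4 \<le> (exp 2 :: real)"
      using power_mono[OF e1, of 2] by (simp flip: exp_of_nat_mult)
    have en: "real n = exp (ln (real n))" using n by simp
    have "2 * real n + 1 \<le> 4 * real n" using n by simp
    also have "\<dots> \<le> exp 2 * real n" using e2 by (intro mult_right_mono) auto
    also have "\<dots> = exp (2 + ln (real n))" using en by (simp add: exp_add)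
    finally have "(2 * real n + 1) ^ vc_dim M H \<le> exp (2 + ln (real n)) ^ vc_dim M H"
      by (intro power_mono) auto
    also have "\<dots> = exp (?d * (2 + ln (real n)))" by (simp add: exp_of_nat_mult)
    finally have "4 * (2 * real n + 1) ^ vc_dim M H \<le> exp 2 * exp (?d * (2 + ln (real n)))"
      using e2 by (intro mult_mono) auto
    then have "4 * (2 * real n + 1) ^ vc_dim M H * exp (- (real n * t\<^sup>2 / 2))
        \<le> exp 2 * exp (?d * (2 + ln (real n))) * exp (- (real n * t\<^sup>2 / 2))"
      by (intro mult_right_mono) auto
    also have "\<dots> = exp (2 + ?d * (2 + ln (real n)) - 4 * ?d * l)"
      unfolding nt by (simp add: mult_exp_exp algebra_simps)
    also have "\<dots> \<le> exp (- ln (real n))"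
    proof -
      have "ln (real n) \<le> ?d * ln (real n)" using d1 n by (simp add: mult_le_cancel_right1)
      moreover have "0 \<le> ln (real n)" using n by simp
      ultimately show ?thesis using d1 by (simp add: l_def algebra_simps)
    qed
    also have "\<dots> = 1 / real n" using n by (simp add: exp_minus inverse_eq_divide)
    finally show ?thesis .
  qed
  obtain L where L: "L \<in> exact_learners M H \<alpha> n \<mu>0"
    "\<And>S h. S \<in> space (\<Pi>\<^sub>M i\<in>{..<n}. M) \<Longrightarrow> h \<in> feasible H \<alpha> \<mu>0 \<Longrightarrow>
      (\<Sum>i<n. real (h (S i))) \<le> (\<Sum>i<n. real (L S (S i)))"
    using erm_learner[OF hyp ne] by blast
  have "minimax_excess M H \<alpha> n \<mu>0 \<le> ennreal (4 * t + 1 / real n)"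
  proof (rule minimax_excess_le[OF L(1)])
    fix \<mu> assume \<mu>: "\<mu> \<in> space (prob_algebra M)"
    let ?P = "\<Pi>\<^sub>M i\<in>{..<n}. \<mu>"
    let ?m = "\<lambda>h. measure \<mu> {x \<in> space M. h x = 1}"
    obtain A where A: "A \<in> sets ?P"
      "measure ?P A \<le> 4 * (2 * real n + 1) ^ vc_dim M H * exp (- (real n * t\<^sup>2 / 2))"
      "\<And>S h. S \<in> space ?P \<Longrightarrow> S \<notin> A \<Longrightarrow> h \<in> H \<Longrightarrow>
        \<bar>(\<Sum>i<n. real (h (S i))) - real n * ?m h\<bar> \<le> 2 * real n * t"
      using uniform_convergence[OF hyp vc tr \<mu> n t0 nt1] by blast
    show "outer_expectation ?P (\<lambda>S. ennreal (excess_risk H \<alpha> \<mu>0 \<mu> (L S))) \<le> ennreal (4 * t + 1 / real n)"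
    proof (rule outer_expectation_le[OF space_PiM_prob_algebra(3)[OF \<mu>] A(1)])
      show "excess_risk H \<alpha> \<mu>0 \<mu> (L S) \<le> 1" for S by (rule excess_risk_le_1[OF ne \<mu>])
      show "measure ?P A \<le> 1 / real n" using A(2) tail by linarith
      fix S assume S: "S \<in> space ?P" "S \<notin> A"
      then have SM: "S \<in> space (\<Pi>\<^sub>M i\<in>{..<n}. M)" by (simp only: space_PiM_prob_algebra(2)[OF \<mu>])
      have g: "L S \<in> feasible H \<alpha> \<mu>0" using L(1) SM by (simp add: exact_learners_def)
      show "excess_risk H \<alpha> \<mu>0 \<mu> (L S) \<le> 4 * t"
      proof (rule excess_risk_le[OF ne])
        fix h assume h: "h \<in> feasible H \<alpha> \<mu>0"
        have gh: "L S \<in> H" "h \<in> H" using g h by (auto simp: feasible_def)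
        \<comment> \<open>Two deviations of at most \<open>2 * t\<close>, one for the competitor and
          one for the returned hypothesis.\<close>
        have "real n * (?m h - ?m (L S)) \<le> real n * (4 * t)"
          using A(3)[OF S gh(1)] A(3)[OF S gh(2)] L(2)[OF SM h] by (simp add: algebra_simps abs_le_iff)
        then have "?m h - ?m (L S) \<le> 4 * t" using n by simp
        then show "risk1 \<mu> (L S) - risk1 \<mu> h \<le> 4 * t"
          unfolding risk1_eq[OF hyp gh(1) \<mu>] risk1_eq[OF hyp gh(2) \<mu>] by simp
      qed (use t0 in simp)
    qed (use t0 in simp_all)
  qed
  also have "4 * t + 1 / real n \<le> 13 * (l * sqrt (?d / real n))"
  proof -
    \<comment> \<open>The final 13 is \<open>4 * 3\<close>, from
      \<open>8 * l \<le> (3 * l)\<^sup>2\<close>, plus 1 for the exceptional set.\<close>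
    have "t \<le> sqrt ((3 * l)\<^sup>2 * (?d / real n))"
      unfolding t_def
    proof (rule real_sqrt_le_mono)
      have "8 * l \<le> (3 * l)\<^sup>2" using mult_mono[OF l l] l by (simp add: power2_eq_square)
      then have "8 * l * (?d / real n) \<le> (3 * l)\<^sup>2 * (?d / real n)" by (intro mult_right_mono) auto
      then show "8 * ?d * l / real n \<le> (3 * l)\<^sup>2 * (?d / real n)" by (simp add: mult_ac)
    qed
    also have "\<dots> = 3 * l * sqrt (?d / real n)" unfolding real_sqrt_mult real_sqrt_abs using l by simp
    finally have "4 * t \<le> 12 * (l * sqrt (?d / real n))" by simp
    moreover have "1 / real n \<le> l * sqrt (?d / real n)"
    proof -
      have "1 / real n \<le> sqrt (?d / real n)"
      proof (rule real_le_rsqrt)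
        have "(1 / real n)\<^sup>2 \<le> 1 / real n" using n by (simp add: power2_eq_square field_simps)
        also have "\<dots> \<le> ?d / real n" using d1 by (intro divide_right_mono) auto
        finally show "(1 / real n)\<^sup>2 \<le> ?d / real n" .
      qed
      also have "\<dots> \<le> l * sqrt (?d / real n)"
        using mult_right_mono[OF l, of "sqrt (?d / real n)"] by simp
      finally show ?thesis .
    qed
    ultimately show ?thesis by linarith
  qed
  finally show ?thesis unfolding l_def by (simp add: ennreal_leI)
qed

section \<open>Classes that do not separate three points\<close>

definition comparable_on :: "'a set \<Rightarrow> ('a \<Rightarrow> nat) \<Rightarrow> ('a \<Rightarrow> nat) \<Rightarrow> bool" where
  "comparable_on X g h \<longleftrightarrow> {x \<in> X. g x = 1} \<subseteq> {x \<in> X. h x = 1} \<or> {x \<in> X. h x = 1} \<subseteq> {x \<in> X. g x = 1}"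

text \<open>Points at which the two inclusions fail, together with the common zero, would be three
  separated points.\<close>

lemma comparable_of_common_zero:
  assumes hyp: "hypothesis_class M H" and ns: "\<not> separates_three_points M H"
    and gh: "g \<in> H" "h \<in> H" "z \<in> space M" "g z = 0" "h z = 0"
  shows "comparable_on (space M) g h"
proof (rule ccontr)
  assume "\<not> ?thesis"
  then obtain x y where "x \<in> space M" "g x = 1" "h x \<noteq> 1" "y \<in> space M" "h y = 1" "g y \<noteq> 1"
    unfolding comparable_on_def by blast
  moreover then have "h x = 0" "g y = 0" using hypothesis_value[OF hyp] gh by blast+
  ultimately have "separates_three_points M H"
    unfolding separates_three_points_def using gh by blast
  with ns show False ..
qed

text \<open>Two feasible hypotheses take \<mu>0-mass at most \<open>2 * \<alpha> < 1\<close>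
  together, so they cannot cover the space.\<close>

lemma feasible_comparable:
  assumes hyp: "hypothesis_class M H" and ns: "\<not> separates_three_points M H"
    and \<mu>0: "\<mu>0 \<in> space (prob_algebra M)" and \<alpha>: "\<alpha> < 1 / 2"
    and gh: "g \<in> feasible H \<alpha> \<mu>0" "h \<in> feasible H \<alpha> \<mu>0"
  shows "comparable_on (space M) g h"
proof -
  interpret prob_space \<mu>0 using prob_algebraD[OF \<mu>0] by simp
  note [simp] = prob_algebraD(2,3)[OF \<mu>0]
  have H: "g \<in> H" "h \<in> H" using gh by (auto simp: feasible_def)
  have "\<exists>z\<in>space M. g z = 0 \<and> h z = 0"
  proof (rule ccontr)
    assume "\<not> ?thesis"
    then have "space M = {x \<in> space M. g x = 1} \<union> {x \<in> space M. h x = 1}"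
      using hypothesis_value[OF hyp] H by blast
    then have "1 = measure \<mu>0 ({x \<in> space M. g x = 1} \<union> {x \<in> space M. h x = 1})"
      using prob_space by simp
    also have "\<dots> \<le> measure \<mu>0 {x \<in> space M. g x = 1} + measure \<mu>0 {x \<in> space M. h x = 1}"
      by (rule measure_Un_le) (use sets_hypothesis[OF hyp] H in auto)
    also have "\<dots> \<le> \<alpha> + \<alpha>"
      using gh by (intro add_mono) (auto simp: feasible_def risk0_def)
    finally show False using \<alpha> by simp
  qed
  then show ?thesis using comparable_of_common_zero[OF hyp ns] H by blast
qed

text \<open>Three shattered points give a pair system with one pair, that is, three separated
  points. Consequently \<open>d / n\<close> and \<open>1 / n\<close> agree up to a constant in the
  case without separation.\<close>

lemma shattered_card_le_2:
  assumes ns: "\<not> separates_three_points M H" and A: "shattered M H A"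
  shows "card A \<le> 2"
proof (rule ccontr)
  assume "\<not> card A \<le> 2"
  then have "2 * 1 + 1 \<le> card A" by simp
  then obtain q x0 where ps: "pair_system M H 1 q x0" by (rule pair_system_shattered[OF A])
  have q: "q 0 \<in> space M" "q 1 \<in> space M" "x0 \<in> space M"
    using ps by (auto simp: pair_system_def)
  have "\<exists>h\<in>H. h x0 = 0 \<and> (\<forall>i<2*1. h (q i) = (if heavy \<sigma> i then 1 else 0))" if "\<sigma> \<subseteq> {..<1}" for \<sigma>
    using ps that unfolding pair_system_def by blast
  from this[of "{}"] this[of "{0}"] obtain h1 h2 where
    "h1 \<in> H" "h1 x0 = 0" "h1 (q 0) = 1" "h1 (q 1) = 0"
    "h2 \<in> H" "h2 x0 = 0" "h2 (q 0) = 0" "h2 (q 1) = 1"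
    by (auto simp: heavy_def)
  then have "separates_three_points M H" unfolding separates_three_points_def using q by blast
  with ns show False ..
qed

lemma minimax_excess_eq_0:
  assumes ne: "admits_maximal M (feasible H \<alpha> \<mu>0)" and hyp: "hypothesis_class M H"
  shows "minimax_excess M H \<alpha> n \<mu>0 = 0"
proof -
  obtain g where g: "g \<in> feasible H \<alpha> \<mu>0"
    and max: "\<And>h. h \<in> feasible H \<alpha> \<mu>0 \<Longrightarrow> {x \<in> space M. h x = 1} \<subseteq> {x \<in> space M. g x = 1}"
    using ne unfolding admits_maximal_def by blast
  have "minimax_excess M H \<alpha> n \<mu>0 \<le> 0"
  proof (rule minimax_excess_le[where L = "\<lambda>_. g"])
    show "(\<lambda>_. g) \<in> exact_learners M H \<alpha> n \<mu>0" using g by (simp add: exact_learners_def)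
    fix \<mu> assume \<mu>: "\<mu> \<in> space (prob_algebra M)"
    interpret prob_space \<mu> using prob_algebraD[OF \<mu>] by simp
    have "excess_risk H \<alpha> \<mu>0 \<mu> g \<le> 0"
    proof (rule excess_risk_le)
      fix h assume h: "h \<in> feasible H \<alpha> \<mu>0"
      have gh: "g \<in> H" "h \<in> H" using g h by (auto simp: feasible_def)
      have "measure \<mu> {x \<in> space M. h x = 1} \<le> measure \<mu> {x \<in> space M. g x = 1}"
        by (rule finite_measure_mono[OF max[OF h]])
           (use sets_hypothesis[OF hyp gh(1)] prob_algebraD(2)[OF \<mu>] in auto)
      then show "risk1 \<mu> g - risk1 \<mu> h \<le> 0"
        unfolding risk1_eq[OF hyp gh(1) \<mu>] risk1_eq[OF hyp gh(2) \<mu>] by simp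
    qed (use g in auto)
    then have "ennreal (excess_risk H \<alpha> \<mu>0 \<mu> g) = 0" by (simp add: ennreal_neg)
    then show "outer_expectation (\<Pi>\<^sub>M i\<in>{..<n}. \<mu>) (\<lambda>S. ennreal (excess_risk H \<alpha> \<mu>0 \<mu> g)) \<le> 0"
      by (simp add: outer_expectation_eq_nn_integral)
  qed
  then show ?thesis by simp
qed

lemma minimax_excess_ge_no_maximal:
  assumes single: "\<forall>x\<in>space M. {x} \<in> sets M" and hyp: "hypothesis_class M H"
    and \<mu>0: "\<mu>0 \<in> space (prob_algebra M)" and ne: "feasible H \<alpha> \<mu>0 \<noteq> {}"
    and nomax: "\<not> admits_maximal M (feasible H \<alpha> \<mu>0)"
    and chain: "\<And>g h. g \<in> feasible H \<alpha> \<mu>0 \<Longrightarrow> h \<in> feasible H \<alpha> \<mu>0 \<Longrightarrow> comparable_on (space M) g h"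
    and n: "0 < n"
  shows "ennreal (1 / (4 * real n)) \<le> minimax_excess M H \<alpha> n \<mu>0"
proof (rule minimax_excess_ge[OF \<mu>0 ne])
  fix L assume L: "L \<in> exact_learners M H \<alpha> n \<mu>0"
  obtain x where x: "x \<in> space M"
    using prob_space.not_empty[OF prob_algebraD(1)[OF \<mu>0]] prob_algebraD(3)[OF \<mu>0] by blast
  define S where "S = (\<lambda>i\<in>{..<n}. x)"
  have S: "S \<in> space (\<Pi>\<^sub>M i\<in>{..<n}. M)" using x by (simp add: S_def space_PiM)
  have g: "L S \<in> feasible H \<alpha> \<mu>0" using L S by (simp add: exact_learners_def)
  obtain h y where h: "h \<in> feasible H \<alpha> \<mu>0" and y: "y \<in> space M" "h y = 1" "L S y \<noteq> 1"
    using nomax g unfolding admits_maximal_def by blast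
  \<comment> \<open>By comparability \<open>h\<close> contains all that \<open>L S\<close> selects,
    so the large mass at \<open>x\<close> cannot favour \<open>L S\<close>.\<close>
  have sub: "{x \<in> space M. L S x = 1} \<subseteq> {x \<in> space M. h x = 1}"
    using chain[OF g h] y unfolding comparable_on_def by blast
  have gh: "L S \<in> H" "h \<in> H" using g h by (auto simp: feasible_def)
  \<comment> \<open>With this \<open>p\<close> the constant sample has probability at least
    \<open>(1 - p) ^ n \<ge> 1 / 2\<close>, and on it the excess risk is at least
    \<open>p\<close>.\<close>
  define p where "p = 1 / (2 * real n)"
  have p: "0 < p" "p \<le> 1" using n by (auto simp: p_def)
  let ?w = "\<lambda>i::nat. if i = 0 then 1 - p else p" and ?q = "\<lambda>i::nat. if i = 0 then x else y"
  define \<mu> where "\<mu> = discrete_measure M {0, 1} ?w ?q"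
  have dm: "finite {0, 1::nat}" "\<And>i. i \<in> {0, 1} \<Longrightarrow> 0 \<le> ?w i" "sum ?w {0, 1} = 1" "?q \<in> {0, 1} \<rightarrow> space M"
    using p x y by auto
  have \<mu>: "\<mu> \<in> space (prob_algebra M)"
    unfolding \<mu>_def by (rule discrete_measure_in_prob_algebra[OF dm])
  have m: "measure \<mu> B = (1 - p) * (if x \<in> B then 1 else 0) + p * (if y \<in> B then 1 else 0)" if "B \<in> sets M" for B
  proof -
    have "measure \<mu> B = (\<Sum>i\<in>{i\<in>{0, 1}. ?q i \<in> B}. ?w i)"
      unfolding \<mu>_def by (rule measure_discrete_measure[OF dm that])
    also have "\<dots> = (\<Sum>i\<in>{0, 1}. ?w i * (if ?q i \<in> B then 1 else 0))"
      by (rule sum_filter_eq) simp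
    finally show ?thesis by simp
  qed
  have "p \<le> measure \<mu> {x \<in> space M. h x = 1} - measure \<mu> {x \<in> space M. L S x = 1}"
    unfolding m[OF sets_hypothesis[OF hyp gh(1)]] m[OF sets_hypothesis[OF hyp gh(2)]]
    using y sub p by auto
  also have "\<dots> = risk1 \<mu> (L S) - risk1 \<mu> h"
    unfolding risk1_eq[OF hyp gh(1) \<mu>] risk1_eq[OF hyp gh(2) \<mu>] by simp
  also have "\<dots> \<le> excess_risk H \<alpha> \<mu>0 \<mu> (L S)" by (rule excess_risk_ge[OF h])
  finally have exc: "p \<le> excess_risk H \<alpha> \<mu>0 \<mu> (L S)" .
  have xs: "{x} \<in> sets M" using single x by blast
  interpret prob_space \<mu> using prob_algebraD[OF \<mu>] by simp
  have ex: "ennreal (1 - p) \<le> emeasure \<mu> {x}"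
    unfolding emeasure_eq_measure m[OF xs] using p by (intro ennreal_leI) auto
  have "1 / 2 = 1 + real n * (- p)" using n by (simp add: p_def)
  also have "\<dots> \<le> (1 + - p) ^ n" by (rule Bernoulli_inequality) (use p in simp)
  finally have half: "1 / 2 \<le> (1 - p) ^ n" by simp
  have "1 / (4 * real n) = p * (1 / 2)" by (simp add: p_def)
  also have "ennreal \<dots> = ennreal p * ennreal (1 / 2)" using p by (intro ennreal_mult) auto
  also have "\<dots> \<le> ennreal (excess_risk H \<alpha> \<mu>0 \<mu> (L S)) * (\<Prod>i<n. emeasure \<mu> {S i})"
  proof (rule mult_mono)
    have "ennreal (1 / 2) \<le> ennreal ((1 - p) ^ n)" by (rule ennreal_leI[OF half])
    also have "\<dots> = ennreal (1 - p) ^ n" using p by (simp add: ennreal_power)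
    also have "\<dots> \<le> emeasure \<mu> {x} ^ n" using ex by (intro power_mono) auto
    also have "\<dots> = (\<Prod>i<n. emeasure \<mu> {S i})" by (simp add: S_def)
    finally show "ennreal (1 / 2) \<le> (\<Prod>i<n. emeasure \<mu> {S i})" .
  qed (use exc in \<open>auto intro: ennreal_leI\<close>)
  also have "\<dots> = (\<Sum>S\<in>{S}. ennreal (excess_risk H \<alpha> \<mu>0 \<mu> (L S)) * (\<Prod>i<n. emeasure \<mu> {S i}))" by simp
  also have "\<dots> \<le> outer_expectation (\<Pi>\<^sub>M i\<in>{..<n}. \<mu>) (\<lambda>S. ennreal (excess_risk H \<alpha> \<mu>0 \<mu> (L S)))"
    by (rule outer_expectation_ge_sum[OF single \<mu>]) (use S in auto)
  finally show "\<exists>\<mu>1 \<in> space (prob_algebra M). ennreal (1 / (4 * real n))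
      \<le> outer_expectation (\<Pi>\<^sub>M i\<in>{..<n}. \<mu>1) (\<lambda>S. ennreal (excess_risk H \<alpha> \<mu>0 \<mu>1 (L S)))"
    using \<mu> by blast
qed

subsection \<open>Chains of hypotheses\<close>

text \<open>\<open>measurable_traces\<close> ignores null sets of each product distribution. A set
  that is null for this mixture stays null under \<mu> and cannot contain \<open>z\<close>, so a
  coordinate may later be fixed at \<open>z\<close>.\<close>

definition add_atom :: "'a measure \<Rightarrow> 'a \<Rightarrow> 'a measure \<Rightarrow> 'a measure" where
  "add_atom M z \<mu> = measure_pmf (bernoulli_pmf (1/2)) \<bind> (\<lambda>b. if b then return M z else \<mu>)"

lemma
  assumes \<mu>: "\<mu> \<in> space (prob_algebra M)" and z: "z \<in> space M"
  shows add_atom_in_prob_algebra: "add_atom M z \<mu> \<in> space (prob_algebra M)"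
    and nn_integral_add_atom: "f \<in> borel_measurable M \<Longrightarrow>
      (\<integral>\<^sup>+x. f x \<partial>add_atom M z \<mu>) = ennreal (1/2) * f z + ennreal (1/2) * (\<integral>\<^sup>+x. f x \<partial>\<mu>)"
proof -
  let ?N = "\<lambda>b. if b then return M z else \<mu>"
  have N: "?N b \<in> space (prob_algebra M)" for b
    using \<mu> z by (auto simp: space_prob_algebra prob_space_return)
  have Np: "?N \<in> measurable (measure_pmf (bernoulli_pmf (1/2))) (prob_algebra M)"
    using N by simp
  then have Ns: "?N \<in> measurable (measure_pmf (bernoulli_pmf (1/2))) (subprob_algebra M)"
    by (rule measurable_prob_algebraD)
  have "prob_space (add_atom M z \<mu>)"
    unfolding add_atom_def
    by (rule measure_pmf.prob_space_bind[OF _ Ns]) (use N in \<open>auto simp: space_prob_algebra\<close>)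
  moreover have "sets (add_atom M z \<mu>) = sets M"
    unfolding add_atom_def by (rule sets_bind) (use prob_algebraD(2)[OF N] in auto)
  ultimately show "add_atom M z \<mu> \<in> space (prob_algebra M)" by (simp add: space_prob_algebra)
  show "(\<integral>\<^sup>+x. f x \<partial>add_atom M z \<mu>) = ennreal (1/2) * f z + ennreal (1/2) * (\<integral>\<^sup>+x. f x \<partial>\<mu>)"
    if f: "f \<in> borel_measurable M"
  proof -
    have "(\<integral>\<^sup>+x. f x \<partial>add_atom M z \<mu>)
        = (\<integral>\<^sup>+b. \<integral>\<^sup>+x. f x \<partial>(?N b) \<partial>measure_pmf (bernoulli_pmf (1/2)))"
      unfolding add_atom_def by (rule nn_integral_bind[OF f Ns])
    also have "\<dots> = ennreal (1/2) * (\<integral>\<^sup>+x. f x \<partial>return M z) + ennreal (1/2) * (\<integral>\<^sup>+x. f x \<partial>\<mu>)"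
      by (subst nn_integral_bernoulli_pmf) (auto simp: mult.commute)
    finally show ?thesis using nn_integral_return[OF z f] by simp
  qed
qed

lemma nn_integral_add_atom_eq_0:
  assumes \<mu>: "\<mu> \<in> space (prob_algebra M)" and z: "z \<in> space M" and f: "f \<in> borel_measurable M"
    and 0: "(\<integral>\<^sup>+x. f x \<partial>add_atom M z \<mu>) = 0"
  shows "f z = 0" "AE x in \<mu>. f x = 0"
proof -
  have "ennreal (1/2) * f z + ennreal (1/2) * (\<integral>\<^sup>+x. f x \<partial>\<mu>) = 0"
    using nn_integral_add_atom[OF \<mu> z f] 0 by simp
  then show "f z = 0" and "AE x in \<mu>. f x = 0"
    using f prob_algebraD(2)[OF \<mu>] by (auto simp: nn_integral_0_iff_AE cong: measurable_cong_sets)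
qed

text \<open>The indicator of \<open>N\<close> is integrated coordinate by coordinate. A zero
  integral against the mixture forces a zero at its atom and almost everywhere for \<mu>; the first
  coordinate keeps the former conclusion, the other two the latter.\<close>

lemma null_section_add_atom:
  fixes M :: "'a measure"
  assumes \<mu>: "\<mu> \<in> space (prob_algebra M)" and z: "z \<in> space M"
    and N: "N \<in> null_sets (\<Pi>\<^sub>M i\<in>{..<3::nat}. add_atom M z \<mu>)"
  defines "\<phi> \<equiv> \<lambda>a x y. \<lambda>i\<in>{..<3::nat}. if i = 0 then a else if i = 1 then x else y"
  shows "(\<lambda>(x, y). \<phi> z x y) -` N \<inter> space (\<mu> \<Otimes>\<^sub>M \<mu>) \<in> null_sets (\<mu> \<Otimes>\<^sub>M \<mu>)"
proof -
  let ?\<nu> = "add_atom M z \<mu>"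
  have \<nu>: "?\<nu> \<in> space (prob_algebra M)" by (rule add_atom_in_prob_algebra[OF \<mu> z])
  interpret \<mu>: prob_space \<mu> using prob_algebraD[OF \<mu>] by simp
  interpret \<nu>: prob_space ?\<nu> using prob_algebraD[OF \<nu>] by simp
  interpret pair_sigma_finite \<mu> \<mu> by standard
  interpret product_sigma_finite "\<lambda>_::nat. ?\<nu>" by standard
  have [measurable_cong]: "sets \<mu> = sets M" "sets ?\<nu> = sets M"
    using prob_algebraD[OF \<mu>] prob_algebraD[OF \<nu>] by auto
  have space: "space \<mu> = space M" "space ?\<nu> = space M"
    using prob_algebraD[OF \<mu>] prob_algebraD[OF \<nu>] by auto
  have \<phi>[measurable]: "(\<lambda>(a, x, y). \<phi> a x y) \<in> measurable (M \<Otimes>\<^sub>M M \<Otimes>\<^sub>M M) (\<Pi>\<^sub>M i\<in>{..<3}. M)"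
    unfolding \<phi>_def split_beta' by (rule measurable_restrict) simp
  have NM[measurable]: "N \<in> sets (\<Pi>\<^sub>M i\<in>{..<3}. M)"
    using N space_PiM_prob_algebra(1)[OF \<nu>, of "{..<3::nat}"] by auto
  define F where "F a x y = (indicator N (\<phi> a x y) :: ennreal)" for a x y
  have F[measurable]: "(\<lambda>(a, x, y). F a x y) \<in> borel_measurable (M \<Otimes>\<^sub>M M \<Otimes>\<^sub>M M)"
    unfolding F_def split_beta' using \<phi>[unfolded split_beta'] by measurable
  have F'[measurable (raw)]: "(\<lambda>w. F (a w) (x w) (y w)) \<in> borel_measurable W"
    if "a \<in> measurable W M" "x \<in> measurable W M" "y \<in> measurable W M" for a x y and W :: "'w measure"
    using measurable_compose[OF measurable_Pair[OF that(1) measurable_Pair[OF that(2,3)]] F] by simp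
  have I3: "{..<3::nat} = insert 2 (insert 1 {0})" by auto
  have N3: "(indicator N :: _ \<Rightarrow> ennreal) \<in> borel_measurable (\<Pi>\<^sub>M i\<in>insert 2 (insert 1 {0}). ?\<nu>)"
    using N unfolding I3 by auto
  have "0 = (\<integral>\<^sup>+Z. indicator N Z \<partial>(\<Pi>\<^sub>M i\<in>{..<3}. ?\<nu>))" using N by auto
  also have "\<dots> = (\<integral>\<^sup>+y. \<integral>\<^sup>+x. \<integral>\<^sup>+a. F a x y \<partial>?\<nu> \<partial>?\<nu> \<partial>?\<nu>)"
  proof -
    have inner: "(\<integral>\<^sup>+Z. indicator N (Z(2 := y)) \<partial>(\<Pi>\<^sub>M i\<in>insert 1 {0}. ?\<nu>)) = (\<integral>\<^sup>+x. \<integral>\<^sup>+a. F a x y \<partial>?\<nu> \<partial>?\<nu>)"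
      if y: "y \<in> space ?\<nu>" for y
    proof -
      have fy: "(\<lambda>Z. indicator N (Z(2 := y)) :: ennreal) \<in> borel_measurable (\<Pi>\<^sub>M i\<in>insert 1 {0}. ?\<nu>)"
        by (rule measurable_compose[OF measurable_fun_upd N3]) (use y in auto)
      have "(\<integral>\<^sup>+Z. indicator N (Z(2 := y)) \<partial>(\<Pi>\<^sub>M i\<in>insert 1 {0}. ?\<nu>))
        = (\<integral>\<^sup>+x. \<integral>\<^sup>+Z. indicator N (Z(1 := x, 2 := y)) \<partial>(\<Pi>\<^sub>M i\<in>{0}. ?\<nu>) \<partial>?\<nu>)"
        by (rule product_nn_integral_insert_rev[OF _ _ fy]) auto
      also have "\<dots> = (\<integral>\<^sup>+x. \<integral>\<^sup>+a. F a x y \<partial>?\<nu> \<partial>?\<nu>)"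
      proof (rule nn_integral_cong)
        fix x assume x: "x \<in> space ?\<nu>"
        have [measurable]: "x \<in> space M" "y \<in> space M" using x y space by simp_all
        have "(\<integral>\<^sup>+Z. indicator N (Z(1 := x, 2 := y)) \<partial>(\<Pi>\<^sub>M i\<in>{0}. ?\<nu>))
          = (\<integral>\<^sup>+Z. F (Z 0) x y \<partial>(\<Pi>\<^sub>M i\<in>{0::nat}. ?\<nu>))"
        proof (rule nn_integral_cong)
          fix Z assume "Z \<in> space (\<Pi>\<^sub>M i\<in>{0::nat}. ?\<nu>)"
          then have "Z(1 := x, 2 := y) = \<phi> (Z 0) x y"
            by (auto simp: \<phi>_def fun_eq_iff space_PiM PiE_def extensional_def)
          then show "indicator N (Z(1 := x, 2 := y)) = F (Z 0) x y" by (simp add: F_def)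
        qed
        also have "\<dots> = (\<integral>\<^sup>+a. F a x y \<partial>?\<nu>)"
          by (rule product_nn_integral_singleton) measurable
        finally show "(\<integral>\<^sup>+Z. indicator N (Z(1 := x, 2 := y)) \<partial>(\<Pi>\<^sub>M i\<in>{0}. ?\<nu>)) = (\<integral>\<^sup>+a. F a x y \<partial>?\<nu>)" .
      qed
      finally show ?thesis .
    qed
    have "(\<integral>\<^sup>+Z. indicator N Z \<partial>(\<Pi>\<^sub>M i\<in>{..<3}. ?\<nu>))
      = (\<integral>\<^sup>+y. \<integral>\<^sup>+Z. indicator N (Z(2 := y)) \<partial>(\<Pi>\<^sub>M i\<in>insert 1 {0}. ?\<nu>) \<partial>?\<nu>)"
      unfolding I3 by (rule product_nn_integral_insert_rev[OF _ _ N3]) auto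
    also have "\<dots> = (\<integral>\<^sup>+y. \<integral>\<^sup>+x. \<integral>\<^sup>+a. F a x y \<partial>?\<nu> \<partial>?\<nu> \<partial>?\<nu>)"
      by (rule nn_integral_cong) (rule inner)
    finally show ?thesis .
  qed
  finally have 0: "(\<integral>\<^sup>+y. \<integral>\<^sup>+x. \<integral>\<^sup>+a. F a x y \<partial>?\<nu> \<partial>?\<nu> \<partial>?\<nu>) = 0" by simp
  have "AE y in \<mu>. (\<integral>\<^sup>+x. \<integral>\<^sup>+a. F a x y \<partial>?\<nu> \<partial>?\<nu>) = 0"
    by (rule nn_integral_add_atom_eq_0(2)[OF \<mu> z _ 0]) measurable
  then have "AE y in \<mu>. (\<integral>\<^sup>+x. F z x y \<partial>\<mu>) = 0"
  proof (rule AE_mp, intro AE_I2 impI)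
    fix y assume y: "y \<in> space \<mu>" and 0: "(\<integral>\<^sup>+x. \<integral>\<^sup>+a. F a x y \<partial>?\<nu> \<partial>?\<nu>) = 0"
    have [measurable]: "y \<in> space M" using y space by simp
    have "AE x in \<mu>. (\<integral>\<^sup>+a. F a x y \<partial>?\<nu>) = 0"
      by (rule nn_integral_add_atom_eq_0(2)[OF \<mu> z _ 0]) measurable
    then have "AE x in \<mu>. F z x y = 0"
    proof (rule AE_mp, intro AE_I2 impI)
      fix x assume x: "x \<in> space \<mu>" and 0: "(\<integral>\<^sup>+a. F a x y \<partial>?\<nu>) = 0"
      have [measurable]: "x \<in> space M" using x space by simp
      show "F z x y = 0"
        by (rule nn_integral_add_atom_eq_0(1)[OF \<mu> z _ 0]) measurable
    qed
    then show "(\<integral>\<^sup>+x. F z x y \<partial>\<mu>) = 0"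
      by (simp add: nn_integral_cong_AE)
  qed
  then have "(\<integral>\<^sup>+y. \<integral>\<^sup>+x. F z x y \<partial>\<mu> \<partial>\<mu>) = 0" by (simp add: nn_integral_cong_AE)
  moreover have [measurable]: "(\<lambda>(x, y). \<phi> z x y) \<in> measurable (M \<Otimes>\<^sub>M M) (\<Pi>\<^sub>M i\<in>{..<3}. M)"
    unfolding \<phi>_def split_beta' using z by (intro measurable_restrict) simp
  have "(\<lambda>(x, y). F z x y) \<in> borel_measurable (\<mu> \<Otimes>\<^sub>M \<mu>)"
    unfolding F_def by measurable
  ultimately have "(\<integral>\<^sup>+p. (\<lambda>(x, y). F z x y) p \<partial>(\<mu> \<Otimes>\<^sub>M \<mu>)) = 0"
    by (subst nn_integral_snd[symmetric]) (auto simp: split_beta')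
  let ?V = "(\<lambda>(x, y). \<phi> z x y) -` N \<inter> space (\<mu> \<Otimes>\<^sub>M \<mu>)"
  have V: "?V \<in> sets (\<mu> \<Otimes>\<^sub>M \<mu>)" by measurable
  have "emeasure (\<mu> \<Otimes>\<^sub>M \<mu>) ?V = (\<integral>\<^sup>+p. indicator ?V p \<partial>(\<mu> \<Otimes>\<^sub>M \<mu>))" using V by simp
  also have "\<dots> = (\<integral>\<^sup>+p. (\<lambda>(x, y). F z x y) p \<partial>(\<mu> \<Otimes>\<^sub>M \<mu>))"
    by (rule nn_integral_cong) (auto simp: F_def indicator_def)
  finally show ?thesis using V \<open>(\<integral>\<^sup>+p. (\<lambda>(x, y). F z x y) p \<partial>(\<mu> \<Otimes>\<^sub>M \<mu>)) = 0\<close> by auto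
qed


text \<open>With an atom at \<open>z\<close>, the trace of \<open>H\<close> on three points restricts to the trace on two points under
  the constraint \<open>h z = 0\<close>, which selects a chain.\<close>

lemma measurable_constrained_trace:
  assumes tr: "measurable_traces M H" and \<mu>: "\<mu> \<in> space (prob_algebra M)" and z: "z \<in> space M"
  obtains T1 T2 where "T1 \<in> sets (\<mu> \<Otimes>\<^sub>M \<mu>)" "T2 \<in> sets (\<mu> \<Otimes>\<^sub>M \<mu>)"
    "T2 - T1 \<in> null_sets (\<mu> \<Otimes>\<^sub>M \<mu>)"
    "T1 \<subseteq> {(x, y) \<in> space M \<times> space M. \<exists>h\<in>H. h z = 0 \<and> h x = 1 \<and> h y = 0}"
    "{(x, y) \<in> space M \<times> space M. \<exists>h\<in>H. h z = 0 \<and> h x = 1 \<and> h y = 0} \<subseteq> T2"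
proof -
  let ?\<nu> = "add_atom M z \<mu>"
  let ?P = "\<Pi>\<^sub>M i\<in>{..<3::nat}. ?\<nu>"
  have \<nu>: "?\<nu> \<in> space (prob_algebra M)" by (rule add_atom_in_prob_algebra[OF \<mu> z])
  have [measurable_cong]: "sets \<mu> = sets M" "sets ?\<nu> = sets M"
    using prob_algebraD[OF \<mu>] prob_algebraD[OF \<nu>] by auto
  define \<phi> where "\<phi> = (\<lambda>x y. \<lambda>i\<in>{..<3::nat}. if i = 0 then z else if i = 1 then x else y)"
  let ?y = "\<lambda>i::nat. if i = 1 then 1 else (0::nat)"
  let ?R = "{S \<in> space (\<Pi>\<^sub>M i\<in>{..<3}. M). \<exists>h\<in>H. \<forall>i<3. h (S i) = ?y i}"
  have "?R \<in> sets (completion ?P)"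
    by (rule bspec[OF tr[unfolded measurable_traces_def] \<nu>, THEN spec, THEN spec])
  then obtain R N N' where R: "?R = R \<union> N" "N \<subseteq> N'" "N' \<in> null_sets ?P" "R \<in> sets ?P"
    by (rule sets_completionE)
  have "(\<lambda>(x, y). \<phi> x y) \<in> measurable (M \<Otimes>\<^sub>M M) (\<Pi>\<^sub>M i\<in>{..<3}. M)"
    unfolding \<phi>_def split_beta' using z by (intro measurable_restrict) simp
  moreover have "sets (\<mu> \<Otimes>\<^sub>M \<mu>) = sets (M \<Otimes>\<^sub>M M)"
    by (rule sets_pair_measure_cong) (rule prob_algebraD(2)[OF \<mu>])+
  ultimately have \<phi>[measurable]: "(\<lambda>(x, y). \<phi> x y) \<in> measurable (\<mu> \<Otimes>\<^sub>M \<mu>) ?P"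
    using measurable_cong_sets[OF _ space_PiM_prob_algebra(1)[OF \<nu>]] by blast
  have space: "space (\<mu> \<Otimes>\<^sub>M \<mu>) = space M \<times> space M"
    using prob_algebraD(3)[OF \<mu>] by (simp add: space_pair_measure)
  have all3: "(\<forall>i<3. h (\<phi> x y i) = ?y i) \<longleftrightarrow> h z = 0 \<and> h x = 1 \<and> h y = 0" for h :: "'a \<Rightarrow> nat" and x y
  proof -
    have "(\<forall>i<3. Q i) \<longleftrightarrow> Q 0 \<and> Q 1 \<and> Q (2::nat)" for Q
      by (auto simp: numeral_3_eq_3 numeral_2_eq_2 less_Suc_eq)
    then show ?thesis by (simp add: \<phi>_def)
  qed
  \<comment> \<open>The sandwich provided by the completion is pulled back to pairs, so that Fubini
    can work with sets of the product sigma-algebra. \<open>null_section_add_atom\<close> keeps the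
    gap null.\<close>
  let ?pre = "\<lambda>A. (\<lambda>(x, y). \<phi> x y) -` A \<inter> space (\<mu> \<Otimes>\<^sub>M \<mu>)"
  show ?thesis
  proof (rule that[of "?pre R" "?pre R \<union> ?pre N'"])
    have N': "?pre N' \<in> null_sets (\<mu> \<Otimes>\<^sub>M \<mu>)"
      using null_section_add_atom[OF \<mu> z R(3)] unfolding \<phi>_def .
    show R1: "?pre R \<in> sets (\<mu> \<Otimes>\<^sub>M \<mu>)" using R(4) by measurable
    show "?pre R \<union> ?pre N' \<in> sets (\<mu> \<Otimes>\<^sub>M \<mu>)" using R1 N' by auto
    show "?pre R \<union> ?pre N' - ?pre R \<in> null_sets (\<mu> \<Otimes>\<^sub>M \<mu>)"
      by (rule null_sets_subset[OF N']) (use R1 N' in auto)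
    show "?pre R \<subseteq> {(x, y) \<in> space M \<times> space M. \<exists>h\<in>H. h z = 0 \<and> h x = 1 \<and> h y = 0}"
    proof
      fix p assume p: "p \<in> ?pre R"
      obtain x y where xy: "p = (x, y)" "x \<in> space M" "y \<in> space M" using p space by blast
      have "\<phi> x y \<in> ?R" unfolding R(1) using p xy(1) by simp
      then obtain h where "h \<in> H" "\<forall>i<3. h (\<phi> x y i) = ?y i" by blast
      then have "\<exists>h\<in>H. h z = 0 \<and> h x = 1 \<and> h y = 0" unfolding all3 by blast
      then show "p \<in> {(x, y) \<in> space M \<times> space M. \<exists>h\<in>H. h z = 0 \<and> h x = 1 \<and> h y = 0}" using xy by simp
    qed
    show "{(x, y) \<in> space M \<times> space M. \<exists>h\<in>H. h z = 0 \<and> h x = 1 \<and> h y = 0} \<subseteq> ?pre R \<union> ?pre N'"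
    proof
      fix p assume p: "p \<in> {(x, y) \<in> space M \<times> space M. \<exists>h\<in>H. h z = 0 \<and> h x = 1 \<and> h y = 0}"
      then obtain x y where xy: "p = (x, y)" "x \<in> space M" "y \<in> space M"
        and ex: "\<exists>h\<in>H. h z = 0 \<and> h x = 1 \<and> h y = 0" by blast
      have "\<phi> x y \<in> space (\<Pi>\<^sub>M i\<in>{..<3}. M)"
        using xy z by (auto simp: \<phi>_def space_PiM)
      moreover have "\<exists>h\<in>H. \<forall>i<3. h (\<phi> x y i) = ?y i" unfolding all3 by (rule ex)
      ultimately have "\<phi> x y \<in> R \<union> N" unfolding R(1)[symmetric] by blast
      then show "p \<in> ?pre R \<union> ?pre N'" using R(2) xy space by auto
    qed
  qed
qed

text \<open>The union of an uncountable chain could have larger outer measure than its members. The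
  relation "some hypothesis with \<open>h z = 0\<close> contains \<open>x\<close> but not \<open>y\<close>" rules this out: on the
  hull \<open>B\<close> of the excess, almost all its sections in \<open>y\<close> would be almost full and almost all its
  sections in \<open>x\<close> almost null, against Fubini.\<close>

lemma chain_union_outer_measure:
  assumes hyp: "hypothesis_class M H" and tr: "measurable_traces M H" and ns: "\<not> separates_three_points M H"
    and \<mu>: "\<mu> \<in> space (prob_algebra M)" and z: "z \<in> space M"
    and D: "D \<subseteq> H" "D \<noteq> {}" "\<And>h. h \<in> D \<Longrightarrow> h z = 0"
    and s: "\<And>h. h \<in> D \<Longrightarrow> measure \<mu> {x \<in> space M. h x = 1} \<le> s" and \<delta>: "0 < \<delta>"
  obtains B where "B \<in> sets M" "measure \<mu> B \<le> s + 2 * \<delta>" "(\<Union>h\<in>D. {x \<in> space M. h x = 1}) \<subseteq> B"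
proof -
  let ?S = "\<lambda>h. {x \<in> space M. h x = 1}"
  let ?m = "\<lambda>h. measure \<mu> (?S h)"
  interpret prob_space \<mu> using prob_algebraD[OF \<mu>] by simp
  interpret PP: pair_sigma_finite \<mu> \<mu> by standard
  note sets_\<mu> = prob_algebraD(2)[OF \<mu>] and space_\<mu> = prob_algebraD(3)[OF \<mu>]
  have comp: "?S g \<subseteq> ?S h \<or> ?S h \<subseteq> ?S g" if "g \<in> H" "h \<in> H" "g z = 0" "h z = 0" for g h
    using comparable_of_common_zero[OF hyp ns that(1,2) z that(3,4)] unfolding comparable_on_def .
  have SM: "?S h \<in> sets \<mu>" if "h \<in> D" for h
    using sets_hypothesis[OF hyp] D(1) that sets_\<mu> by blast
  have bdd: "bdd_above (?m ` D)" by (rule bdd_aboveI[of _ 1]) auto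
  \<comment> \<open>\<open>h0\<close> is within \<delta> of the supremum, so by comparability each
    single member adds at most \<delta> to it. Only the union could add more.\<close>
  obtain h0 where h0: "h0 \<in> D" "(SUP h\<in>D. ?m h) - \<delta> < ?m h0"
    using less_cSUP_iff[OF D(2) bdd, of "(SUP h\<in>D. ?m h) - \<delta>"] \<delta> by auto
  have diff: "measure \<mu> (?S h - ?S h0) \<le> \<delta>" if h: "h \<in> D" for h
  proof (cases "?S h \<subseteq> ?S h0")
    case True
    then have "?S h - ?S h0 = {}" by blast
    then show ?thesis using \<delta> by (simp only: measure_empty)
  next
    case False
    then have "?S h0 \<subseteq> ?S h"
    using comp[OF subsetD[OF D(1) h] subsetD[OF D(1) h0(1)] D(3)[OF h] D(3)[OF h0(1)]] by simp
    then have "measure \<mu> (?S h - ?S h0) = ?m h - ?m h0"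
      by (intro finite_measure_Diff SM h h0(1))
    also have "\<dots> \<le> \<delta>" using cSUP_upper[OF h bdd] h0(2) by linarith
    finally show ?thesis .
  qed
  define U where "U = (\<Union>h\<in>D. ?S h) - ?S h0"
  have "U \<subseteq> space \<mu>" unfolding U_def space_\<mu> by blast
  from outer_measure_of_attain[OF this]
  obtain E where E: "E \<in> sets \<mu>" "U \<subseteq> E" "outer_measure_of \<mu> U = emeasure \<mu> E"
    by (elim bexE conjE)
  define B where "B = E - ?S h0"
  have "U \<inter> ?S h0 = {}" unfolding U_def by blast
  then have B: "B \<in> sets \<mu>" "U \<subseteq> B" "B \<inter> ?S h0 = {}"
    unfolding B_def using E(1,2) SM[OF h0(1)] by (blast intro: sets.Diff)+
  let ?b = "measure \<mu> B"
  \<comment> \<open>A measurable condition that holds on \<open>U\<close> holds almost everywhere on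
    \<open>B\<close>. The section bounds therefore need proof only at points of
    \<open>U\<close>.\<close>
  have hull: "measure \<mu> (F \<inter> B) = ?b" if F: "F \<in> sets \<mu>" "U \<subseteq> F" for F
  proof (rule antisym)
    show "measure \<mu> (F \<inter> B) \<le> ?b" using F B by (intro finite_measure_mono) auto
    have "emeasure \<mu> B \<le> emeasure \<mu> E" using E(1) by (intro emeasure_mono) (simp_all add: B_def)
    also have "\<dots> \<le> outer_measure_of \<mu> (F \<inter> B)"
      unfolding E(3)[symmetric] using F(2) B(2) by (intro outer_measure_of_mono) auto
    also have "\<dots> = emeasure \<mu> (F \<inter> B)" using F(1) B(1) by (intro outer_measure_of_eq) auto
    finally show "?b \<le> measure \<mu> (F \<inter> B)" by (simp add: emeasure_eq_measure)
  qed
  obtain T1 T2 where T: "T1 \<in> sets (\<mu> \<Otimes>\<^sub>M \<mu>)" "T2 \<in> sets (\<mu> \<Otimes>\<^sub>M \<mu>)"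
    "T2 - T1 \<in> null_sets (\<mu> \<Otimes>\<^sub>M \<mu>)"
    "T1 \<subseteq> {(x, y) \<in> space M \<times> space M. \<exists>h\<in>H. h z = 0 \<and> h x = 1 \<and> h y = 0}"
    "{(x, y) \<in> space M \<times> space M. \<exists>h\<in>H. h z = 0 \<and> h x = 1 \<and> h y = 0} \<subseteq> T2"
    using measurable_constrained_trace[OF tr \<mu> z] by blast
  let ?Q = "\<mu> \<Otimes>\<^sub>M \<mu>" and ?BB = "B \<times> B"
  have BB: "?BB \<in> sets ?Q" using B(1) by (intro pair_measureI)
  \<comment> \<open>\<open>f\<close> will be bounded below and \<open>g\<close> above, so they use
    the outer and the inner approximation, which differ by a null set.\<close>
  define f where "f x = emeasure \<mu> (Pair x -` (T2 \<inter> ?BB))" for x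
  define g where "g y = emeasure \<mu> ((\<lambda>x. (x, y)) -` (T1 \<inter> ?BB))" for y
  have T1B: "T1 \<inter> ?BB \<in> sets ?Q" and T2B: "T2 \<inter> ?BB \<in> sets ?Q" using T BB by auto
  have f: "f \<in> borel_measurable \<mu>" unfolding f_def by (rule measurable_emeasure_Pair[OF T2B])
  have g: "g \<in> borel_measurable \<mu>" unfolding g_def by (rule PP.measurable_emeasure_Pair2[OF T1B])
  have BM: "x \<in> space M" if "x \<in> B" for x using that sets.sets_into_space[OF B(1)] space_\<mu> by blast
  have cap: "measure \<mu> (?S h \<inter> B) \<le> \<delta>" if h: "h \<in> D" for h
  proof -
    have "measure \<mu> (?S h \<inter> B) \<le> measure \<mu> (?S h - ?S h0)"
      using B(3) SM[OF h] SM[OF h0(1)] by (intro finite_measure_mono) auto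
    then show ?thesis using diff[OF h] by linarith
  qed
  \<comment> \<open>A member of \<open>D\<close> containing \<open>x\<close> takes at most \<delta>
    of \<open>B\<close>, and \<open>x\<close> is related to every other point of
    \<open>B\<close>.\<close>
  have fU: "ennreal (?b - \<delta>) \<le> f x" if x: "x \<in> U" for x
  proof -
    obtain h where h: "h \<in> D" "x \<in> ?S h" using x unfolding U_def by blast
    have xB: "x \<in> B" using x B(2) by blast
    have sub: "B - ?S h \<subseteq> Pair x -` (T2 \<inter> ?BB)"
    proof
      fix y assume y: "y \<in> B - ?S h"
      have yM: "y \<in> space M" using y BM by blast
      then have "h y = 0" using hypothesis_value[OF hyp, of h y] h(1) D(1) y by blast
      then have "(x, y) \<in> T2"
        using subsetD[OF T(5), of "(x, y)"] h D(1) D(3)[OF h(1)] yM by blast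
      then show "y \<in> Pair x -` (T2 \<inter> ?BB)" using xB y by blast
    qed
    have "?b - \<delta> \<le> ?b - measure \<mu> (?S h \<inter> B)" using cap[OF h(1)] by simp
    also have "\<dots> = measure \<mu> (B - ?S h)"
      using finite_measure_Diff'[OF B(1) SM[OF h(1)]] by (simp add: Int_commute)
    finally have "ennreal (?b - \<delta>) \<le> emeasure \<mu> (B - ?S h)"
      unfolding emeasure_eq_measure by (rule ennreal_leI)
    also have "\<dots> \<le> f x"
      unfolding f_def by (rule emeasure_mono[OF sub sets_Pair1[OF T2B]])
    finally show ?thesis .
  qed
  \<comment> \<open>A hypothesis that vanishes at \<open>z\<close> and \<open>y\<close> lies below
    any member of \<open>D\<close> containing \<open>y\<close>, so its part in \<open>B\<close> lies
    in a set of measure at most \<delta>.\<close>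
  have gU: "g y \<le> ennreal \<delta>" if y: "y \<in> U" for y
  proof -
    obtain h where h: "h \<in> D" "y \<in> ?S h" using y unfolding U_def by blast
    have sub: "(\<lambda>x. (x, y)) -` (T1 \<inter> ?BB) \<subseteq> ?S h \<inter> B"
    proof
      fix x assume x: "x \<in> (\<lambda>x. (x, y)) -` (T1 \<inter> ?BB)"
      then obtain h' where h': "h' \<in> H" "h' z = 0" "h' x = 1" "h' y = 0" using subsetD[OF T(4), of "(x, y)"] by blast
      have "\<not> ?S h \<subseteq> ?S h'" using h h'(4) by auto
      then have "?S h' \<subseteq> ?S h"
        using comp[OF subsetD[OF D(1) h(1)] h'(1) D(3)[OF h(1)] h'(2)] by simp
      then show "x \<in> ?S h \<inter> B" using x h'(3) BM by blast
    qed
    have "g y \<le> emeasure \<mu> (?S h \<inter> B)"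
      unfolding g_def using SM[OF h(1)] B(1) by (intro emeasure_mono[OF sub]) auto
    also have "\<dots> \<le> ennreal \<delta>"
      unfolding emeasure_eq_measure by (rule ennreal_leI[OF cap[OF h(1)]])
    finally show ?thesis .
  qed
  define F1 where "F1 = {x \<in> space \<mu>. ennreal (?b - \<delta>) \<le> f x}"
  define F2 where "F2 = {y \<in> space \<mu>. g y \<le> ennreal \<delta>}"
  have F: "F1 \<in> sets \<mu>" "F2 \<in> sets \<mu>" unfolding F1_def F2_def using f g by measurable
  have UF: "U \<subseteq> F1" "U \<subseteq> F2" using fU gU \<open>U \<subseteq> space \<mu>\<close> by (auto simp: F1_def F2_def)
  \<comment> \<open>Integrating in the two orders gives
    \<open>(b - \<delta>) * b \<le> \<delta> * b\<close>, whence
    \<open>b \<le> 2 * \<delta>\<close>.\<close>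
  have "ennreal (?b - \<delta>) * ennreal ?b = (\<integral>\<^sup>+x. ennreal (?b - \<delta>) * indicator (F1 \<inter> B) x \<partial>\<mu>)"
    using hull[OF F(1) UF(1)] F(1) B(1) by (simp add: nn_integral_cmult_indicator emeasure_eq_measure)
  also have "\<dots> \<le> (\<integral>\<^sup>+x. f x \<partial>\<mu>)"
    by (rule nn_integral_mono) (auto simp: F1_def indicator_def)
  also have "\<dots> = emeasure ?Q (T2 \<inter> ?BB)"
    unfolding f_def by (rule emeasure_pair_measure_alt[OF T2B, symmetric])
  also have "\<dots> \<le> emeasure ?Q ((T1 \<inter> ?BB) \<union> (T2 - T1))"
    using T1B T by (intro emeasure_mono) auto
  also have "\<dots> = emeasure ?Q (T1 \<inter> ?BB)" by (rule emeasure_Un_null_set[OF T1B T(3)])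
  also have "\<dots> = (\<integral>\<^sup>+y. g y \<partial>\<mu>)"
    unfolding g_def by (rule PP.emeasure_pair_measure_alt2[OF T1B])
  also have "\<dots> \<le> (\<integral>\<^sup>+y. ennreal \<delta> * indicator B y + indicator (B - F2) y \<partial>\<mu>)"
  proof (rule nn_integral_mono)
    fix y assume y: "y \<in> space \<mu>"
    have "g y = 0" if "y \<notin> B"
    proof -
      have "(\<lambda>x. (x, y)) -` (T1 \<inter> ?BB) = {}" using that by blast
      then show ?thesis unfolding g_def by (simp only: emeasure_empty)
    qed
    moreover have "g y \<le> 1" unfolding g_def by (rule emeasure_le_1)
    ultimately show "g y \<le> ennreal \<delta> * indicator B y + indicator (B - F2) y"
      using y by (auto simp: indicator_def F2_def add_increasing)
  qed
  also have "\<dots> = ennreal \<delta> * ennreal ?b"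
  proof -
    have "measure \<mu> (B - F2) = 0"
      using finite_measure_Diff'[OF B(1) F(2)] hull[OF F(2) UF(2)] by (simp add: Int_commute)
    then show ?thesis
      using B(1) F(2) by (simp add: nn_integral_add nn_integral_cmult_indicator emeasure_eq_measure)
  qed
  finally have le: "ennreal (?b - \<delta>) * ennreal ?b \<le> ennreal \<delta> * ennreal ?b" .
  have b2: "?b \<le> 2 * \<delta>"
  proof (rule ccontr)
    assume "\<not> ?thesis"
    then have b: "2 * \<delta> < ?b" by simp
    have "(?b - \<delta>) * ?b \<le> \<delta> * ?b"
      using le b \<delta> by (simp flip: ennreal_mult add: ennreal_le_iff)
    then have "?b - \<delta> \<le> \<delta>" using b \<delta> by (subst (asm) mult_le_cancel_right_pos) auto
    then show False using b by linarith
  qed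
  show ?thesis
  proof (rule that[of "?S h0 \<union> B"])
    show "?S h0 \<union> B \<in> sets M" using SM[OF h0(1)] B(1) sets_\<mu> by auto
    have "measure \<mu> (?S h0 \<union> B) \<le> ?m h0 + ?b" by (rule measure_Un_le[OF SM[OF h0(1)] B(1)])
    also have "\<dots> \<le> s + 2 * \<delta>" using s[OF h0(1)] b2 by linarith
    finally show "measure \<mu> (?S h0 \<union> B) \<le> s + 2 * \<delta>" .
    show "(\<Union>h\<in>D. ?S h) \<subseteq> ?S h0 \<union> B" using B(2) unfolding U_def by blast
  qed
qed


section \<open>Learning a chain\<close>

text \<open>Of two members of a chain one contains the other, so finitely many points that are
  covered separately are covered by a single member, although the whole union may not be.\<close>

lemma chain_covering:
  assumes ne: "C \<noteq> {}" and chain: "\<And>g h. g \<in> C \<Longrightarrow> h \<in> C \<Longrightarrow> comparable_on X g h"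
    and P: "finite P" "P \<subseteq> X"
  shows "\<exists>g\<in>C. \<forall>x\<in>P. \<forall>h\<in>C. h x = 1 \<longrightarrow> g x = 1"
  using P
proof (induction P rule: finite_induct)
  case empty
  then show ?case using ne by blast
next
  case (insert x P)
  have PX: "P \<subseteq> X" "x \<in> X" using insert.prems by simp_all
  obtain g where gC: "g \<in> C" and g: "\<forall>y\<in>P. \<forall>h\<in>C. h y = 1 \<longrightarrow> g y = 1"
    using insert.IH[OF PX(1)] by (elim bexE)
  show ?case
  proof (cases "\<exists>h\<in>C. h x = 1")
    case True
    then obtain h where h: "h \<in> C" "h x = 1" by (elim bexE)
    show ?thesis
    proof (cases "{x \<in> X. g x = 1} \<subseteq> {x \<in> X. h x = 1}")
      case True
      then have "h y = 1" if "y \<in> P" "g y = 1" for y using that PX(1) by auto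
      then have "\<forall>y\<in>insert x P. \<forall>h'\<in>C. h' y = 1 \<longrightarrow> h y = 1" using g h(2) by simp
      then show ?thesis using h(1) by (rule bexI)
    next
      case False
      then have "{x \<in> X. h x = 1} \<subseteq> {x \<in> X. g x = 1}"
        using chain[OF gC h(1)] unfolding comparable_on_def by simp
      then have "g x = 1" using h(2) PX(2) by auto
      then have "\<forall>y\<in>insert x P. \<forall>h'\<in>C. h' y = 1 \<longrightarrow> g y = 1" using g by simp
      then show ?thesis using gC by (rule bexI)
    qed
  next
    case False
    then have "\<forall>y\<in>insert x P. \<forall>h'\<in>C. h' y = 1 \<longrightarrow> g y = 1" using g by simp
    then show ?thesis using gC by (rule bexI)
  qed
qed

lemma minimax_excess_le_chain:
  assumes hyp: "hypothesis_class M H" and tr: "measurable_traces M H" and ns: "\<not> separates_three_points M H"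
    and ne: "feasible H \<alpha> \<mu>0 \<noteq> {}" and nomax: "\<not> admits_maximal M (feasible H \<alpha> \<mu>0)"
    and chain: "\<And>g h. g \<in> feasible H \<alpha> \<mu>0 \<Longrightarrow> h \<in> feasible H \<alpha> \<mu>0 \<Longrightarrow> comparable_on (space M) g h"
    and n: "0 < n"
  shows "minimax_excess M H \<alpha> n \<mu>0 \<le> ennreal (5 * ((1 + ln (real n)) / real n))"
proof -
  let ?C = "feasible H \<alpha> \<mu>0"
  let ?S = "\<lambda>h. {x \<in> space M. h x = 1}"
  define l where "l = 1 + ln (real n)"
  \<comment> \<open>All \<open>n\<close> points miss a set of measure at least
    \<open>t / 4 = l / n\<close> with probability at most
    \<open>exp (- l) \<le> 1 / n\<close>.\<close>
  define t where "t = 4 * l / real n"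
  have l: "1 \<le> l" using n by (simp add: l_def)
  have t: "0 < t" using l n by (simp add: t_def)
  have CH: "h \<in> H" if "h \<in> ?C" for h using that by (simp add: feasible_def)
  define L where "L S = (SOME g. g \<in> ?C \<and> (\<forall>i<n. \<forall>h\<in>?C. h (S i) = 1 \<longrightarrow> g (S i) = 1))" for S
  have L: "L S \<in> ?C" "\<And>i h. i < n \<Longrightarrow> h \<in> ?C \<Longrightarrow> h (S i) = 1 \<Longrightarrow> L S (S i) = 1"
    if S: "S \<in> space (\<Pi>\<^sub>M i\<in>{..<n}. M)" for S
  proof -
    have "S ` {..<n} \<subseteq> space M" using S by (auto simp: space_PiM)
    then have "\<exists>g\<in>?C. \<forall>x\<in>S ` {..<n}. \<forall>h\<in>?C. h x = 1 \<longrightarrow> g x = 1"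
      using chain_covering[OF ne chain, of "S ` {..<n}"] by simp
    then have "\<exists>g. g \<in> ?C \<and> (\<forall>i<n. \<forall>h\<in>?C. h (S i) = 1 \<longrightarrow> g (S i) = 1)" by auto
    from someI_ex[OF this] show "L S \<in> ?C" "\<And>i h. i < n \<Longrightarrow> h \<in> ?C \<Longrightarrow> h (S i) = 1 \<Longrightarrow> L S (S i) = 1"
      unfolding L_def by blast+
  qed
  have "minimax_excess M H \<alpha> n \<mu>0 \<le> ennreal (t + 1 / real n)"
  proof (rule minimax_excess_le[where L = L])
    show "L \<in> exact_learners M H \<alpha> n \<mu>0" using L(1) by (simp add: exact_learners_def)
    fix \<mu> assume \<mu>: "\<mu> \<in> space (prob_algebra M)"
    let ?P = "\<Pi>\<^sub>M i\<in>{..<n}. \<mu>"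
    let ?m = "\<lambda>h. measure \<mu> (?S h)"
    interpret prob_space \<mu> using prob_algebraD[OF \<mu>] by simp
    interpret FP: finite_product_prob_space "\<lambda>_. \<mu>" "{..<n}" by unfold_locales simp_all
    note sets_\<mu> = prob_algebraD(2)[OF \<mu>] and space_\<mu> = prob_algebraD(3)[OF \<mu>]
    have SM: "?S h \<in> sets \<mu>" if "h \<in> ?C" for h
      using sets_hypothesis[OF hyp CH[OF that]] sets_\<mu> by simp
    define s where "s = (SUP h\<in>?C. ?m h)"
    have bdd: "bdd_above (?m ` ?C)" by (rule bdd_aboveI[of _ 1]) auto
    have s: "?m h \<le> s" if "h \<in> ?C" for h unfolding s_def by (rule cSUP_upper[OF that bdd])
    obtain h1 where h1: "h1 \<in> ?C" "s - t / 2 < ?m h1"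
      using less_cSUP_iff[OF ne bdd, of "s - t / 2"] t unfolding s_def by auto
    \<comment> \<open>Without a maximal element some \<open>z\<close> lies outside
      \<open>h1\<close>. Members of \<open>D\<close> have less mass than \<open>h1\<close>, hence
      lie below it and vanish at \<open>z\<close> too, as the bound on their union requires.\<close>
    obtain h2 z where z: "h2 \<in> ?C" "z \<in> space M" "h1 z \<noteq> 1"
      using nomax h1(1) unfolding admits_maximal_def by blast
    have h1z: "h1 z = 0" using hypothesis_value[OF hyp CH[OF h1(1)] z(2)] z(3) by simp
    define D where "D = {h \<in> ?C. ?m h < s - t}"
    have DH: "D \<subseteq> H" using CH by (auto simp: D_def)
    have Dz: "h z = 0" if h: "h \<in> D" for h
    proof -
      have hC: "h \<in> ?C" and lt: "?m h < ?m h1" using h h1(2) t by (auto simp: D_def)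
      have "\<not> ?S h1 \<subseteq> ?S h"
      proof
        assume "?S h1 \<subseteq> ?S h"
        then have "?m h1 \<le> ?m h" by (rule finite_measure_mono[OF _ SM[OF hC]])
        then show False using lt by linarith
      qed
      then have "?S h \<subseteq> ?S h1" using chain[OF hC h1(1)] unfolding comparable_on_def by simp
      then have "h z \<noteq> 1" using z(2,3) by blast
      then show ?thesis using hypothesis_value[OF hyp CH[OF hC] z(2)] by simp
    qed
    have "\<exists>A\<in>sets ?P. measure ?P A \<le> 1 / real n \<and> (\<forall>S\<in>space ?P. L S \<in> D \<longrightarrow> S \<in> A)"
    proof (cases "D = {}")
      case True
      then show ?thesis by (intro bexI[of _ "{}"]) auto
    next
      case False
      \<comment> \<open>\<open>h1\<close> has mass above \<open>s - t / 2\<close> and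
        \<open>B\<close> at most \<open>s - t + t / 4\<close>, so \<open>h1\<close> keeps at least
        \<open>t / 4\<close> outside \<open>B\<close>.\<close>
      obtain B where B: "B \<in> sets M" "measure \<mu> B \<le> s - t + 2 * (t / 8)" "(\<Union>h\<in>D. ?S h) \<subseteq> B"
      proof (rule chain_union_outer_measure[OF hyp tr ns \<mu> z(2) DH False, where s = "s - t" and \<delta> = "t / 8"])
        show "h z = 0" if "h \<in> D" for h by (rule Dz[OF that])
        show "?m h \<le> s - t" if "h \<in> D" for h using that by (simp add: D_def)
        show "0 < t / 8" using t by simp
      qed blast
      \<comment> \<open>A sample point in \<open>E\<close> is covered by \<open>h1\<close>, hence by
        \<open>L S\<close>, whereas no member of \<open>D\<close> reaches outside
        \<open>B\<close>.\<close>
      define E where "E = ?S h1 - B"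
      have E: "E \<in> sets \<mu>" using SM[OF h1(1)] B(1) sets_\<mu> by (auto simp: E_def)
      have B': "B \<in> sets \<mu>" using B(1) sets_\<mu> by simp
      have "?S h1 \<subseteq> E \<union> B" unfolding E_def by blast
      then have "?m h1 \<le> measure \<mu> (E \<union> B)" by (rule finite_measure_mono) (rule sets.Un[OF E B'])
      also have "\<dots> \<le> measure \<mu> E + measure \<mu> B" by (rule measure_Un_le[OF E B'])
      finally have mE: "t / 4 \<le> measure \<mu> E" using h1(2) B(2) by linarith
      define A where "A = PiE {..<n} (\<lambda>_. space \<mu> - E)"
      have "A \<in> sets ?P" unfolding A_def using E by (intro sets_PiM_I_finite) auto
      moreover have "measure ?P A \<le> 1 / real n"
      proof -
        have "measure ?P A = (\<Prod>i<n. measure \<mu> (space \<mu> - E))"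
          unfolding A_def by (rule FP.prob_times) (use E in auto)
        also have "\<dots> = (1 - measure \<mu> E) ^ n" using prob_compl[OF E] by simp
        also have "\<dots> \<le> exp (- (l / real n)) ^ n"
        proof (rule power_mono)
          have "1 - measure \<mu> E \<le> 1 + - (l / real n)" using mE by (simp add: t_def)
          also have "\<dots> \<le> exp (- (l / real n))" by (rule exp_ge_add_one_self)
          finally show "1 - measure \<mu> E \<le> exp (- (l / real n))" .
        qed simp
        also have "\<dots> = exp (- l)" using n by (simp flip: exp_of_nat_mult)
        also have "\<dots> \<le> exp (- ln (real n))" by (simp add: l_def)
        also have "\<dots> = 1 / real n" using n by (simp add: exp_minus inverse_eq_divide)
        finally show ?thesis .
      qed
      moreover have "S \<in> A" if S: "S \<in> space ?P" and LD: "L S \<in> D" for S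
      proof -
        have SM': "S \<in> space (\<Pi>\<^sub>M i\<in>{..<n}. M)" using S by (simp only: space_PiM_prob_algebra(2)[OF \<mu>])
        have Si: "S i \<in> space M" if "i < n" for i using SM' that by (auto simp: space_PiM)
        have "S i \<notin> E" if i: "i < n" for i
        proof
          assume "S i \<in> E"
          then have "h1 (S i) = 1" "S i \<notin> B" by (auto simp: E_def)
          then show False using L(2)[OF SM' i h1(1)] B(3) LD Si[OF i] by blast
        qed
        then show ?thesis using S by (auto simp: A_def space_PiM)
      qed
      ultimately show ?thesis by blast
    qed
    then obtain A where A: "A \<in> sets ?P" "measure ?P A \<le> 1 / real n" "\<And>S. S \<in> space ?P \<Longrightarrow> L S \<in> D \<Longrightarrow> S \<in> A"
      by blast
    show "outer_expectation ?P (\<lambda>S. ennreal (excess_risk H \<alpha> \<mu>0 \<mu> (L S))) \<le> ennreal (t + 1 / real n)"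
    proof (rule outer_expectation_le[OF space_PiM_prob_algebra(3)[OF \<mu>] A(1)])
      show "excess_risk H \<alpha> \<mu>0 \<mu> (L S) \<le> 1" for S by (rule excess_risk_le_1[OF ne \<mu>])
      fix S assume S: "S \<in> space ?P" "S \<notin> A"
      then have "S \<in> space (\<Pi>\<^sub>M i\<in>{..<n}. M)" by (simp only: space_PiM_prob_algebra(2)[OF \<mu>])
      note LC = L(1)[OF this]
      have "L S \<notin> D" using A(3) S by blast
      then have Ls: "s - t \<le> ?m (L S)" using LC by (simp add: D_def)
      show "excess_risk H \<alpha> \<mu>0 \<mu> (L S) \<le> t"
      proof (rule excess_risk_le[OF ne])
        fix h assume h: "h \<in> ?C"
        show "risk1 \<mu> (L S) - risk1 \<mu> h \<le> t"
          unfolding risk1_eq[OF hyp CH[OF LC] \<mu>] risk1_eq[OF hyp CH[OF h] \<mu>] using s[OF h] Ls by simp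
      qed (use t in simp)
    qed (use t A(2) in simp_all)
  qed
  also have "t + 1 / real n \<le> 5 * (l / real n)"
    using divide_right_mono[OF l, of "real n"] by (simp add: t_def)
  finally show ?thesis unfolding l_def by (simp add: ennreal_leI)
qed

theorem theorem1:
  "\<exists>c C k :: real. 0 < c \<and> 0 < C \<and> 0 < k \<and>
    (\<forall>(M :: 'a measure) (H :: ('a \<Rightarrow> nat) set) (\<alpha> :: real) (n :: nat).
      (\<forall>x\<in>space M. {x} \<in> sets M) \<longrightarrow> hypothesis_class M H \<longrightarrow> finite_vc_dim M H \<longrightarrow>
      0 < \<alpha> \<longrightarrow> \<alpha> < 1 / 2 \<longrightarrow> 0 < n \<longrightarrow> real (vc_dim M H) / real n \<le> 1 / 2 \<longrightarrow>
      (separates_three_points M H \<longrightarrow>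
        (\<exists>\<mu>0 \<in> space (prob_algebra M). feasible H \<alpha> \<mu>0 \<noteq> {} \<and>
           log_ge c k n (minimax_excess M H \<alpha> n \<mu>0) (sqrt (real (vc_dim M H) / real n)) \<and>
           (measurable_traces M H \<longrightarrow>
             log_le C k n (minimax_excess M H \<alpha> n \<mu>0) (sqrt (real (vc_dim M H) / real n))))) \<and>
      (\<not> separates_three_points M H \<longrightarrow>
        (\<forall>\<mu>0 \<in> space (prob_algebra M).
           feasible H \<alpha> \<mu>0 \<noteq> {} \<and> \<not> admits_maximal M (feasible H \<alpha> \<mu>0) \<longrightarrow>
           log_ge c k n (minimax_excess M H \<alpha> n \<mu>0) (real (vc_dim M H) / real n) \<and>
           (measurable_traces M H \<longrightarrow>
             log_le C k n (minimax_excess M H \<alpha> n \<mu>0) (real (vc_dim M H) / real n))) \<and>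
        (\<forall>\<mu>0 \<in> space (prob_algebra M).
           admits_maximal M (feasible H \<alpha> \<mu>0) \<longrightarrow>
           minimax_excess M H \<alpha> n \<mu>0 = 0)))"
proof (rule exI[of _ "1/64"], rule exI[of _ 13], rule exI[of _ 1], intro conjI allI impI)
  fix M :: "'a measure" and H :: "('a \<Rightarrow> nat) set" and \<alpha> :: real and n :: nat
  assume single: "\<forall>x\<in>space M. {x} \<in> sets M" and hyp: "hypothesis_class M H" and vc: "finite_vc_dim M H"
    and \<alpha>: "0 < \<alpha>" "\<alpha> < 1 / 2" and n: "0 < n" and dn: "real (vc_dim M H) / real n \<le> 1 / 2"
  \<comment> \<open>The lower constant \<open>1 / 64 = 8 / 512\<close> is below
    \<open>9 / 512\<close>, and \<open>d \<le> 2\<close> gives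
    \<open>d / (64 * n) \<le> 1 / (4 * n)\<close>. The upper constant 13 exceeds the 5 of the chain
    bound, and one power of the logarithm covers both upper bounds.\<close>
  let ?d = "vc_dim M H"
  have d_le: "?d \<le> n" using dn n by (simp add: field_simps)
  have l: "1 \<le> 1 + ln (real n)" using n by simp
  have ge: "log_ge (1/64) 1 n A B" if "ennreal b \<le> A" "1 / 64 * B \<le> b" "0 \<le> B" for A b B
  proof -
    have "1 / 64 * ((1 + ln (real n)) powr (- 1) * B) \<le> 1 / 64 * (1 * B)"
      using l that(3) by (intro mult_left_mono mult_right_mono) (simp_all add: powr_minus inverse_le_1_iff)
    then have "1 / 64 * (1 + ln (real n)) powr (- 1) * B \<le> b" using that(2) by simp
    then show ?thesis unfolding log_ge_def using that(1) by (meson ennreal_leI order_trans)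
  qed
  have le: "log_le 13 1 n A B" if "A \<le> ennreal b" "b \<le> 13 * ((1 + ln (real n)) * B)" for A b B
  proof -
    have "(1 + ln (real n)) powr 1 = 1 + ln (real n)" using l by simp
    then have "b \<le> 13 * (1 + ln (real n)) powr 1 * B" using that(2) by (simp only: mult.assoc)
    then show ?thesis unfolding log_le_def using that(1) by (meson ennreal_leI order_trans)
  qed
  show "\<exists>\<mu>0 \<in> space (prob_algebra M). feasible H \<alpha> \<mu>0 \<noteq> {} \<and>
      log_ge (1/64) 1 n (minimax_excess M H \<alpha> n \<mu>0) (sqrt (real ?d / real n)) \<and>
      (measurable_traces M H \<longrightarrow>
        log_le 13 1 n (minimax_excess M H \<alpha> n \<mu>0) (sqrt (real ?d / real n)))"
    if sep: "separates_three_points M H"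
  proof -
    obtain \<mu>0 where \<mu>0: "\<mu>0 \<in> space (prob_algebra M)" "feasible H \<alpha> \<mu>0 \<noteq> {}"
      "ennreal (9 / 512 * sqrt (real ?d / real n)) \<le> minimax_excess M H \<alpha> n \<mu>0"
      using minimax_excess_ge_sqrt[OF single hyp vc sep \<alpha> n d_le] by blast
    obtain g h x where "g \<in> H" "h \<in> H" "x \<in> space M" "g x = 0" "h x = 1"
      using sep unfolding separates_three_points_def by blast
    then have d: "0 < ?d" using vc_dim_pos[OF vc, of g h x] by simp
    have "log_ge (1/64) 1 n (minimax_excess M H \<alpha> n \<mu>0) (sqrt (real ?d / real n))"
      by (rule ge[OF \<mu>0(3)]) simp_all
    moreover have "log_le 13 1 n (minimax_excess M H \<alpha> n \<mu>0) (sqrt (real ?d / real n))"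
      if tr: "measurable_traces M H"
      by (rule le[OF minimax_excess_le_sqrt[OF hyp vc tr \<mu>0(2) n d]]) simp
    ultimately show ?thesis using \<mu>0(1,2) by blast
  qed
  show "\<forall>\<mu>0 \<in> space (prob_algebra M).
      feasible H \<alpha> \<mu>0 \<noteq> {} \<and> \<not> admits_maximal M (feasible H \<alpha> \<mu>0) \<longrightarrow>
      log_ge (1/64) 1 n (minimax_excess M H \<alpha> n \<mu>0) (real ?d / real n) \<and>
      (measurable_traces M H \<longrightarrow> log_le 13 1 n (minimax_excess M H \<alpha> n \<mu>0) (real ?d / real n))"
    if ns: "\<not> separates_three_points M H"
  proof (intro ballI impI, elim conjE)
    fix \<mu>0 assume \<mu>0: "\<mu>0 \<in> space (prob_algebra M)" and ne: "feasible H \<alpha> \<mu>0 \<noteq> {}"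
      and nomax: "\<not> admits_maximal M (feasible H \<alpha> \<mu>0)"
    note chain = feasible_comparable[OF hyp ns \<mu>0 \<alpha>(2)]
    obtain g where g: "g \<in> feasible H \<alpha> \<mu>0" using ne by blast
    obtain h x where h: "h \<in> feasible H \<alpha> \<mu>0" "x \<in> space M" "h x = 1" "g x \<noteq> 1"
      using nomax g unfolding admits_maximal_def by blast
    have gH: "g \<in> H" and hH: "h \<in> H" using g h(1) by (auto simp: feasible_def)
    have "g x = 0" using hypothesis_value[OF hyp gH h(2)] h(4) by simp
    then have d1: "1 \<le> ?d" using vc_dim_pos[OF vc gH hH h(2)] h(3) by blast
    have "H \<noteq> {}" using gH by blast
    then obtain A where "shattered M H A" "card A = ?d" by (rule ex_shattered_card_eq_vc_dim[OF vc])
    then have d2: "?d \<le> 2" using shattered_card_le_2[OF ns] by metis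
    have "log_ge (1/64) 1 n (minimax_excess M H \<alpha> n \<mu>0) (real ?d / real n)"
    proof (rule ge[OF minimax_excess_ge_no_maximal[OF single hyp \<mu>0 ne nomax chain n]])
      show "1 / 64 * (real ?d / real n) \<le> 1 / (4 * real n)" using d2 n by (simp add: field_simps)
    qed simp_all
    moreover have "log_le 13 1 n (minimax_excess M H \<alpha> n \<mu>0) (real ?d / real n)"
      if tr: "measurable_traces M H"
    proof (rule le[OF minimax_excess_le_chain[OF hyp tr ns ne nomax chain n]])
      have "(1 + ln (real n)) / real n * 1 \<le> (1 + ln (real n)) / real n * real ?d"
        using d1 l by (intro mult_left_mono) auto
      moreover have "0 \<le> (1 + ln (real n)) / real n" using l by simp
      ultimately have "5 * ((1 + ln (real n)) / real n) \<le> 13 * ((1 + ln (real n)) / real n * real ?d)"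
        by linarith
      then show "5 * ((1 + ln (real n)) / real n) \<le> 13 * ((1 + ln (real n)) * (real ?d / real n))"
        by (simp only: times_divide_eq_left times_divide_eq_right)
    qed
    ultimately show "log_ge (1/64) 1 n (minimax_excess M H \<alpha> n \<mu>0) (real ?d / real n) \<and>
      (measurable_traces M H \<longrightarrow> log_le 13 1 n (minimax_excess M H \<alpha> n \<mu>0) (real ?d / real n))"
      by blast
  qed
  show "\<forall>\<mu>0 \<in> space (prob_algebra M). admits_maximal M (feasible H \<alpha> \<mu>0) \<longrightarrow> minimax_excess M H \<alpha> n \<mu>0 = 0"
    using minimax_excess_eq_0[OF _ hyp] by blast
qed simp_all

end
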